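(* Let $(X,\mathbb{P}_x)$, $x>0$, be the stable Lévy process killed (absorbed at $0$) when it first leaves the positive half-line, and let $\mathcal{K}$ be its generator. Let $f\in\mathfrak{D}_{\mathcal{K}}$ be such that the function $\tilde f$ on $\mathbb{R}$ defined by $\tilde f(x)=f(x)$ if $x>0$ and $\tilde f(x)=0$ if $x\le0$ belongs to $\mathfrak{D}_{\mathcal{A}}$. Then \[\mathcal{K}f(x)=\mathcal{A}\tilde f(x)-\frac{f(x)}{x^\alpha}\Big(k-\frac{c_-}{\alpha}\Big),\quad x>0,\qquad \mathcal{K}f(0)=0.\] The generator can also be written, for $x>0$, as \[\mathcal{K}f(x)=\int_0^\infty\frac{1}{x^\alpha}\big(f(ux)-f(x)-xf'(x)(u-1)\mathbf 1_{\{|u-1|<1\}}\big)\nu(u-1)\,du+a\,x^{1-\alpha}f'(x)-k\,x^{-\alpha}f(x).\]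
   Context: Fix $\alpha\in(0,2)$ and constants $c_+,c_-\ge 0$ with $c_++c_->0$. Under $P_x$ (expectation $E_x$), $X=(X_t)_{t\ge0}$ is a stable Lévy process of index $\alpha$ with càdlàg paths, started at $x\in\mathbb{R}$, with $E_0[e^{i\lambda X_t}]=e^{t\psi(\lambda)}$, where \[\psi(\lambda)=ia\lambda+\int_{\mathbb{R}}(e^{i\lambda y}-1-i\lambda y\mathbf 1_{\{|y|<1\}})\,\nu(y)\,dy,\qquad \nu(y)=c_+y^{-\alpha-1}\mathbf 1_{\{y>0\}}+c_-|y|^{-\alpha-1}\mathbf 1_{\{y<0\}}.\] If $\alpha\ne1$, then $a=\frac{c_+-c_-}{1-\alpha}$; if $\alpha=1$, the process is a symmetric Cauchy process, i.e. $c_+=c_-$ and $a=0$. It is assumed that neither $X$ nor $-X$ is a subordinator. Put $T=\inf\{t\ge0:X_t\le0\}$ and $\rho=P_0(X_1<0)$. The constant $k$: if $\alpha\neq1$, let $c=-(c_++c_-)\Gamma(-\alpha)\cos\frac{\pi\alpha}{2}$ and $\beta=\frac{c_+-c_-}{c_++c_-}$, and set $k=c\,(1+\beta^2\tan^2(\pi\alpha/2))^{1/2}\,\Gamma(\alpha)\sin(\pi\alpha\rho)/\pi$; if $\alpha=1$, set $k=c_+$ $(=c_-)$. Killed process: for $x>0$, $\mathbb{P}_x$ (expectation $\mathbb{E}_x$) is the law under $P_x$ of the process $X_t\mathbf 1_{\{t<T\}}$, $t\ge0$. Its state space is $[0,\infty)$ and $0$ is absorbing (started at $0$ it stays at $0$).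 Generators: $\mathcal{A}$, with domain $\mathfrak{D}_{\mathcal{A}}$, is the generator of $(X,P_x)$, $\mathcal{A}f(x)=\lim_{t\downarrow0}\frac1t(E_xf(X_t)-f(x))$, which has the form \[\mathcal{A}f(x)=af'(x)+\int_{\mathbb{R}}(f(x+y)-f(x)-yf'(x)\mathbf 1_{\{|y|<1\}})\,\nu(y)\,dy.\] Here $\mathfrak{D}_{\mathcal{A}}$ is understood as the set of bounded continuous $f:\mathbb{R}\to\mathbb{R}$, differentiable with the integral above absolutely convergent for every $x$, for which the limit exists and equals this expression for every $x\in\mathbb{R}$; it contains $C_b^2(\mathbb{R})$. $\mathcal{K}$ is the generator of the killed process, $\mathcal{K}f(x)=\lim_{t\downarrow0}\frac1t(\mathbb{E}_xf(X_t)-f(x))$, with domain $\mathfrak{D}_{\mathcal{K}}$ consisting of bounded measurable functions $f:[0,\infty)\to\mathbb{R}$ with $f(0)=0$ for which this limit exists for every $x\ge0$. *)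

theory Defs
  imports "HOL-Probability.Probability"
begin

(* Processes are indexed by real, but only times t >= 0 are ever constrained or used.
   The initial value is not fixed here, so that the notion applies under every P x. *)
definition levy_process :: "'a measure \<Rightarrow> (real \<Rightarrow> 'a \<Rightarrow> real) \<Rightarrow> bool" where
  "levy_process M X \<longleftrightarrow>
     prob_space M \<and>
     (\<forall>t\<ge>0. X t \<in> borel_measurable M) \<and>
     (\<forall>\<omega>\<in>space M. \<forall>t\<ge>0. ((\<lambda>s. X s \<omega>) \<longlongrightarrow> X t \<omega>) (at_right t)) \<and>
     (\<forall>\<omega>\<in>space M. \<forall>t>0. \<exists>l. ((\<lambda>s. X s \<omega>) \<longlongrightarrow> l) (at_left t)) \<and>
     (\<forall>s\<ge>0. \<forall>h\<ge>0. distr M borel (\<lambda>\<omega>. X (s + h) \<omega> - X s \<omega>)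
                   = distr M borel (\<lambda>\<omega>. X h \<omega> - X 0 \<omega>)) \<and>
     (\<forall>ts::nat \<Rightarrow> real. 0 \<le> ts 0 \<and> incseq ts \<longrightarrow>
        (\<forall>n. prob_space.indep_vars M (\<lambda>_. borel)
               (\<lambda>i \<omega>. X (ts (Suc i)) \<omega> - X (ts i) \<omega>) {..<n}))"

definition subordinator :: "'a measure \<Rightarrow> (real \<Rightarrow> 'a \<Rightarrow> real) \<Rightarrow> bool" where
  "subordinator M X \<longleftrightarrow>
     levy_process M X \<and> (AE \<omega> in M. mono_on {0..} (\<lambda>t. X t \<omega>))"

definition stable_density :: "real \<Rightarrow> real \<Rightarrow> real \<Rightarrow> real \<Rightarrow> real" where
  "stable_density \<alpha> cp cm y =
     (if y > 0 then cp * y powr (-\<alpha> - 1)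
      else if y < 0 then cm * \<bar>y\<bar> powr (-\<alpha> - 1) else 0)"

definition stable_drift :: "real \<Rightarrow> real \<Rightarrow> real \<Rightarrow> real" where
  "stable_drift \<alpha> cp cm = (if \<alpha> = 1 then 0 else (cp - cm) / (1 - \<alpha>))"

definition stable_exponent :: "real \<Rightarrow> real \<Rightarrow> real \<Rightarrow> real \<Rightarrow> complex" where
  "stable_exponent \<alpha> cp cm l =
     \<i> * of_real (stable_drift \<alpha> cp cm * l) +
     (CLINT y|lborel.
        (exp (\<i> * of_real (l * y)) - 1 - \<i> * of_real (l * y * indicator {y. \<bar>y\<bar> < 1} y))
        * of_real (stable_density \<alpha> cp cm y))"

(* For x = 0 the last conjunct reads E_0 exp(i l X_t) = exp(t psi(l)); for the other
   starting points it says that P x is the law of x + X under P 0. *)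
definition stable_family ::
    "real \<Rightarrow> real \<Rightarrow> real \<Rightarrow> (real \<Rightarrow> 'a measure) \<Rightarrow> (real \<Rightarrow> 'a \<Rightarrow> real) \<Rightarrow> bool" where
  "stable_family \<alpha> cp cm P X \<longleftrightarrow>
     (\<forall>x. sets (P x) = sets (P 0)) \<and>
     (\<forall>x. levy_process (P x) X) \<and>
     (\<forall>x. AE \<omega> in P x. X 0 \<omega> = x) \<and>
     (\<forall>x. \<forall>t\<ge>0. \<forall>l. char (distr (P x) borel (\<lambda>\<omega>. X t \<omega> - x)) l
                       = exp (of_real t * stable_exponent \<alpha> cp cm l))"

definition neg_prob :: "(real \<Rightarrow> 'a measure) \<Rightarrow> (real \<Rightarrow> 'a \<Rightarrow> real) \<Rightarrow> real" where
  "neg_prob P X = measure (P 0) {\<omega> \<in> space (P 0). X 1 \<omega> < 0}"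

definition stable_scale :: "real \<Rightarrow> real \<Rightarrow> real \<Rightarrow> real" where
  "stable_scale \<alpha> cp cm = - (cp + cm) * Gamma (-\<alpha>) * cos (pi * \<alpha> / 2)"

definition stable_skew :: "real \<Rightarrow> real \<Rightarrow> real" where
  "stable_skew cp cm = (cp - cm) / (cp + cm)"

definition kill_const :: "real \<Rightarrow> real \<Rightarrow> real \<Rightarrow> real \<Rightarrow> real" where
  "kill_const \<alpha> cp cm \<rho> =
     (if \<alpha> = 1 then cp
      else stable_scale \<alpha> cp cm
           * sqrt (1 + (stable_skew cp cm)\<^sup>2 * (tan (pi * \<alpha> / 2))\<^sup>2)
           * Gamma \<alpha> * sin (pi * \<alpha> * \<rho>) / pi)"

definition exit_time :: "(real \<Rightarrow> 'a \<Rightarrow> real) \<Rightarrow> 'a \<Rightarrow> ereal" where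
  "exit_time X \<omega> = Inf {ereal t |t. 0 \<le> t \<and> X t \<omega> \<le> 0}"

definition killed :: "(real \<Rightarrow> 'a \<Rightarrow> real) \<Rightarrow> real \<Rightarrow> 'a \<Rightarrow> real" where
  "killed X t \<omega> = (if ereal t < exit_time X \<omega> then X t \<omega> else 0)"

definition levy_integrand ::
    "real \<Rightarrow> real \<Rightarrow> real \<Rightarrow> (real \<Rightarrow> real) \<Rightarrow> real \<Rightarrow> real \<Rightarrow> real" where
  "levy_integrand \<alpha> cp cm f x y =
     (f (x + y) - f x - y * deriv f x * indicator {y. \<bar>y\<bar> < 1} y) * stable_density \<alpha> cp cm y"

definition free_quotient ::
    "(real \<Rightarrow> 'a measure) \<Rightarrow> (real \<Rightarrow> 'a \<Rightarrow> real) \<Rightarrow> (real \<Rightarrow> real) \<Rightarrow> real \<Rightarrow> real \<Rightarrow> real" where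
  "free_quotient P X f x t = ((LINT \<omega>|P x. f (X t \<omega>)) - f x) / t"

definition generator ::
    "(real \<Rightarrow> 'a measure) \<Rightarrow> (real \<Rightarrow> 'a \<Rightarrow> real) \<Rightarrow> (real \<Rightarrow> real) \<Rightarrow> real \<Rightarrow> real" where
  "generator P X f x = Lim (at_right 0) (free_quotient P X f x)"

definition generator_domain ::
    "real \<Rightarrow> real \<Rightarrow> real \<Rightarrow> (real \<Rightarrow> 'a measure) \<Rightarrow> (real \<Rightarrow> 'a \<Rightarrow> real) \<Rightarrow> (real \<Rightarrow> real) set" where
  "generator_domain \<alpha> cp cm P X =
     {f. bounded (range f) \<and> continuous_on UNIV f \<and>
         (\<forall>x. f differentiable (at x)) \<and>
         (\<forall>x. integrable lborel (levy_integrand \<alpha> cp cm f x)) \<and>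
         (\<forall>x. (free_quotient P X f x \<longlongrightarrow>
                 stable_drift \<alpha> cp cm * deriv f x
                 + (LINT y|lborel. levy_integrand \<alpha> cp cm f x y)) (at_right 0))}"

(* The event {t < T} is only known to be measurable up to P x-null sets (T is the debut of
   a closed set by a cadlag process), hence the completion: on a non-complete space the
   Bochner integral of a function that is merely a.e. measurable would be 0 by convention.
   For x = 0 one has T = 0 a.s., so the killed process stays at 0. *)
definition killed_quotient ::
    "(real \<Rightarrow> 'a measure) \<Rightarrow> (real \<Rightarrow> 'a \<Rightarrow> real) \<Rightarrow> (real \<Rightarrow> real) \<Rightarrow> real \<Rightarrow> real \<Rightarrow> real" where
  "killed_quotient P X f x t = ((LINT \<omega>|completion (P x). f (killed X t \<omega>)) - f x) / t"

definition killed_generator ::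
    "(real \<Rightarrow> 'a measure) \<Rightarrow> (real \<Rightarrow> 'a \<Rightarrow> real) \<Rightarrow> (real \<Rightarrow> real) \<Rightarrow> real \<Rightarrow> real" where
  "killed_generator P X f x = Lim (at_right 0) (killed_quotient P X f x)"

(* Functions on [0,\<infinity>) are represented by total functions whose values on the negative
   half-line are irrelevant. *)
definition killed_generator_domain ::
    "(real \<Rightarrow> 'a measure) \<Rightarrow> (real \<Rightarrow> 'a \<Rightarrow> real) \<Rightarrow> (real \<Rightarrow> real) set" where
  "killed_generator_domain P X =
     {f. bounded (f ` {0..}) \<and> f \<in> borel_measurable (restrict_space borel {0..}) \<and> f 0 = 0 \<and>
         (\<forall>x\<ge>0. \<exists>l. (killed_quotient P X f x \<longlongrightarrow> l) (at_right 0))}"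

definition zero_ext :: "(real \<Rightarrow> real) \<Rightarrow> real \<Rightarrow> real" where
  "zero_ext f x = (if x > 0 then f x else 0)"

definition killed_integrand ::
    "real \<Rightarrow> real \<Rightarrow> real \<Rightarrow> (real \<Rightarrow> real) \<Rightarrow> real \<Rightarrow> real \<Rightarrow> real" where
  "killed_integrand \<alpha> cp cm f x u =
     1 / x powr \<alpha>
     * (f (u * x) - f x - x * deriv f x * (u - 1) * indicator {u. \<bar>u - 1\<bar> < 1} u)
     * stable_density \<alpha> cp cm (u - 1)"

end

theory Submission
  imports Defs "HOL-Real_Asymp.Real_Asymp"
begin

text \<open>
  The two formulas agree with \<open>\<A> f~\<close> because the constant \<open>k\<close> equals \<open>c\<^sub>- / \<alpha>\<close>.  For
  \<open>\<alpha> \<noteq> 1\<close> the exponent is \<open>\<psi>(\<lambda>) = \<lambda>\<^sup>\<alpha> \<psi>(1)\<close> for \<open>\<lambda> > 0\<close>, and integrating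
  \<open>Im (exp (\<psi>(\<lambda>))) / \<lambda>\<close> (Gil-Pelaez inversion) gives \<open>\<pi> \<alpha> \<rho> = \<pi> \<alpha> / 2 + arg (- \<psi>(1))\<close>; the value of \<open>k\<close>
  is then Euler's reflection formula.

  From \<open>x > 0\<close>, a path that has left the positive half-line by time \<open>t\<close> (probability \<open>O(t)\<close>) is at a
  level above \<open>d > 0\<close> at time \<open>t\<close> only with probability \<open>O(t\<^sup>2)\<close>, as it has to make two jumps; elsewhere
  \<open>f~\<close> is small by continuity at \<open>0\<close>.  Hence killing does not change the limit of the difference
  quotients.  The event of having left is measurable up to a null set since the infimum of the
  path over \<open>[0, t]\<close> has no atom at the boundary: it is attained after a short time \<open>s\<close> with
  probability near \<open>1\<close>, and then contains the independent, atomless summand \<open>X\<^sub>s\<close>.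

  The second formula follows from the substitution \<open>y = x (u - 1)\<close>; the part \<open>u < 0\<close> of the integral
  produces the killing term.
\<close>

section \<open>Integrals over the half-line\<close>

text \<open>The value c_-/\<alpha> of k has a probabilistic reading: from x the process jumps below
  0 at rate c_- x^(-\<alpha>) / \<alpha>, and extending f by 0 already charges f(x) for each such
  jump, so killing adds nothing further. The obstacle is that exit depends on uncountably many
  times, while X is given only through the laws of its increments. Statements about the infimum are
  therefore reduced to walks on dyadic grids, with bounds that do not depend on the mesh;
  independence of the increments of these walks takes the place of the strong Markov property. The
  analytic input on the laws is the characteristic function: the kernel \<epsilon>^2 / (\<epsilon>^2
  + z^2), a mixture of cosines, turns growth of \<psi> into tail estimates linear in time and decay
  of exp (t \<psi>) into the absence of atoms. Closed forms of integrals come from writing a power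
  or a quotient as an integral of exponentials or cosines and exchanging the order in an absolutely
  convergent double integral. A measure of its own for the open half-line keeps indicators out of
  these exchanges.\<close>

abbreviation lpos :: "real measure" where
  "lpos \<equiv> restrict_space lborel {0<..}"

lemma sigma_finite_lpos: "sigma_finite_measure lpos"
  by (rule sigma_finite_measure_restrict_space) (auto intro: lborel.sigma_finite_measure_axioms)

lemma measurable_lpos: "f \<in> borel_measurable borel \<Longrightarrow> f \<in> borel_measurable lpos"
  by (rule measurable_restrict_space1) simp

lemma has_bochner_integral_lpos_iff:
  fixes f :: "real \<Rightarrow> 'b::{banach, second_countable_topology}"
  shows "has_bochner_integral lpos f I \<longleftrightarrow> has_bochner_integral lborel (\<lambda>x. indicator {0<..} x *\<^sub>R f x) I"
  by (simp add: has_bochner_integral_restrict_space)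

lemma integrable_lpos_iff:
  fixes f :: "real \<Rightarrow> 'b::{banach, second_countable_topology}"
  shows "integrable lpos f \<longleftrightarrow> set_integrable lborel {0<..} f"
  unfolding set_integrable_def by (rule integrable_restrict_space) simp

lemma integral_lpos:
  fixes f :: "real \<Rightarrow> 'b::{banach, second_countable_topology}"
  shows "integral\<^sup>L lpos f = (LINT x:{0<..}|lborel. f x)"
  unfolding set_lebesgue_integral_def by (rule integral_restrict_space) simp

lemma has_bochner_integral_lpos_cong:
  assumes "\<And>x. x > 0 \<Longrightarrow> f x = g x" "a = b"
  shows "has_bochner_integral lpos f a \<longleftrightarrow> has_bochner_integral lpos g b"
  using assms by (intro has_bochner_integral_cong) (auto simp: space_restrict_space)

lemma integrable_lpos_cong:
  assumes "\<And>x. x > 0 \<Longrightarrow> f x = g x"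
  shows "integrable lpos f \<longleftrightarrow> integrable lpos g"
  using assms by (intro Bochner_Integration.integrable_cong) (auto simp: space_restrict_space)

lemma integral_lpos_cong:
  assumes "\<And>x. x > 0 \<Longrightarrow> f x = g x"
  shows "integral\<^sup>L lpos f = integral\<^sup>L lpos g"
  using assms by (intro Bochner_Integration.integral_cong) (auto simp: space_restrict_space)

lemma integrable_lpos_bound:
  fixes f :: "real \<Rightarrow> 'b::{banach, second_countable_topology}" and g :: "real \<Rightarrow> real"
  assumes "integrable lpos g" "f \<in> borel_measurable borel" "\<And>x. x > 0 \<Longrightarrow> norm (f x) \<le> g x"
  shows "integrable lpos f"
proof (rule Bochner_Integration.integrable_bound[OF assms(1)])
  show "f \<in> borel_measurable lpos" by (rule measurable_lpos) fact
  have "norm (f x) \<le> norm (g x)" if "x > 0" for x using assms(3)[OF that] by simp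
  then show "AE x in lpos. norm (f x) \<le> norm (g x)"
    by (intro AE_I2) (auto simp: space_restrict_space)
qed

lemma has_bochner_integral_lpos_scale:
  fixes f :: "real \<Rightarrow> 'b::{banach, second_countable_topology}"
  assumes "c > 0"
  shows "has_bochner_integral lpos f I \<longleftrightarrow> has_bochner_integral lpos (\<lambda>x. f (c * x)) (I /\<^sub>R c)"
proof -
  have "has_bochner_integral lborel (\<lambda>x. indicator {0<..} x *\<^sub>R f x) I \<longleftrightarrow>
     has_bochner_integral lborel (\<lambda>x. indicator {0<..} (0 + c * x) *\<^sub>R f (0 + c * x)) (I /\<^sub>R \<bar>c\<bar>)"
    using assms by (intro lborel_has_bochner_integral_real_affine_iff) simp
  also have "(\<lambda>x. indicator {0<..} (0 + c * x) *\<^sub>R f (0 + c * x)) = (\<lambda>x. indicator {0<..} x *\<^sub>R f (c * x))"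
    using assms by (auto simp: fun_eq_iff indicator_def zero_less_mult_iff)
  finally show ?thesis using assms by (simp add: has_bochner_integral_lpos_iff)
qed

section \<open>Powers, exponentials and trigonometric transforms\<close>

lemma has_bochner_integral_lpos_powr_lt1:
  assumes "p > -1"
  shows "has_bochner_integral lpos (\<lambda>y. indicator {..<1} y * y powr p) (1 / (p + 1))"
proof -
  note ftc = interval_integral_FTC_nonneg[of 0 1 "\<lambda>y. y powr (p+1) / (p+1)" "\<lambda>y. y powr p" 0 "1 / (p+1)"]
  have d: "((\<lambda>y. y powr (p+1) / (p+1)) has_real_derivative x powr p) (at x)" if "0 < x" for x
    using that assms by (auto intro!: derivative_eq_intros)
  have c: "isCont (\<lambda>y. y powr p) x" if "0 < x" for x
    using that by (intro continuous_intros) auto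
  have "((\<lambda>y. y powr (p+1) / (p+1)) \<longlongrightarrow> 0) (at_right 0)"
    using assms by real_asymp
  then have l: "(((\<lambda>y. y powr (p+1) / (p+1)) \<circ> real_of_ereal) \<longlongrightarrow> 0) (at_right 0)"
    by (simp add: ereal_tendsto_simps zero_ereal_def)
  have "((\<lambda>y. y powr (p+1) / (p+1)) \<longlongrightarrow> 1 powr (p+1) / (p+1)) (at_left 1)"
    using assms by (intro tendsto_intros) auto
  then have r: "(((\<lambda>y. y powr (p+1) / (p+1)) \<circ> real_of_ereal) \<longlongrightarrow> 1 / (p+1)) (at_left 1)"
    by (simp add: ereal_tendsto_simps one_ereal_def)
  have 1: "set_integrable lborel (einterval 0 1) (\<lambda>y. y powr p)"
    by (rule ftc(1)) (use d c l r in auto)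
  have 2: "(LBINT y=0..1. y powr p) = 1/(p+1) - 0"
    by (rule ftc(2)) (use d c l r in auto)
  have e: "einterval 0 1 = {0<..<1::real}"
    by (auto simp: einterval_def zero_ereal_def one_ereal_def)
  have "(LBINT y=0..1. y powr p) = (LINT y:{0<..<1}|lborel. y powr p)"
    unfolding interval_lebesgue_integral_def e by (simp add: zero_ereal_def one_ereal_def)
  then have "has_bochner_integral lborel (\<lambda>y. indicator {0<..<1} y *\<^sub>R y powr p) (1/(p+1))"
    using 1 2 unfolding e set_integrable_def set_lebesgue_integral_def by (simp add: has_bochner_integral_iff)
  also have "(\<lambda>y. indicator {0<..<1} y *\<^sub>R y powr p) = (\<lambda>y. indicator {0<..} y *\<^sub>R (indicator {..<1} y * y powr p))"
    by (auto simp: fun_eq_iff indicator_def)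
  finally show ?thesis by (simp add: has_bochner_integral_lpos_iff)
qed

lemma has_bochner_integral_lpos_powr_ge1:
  assumes "p < -1"
  shows "has_bochner_integral lpos (\<lambda>y. indicator {1..} y * y powr p) (- 1 / (p + 1))"
proof -
  note ftc = interval_integral_FTC_nonneg[of 1 \<infinity> "\<lambda>y. y powr (p+1) / (p+1)" "\<lambda>y. y powr p" "1 / (p+1)" 0]
  have d: "((\<lambda>y. y powr (p+1) / (p+1)) has_real_derivative x powr p) (at x)" if "1 < x" for x
    using that assms by (auto intro!: derivative_eq_intros)
  have c: "isCont (\<lambda>y. y powr p) x" if "1 < x" for x
    using that by (intro continuous_intros) auto
  have "((\<lambda>y. y powr (p+1) / (p+1)) \<longlongrightarrow> 0) at_top"
    using assms by real_asymp
  then have r: "(((\<lambda>y. y powr (p+1) / (p+1)) \<circ> real_of_ereal) \<longlongrightarrow> 0) (at_left \<infinity>)"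
    by (simp add: ereal_tendsto_simps)
  have "((\<lambda>y. y powr (p+1) / (p+1)) \<longlongrightarrow> 1 powr (p+1) / (p+1)) (at_right 1)"
    using assms by (intro tendsto_intros) auto
  then have l: "(((\<lambda>y. y powr (p+1) / (p+1)) \<circ> real_of_ereal) \<longlongrightarrow> 1 / (p+1)) (at_right 1)"
    by (simp add: ereal_tendsto_simps one_ereal_def)
  have 1: "set_integrable lborel (einterval 1 \<infinity>) (\<lambda>y. y powr p)"
    by (rule ftc(1)) (use d c l r in auto)
  have 2: "(LBINT y=1..\<infinity>. y powr p) = 0 - 1/(p+1)"
    by (rule ftc(2)) (use d c l r in auto)
  have e: "einterval 1 \<infinity> = {1::real<..}"
    by (auto simp: einterval_def zero_ereal_def one_ereal_def)
  have "(LBINT y=1..\<infinity>. y powr p) = (LINT y:{1<..}|lborel. y powr p)"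
    unfolding interval_lebesgue_integral_def e by (simp add: zero_ereal_def one_ereal_def)
  then have "has_bochner_integral lborel (\<lambda>y. indicator {1<..} y *\<^sub>R y powr p) (- 1/(p+1))"
    using 1 2 unfolding e set_integrable_def set_lebesgue_integral_def by (simp add: has_bochner_integral_iff)
  \<comment> \<open>The antiderivative gives the open ray; adding the null point 1 makes
    \<open>{..<1}\<close> and \<open>{1..}\<close> complementary, as the later splittings at 1
    require.\<close>
  also have "?this \<longleftrightarrow> has_bochner_integral lborel (\<lambda>y. indicator {0<..} y *\<^sub>R (indicator {1..} y * y powr p)) (- 1/(p+1))"
    using AE_lborel_singleton[of 1]
    by (intro has_bochner_integral_cong_AE) (auto simp: indicator_def elim!: eventually_mono)
  finally show ?thesis by (simp add: has_bochner_integral_lpos_iff)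
qed

lemma has_bochner_integral_lpos_powr_exp:
  assumes "p > -1" "s > 0"
  shows "has_bochner_integral lpos (\<lambda>y. y powr p * exp (- (s * y))) (Gamma (p + 1) * s powr (- p - 1))"
proof -
  have "has_bochner_integral lborel (\<lambda>y. indicator {0..} y * y powr p / exp y) (Gamma (p + 1))"
  proof (rule has_bochner_integral_nn_integral)
    show "(\<integral>\<^sup>+ x. ennreal (indicat_real {0..} x * x powr p / exp x) \<partial>lborel) = ennreal (Gamma (p + 1))"
      using Gamma_conv_nn_integral_real[of "p + 1"] assms(1) by simp
  qed (use assms(1) Gamma_real_pos[of "p+1"] in auto)
  also have "?this \<longleftrightarrow> has_bochner_integral lborel (\<lambda>y. indicator {0<..} y *\<^sub>R (y powr p * exp (- y))) (Gamma (p + 1))"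
    by (intro has_bochner_integral_cong) (auto simp: indicator_def exp_minus field_simps)
  finally have "has_bochner_integral lpos (\<lambda>y. y powr p * exp (- y)) (Gamma (p + 1))"
    by (simp add: has_bochner_integral_lpos_iff)
  then have "has_bochner_integral lpos (\<lambda>y. (s * y) powr p * exp (- (s * y))) (Gamma (p + 1) /\<^sub>R s)"
    by (subst (asm) has_bochner_integral_lpos_scale[OF assms(2)])
  then have "has_bochner_integral lpos (\<lambda>y. s powr (-p) * ((s * y) powr p * exp (- (s * y)))) (s powr (-p) * (Gamma (p + 1) /\<^sub>R s))"
    by (rule has_bochner_integral_mult_right)
  also have "?this \<longleftrightarrow> ?thesis"
    using assms by (intro has_bochner_integral_lpos_cong)
      (auto simp: powr_mult powr_minus powr_diff field_simps)
  finally show ?thesis .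
qed

lemma has_bochner_integral_lpos_exp:
  assumes "s > 0"
  shows "has_bochner_integral lpos (\<lambda>y. exp (- (s * y))) (1 / s)"
proof -
  have "has_bochner_integral lpos (\<lambda>y. y powr 0 * exp (- (s * y))) (Gamma (0 + 1) * s powr (- 0 - 1))"
    using assms by (intro has_bochner_integral_lpos_powr_exp) auto
  also have "?this \<longleftrightarrow> ?thesis"
    using assms by (intro has_bochner_integral_lpos_cong) (auto simp: powr_minus_divide)
  finally show ?thesis .
qed

lemma has_bochner_integral_lpos_times_exp:
  assumes "s > 0"
  shows "has_bochner_integral lpos (\<lambda>y. y * exp (- (s * y))) (1 / s\<^sup>2)"
proof -
  have "has_bochner_integral lpos (\<lambda>y. y powr 1 * exp (- (s * y))) (Gamma (1 + 1) * s powr (- 1 - 1))"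
    using assms by (intro has_bochner_integral_lpos_powr_exp) auto
  also have "?this \<longleftrightarrow> ?thesis"
    using assms Gamma_fact[of 1, where 'a=real]
    by (intro has_bochner_integral_lpos_cong) (auto simp: powr_minus_divide)
  finally show ?thesis .
qed

lemma integrable_lpos_exp_bounded:
  fixes f :: "real \<Rightarrow> 'b::{banach, second_countable_topology}"
  assumes "s > 0" "f \<in> borel_measurable borel" "\<And>y. norm (f y) \<le> C"
  shows "integrable lpos (\<lambda>y. exp (- (s * y)) *\<^sub>R f y)"
proof (rule integrable_lpos_bound[where g = "\<lambda>y. C * exp (- (s * y))"])
  show "integrable lpos (\<lambda>y. C * exp (- (s * y)))"
    using has_bochner_integral_lpos_exp[OF assms(1)] by (auto simp: has_bochner_integral_iff)
qed (use assms in \<open>auto simp: mult.commute intro!: mult_left_mono\<close>)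

text \<open>The antiderivative is \<open>- exp (- z * of_real y) / z\<close> with z = s - iu, which
  vanishes at infinity because Re z = s > 0. Real and imaginary parts of the result are the cosine
  and sine transforms.\<close>

lemma has_bochner_integral_lpos_exp_cis:
  assumes "s > 0"
  shows "has_bochner_integral lpos (\<lambda>y. exp (- (s * y)) *\<^sub>R cis (u * y)) (1 / Complex s (-u))"
proof -
  have int: "integrable lpos (\<lambda>y. exp (- (s * y)) *\<^sub>R cis (u * y))"
    by (intro integrable_lpos_exp_bounded[where C = 1]) (use assms in \<open>auto intro!: borel_measurable_continuous_onI continuous_intros\<close>)
  define z where "z = Complex s (-u)"
  have z: "z \<noteq> 0" using assms by (auto simp: z_def complex_eq_iff)
  have eq: "exp (- (s * y)) *\<^sub>R cis (u * y) = exp (- z * of_real y)" for y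
    by (subst exp_eq_polar) (simp add: z_def scaleR_conv_of_real)
  have e: "einterval 0 \<infinity> = {0::real<..}"
    by (auto simp: einterval_def zero_ereal_def)
  have "(LBINT y=0..\<infinity>. exp (- z * of_real y)) = 0 - (- 1 / z)"
  proof (rule interval_integral_FTC_integrable[where F = "\<lambda>y. - exp (- z * of_real y) / z"])
    show "((\<lambda>y. - exp (- z * of_real y) / z) has_vector_derivative exp (- z * of_real x)) (at x)" for x
      using z by (auto intro!: derivative_eq_intros has_vector_derivative_real_field)
    show "set_integrable lborel (einterval 0 \<infinity>) (\<lambda>y. exp (- z * of_real y))"
      using int unfolding e integrable_lpos_iff eq .
    have "((\<lambda>y. - exp (- z * of_real y) / z) \<longlongrightarrow> - exp (- z * of_real 0) / z) (at_right 0)"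
      using z by (intro tendsto_intros)
    then show "(((\<lambda>y. - exp (- z * of_real y) / z) \<circ> real_of_ereal) \<longlongrightarrow> - 1 / z) (at_right 0)"
      unfolding zero_ereal_def by (simp add: ereal_tendsto_simps)
    have "((\<lambda>y. exp (- (s * y)) / norm z) \<longlongrightarrow> 0) at_top"
      using assms z by real_asymp
    then have "((\<lambda>y. - exp (- z * of_real y) / z) \<longlongrightarrow> 0) at_top"
      by (subst tendsto_norm_zero_iff[symmetric]) (simp add: norm_divide z_def)
    then show "(((\<lambda>y. - exp (- z * of_real y) / z) \<circ> real_of_ereal) \<longlongrightarrow> 0) (at_left \<infinity>)"
      by (simp add: ereal_tendsto_simps)
  qed (auto simp: zero_ereal_def intro!: continuous_intros)
  then have "integral\<^sup>L lpos (\<lambda>y. exp (- (s * y)) *\<^sub>R cis (u * y)) = 1 / z"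
    unfolding interval_lebesgue_integral_def e integral_lpos eq by (simp add: zero_ereal_def)
  then show ?thesis using int by (simp add: has_bochner_integral_iff z_def)
qed

lemma has_bochner_integral_lpos_exp_cos:
  "s > 0 \<Longrightarrow> has_bochner_integral lpos (\<lambda>y. exp (- (s * y)) * cos (u * y)) (s / (s\<^sup>2 + u\<^sup>2))"
  using has_bochner_integral_bounded_linear[OF bounded_linear_Re has_bochner_integral_lpos_exp_cis[of s u]]
  by (simp add: Re_divide)

lemma has_bochner_integral_lpos_exp_sin:
  "s > 0 \<Longrightarrow> has_bochner_integral lpos (\<lambda>y. exp (- (s * y)) * sin (u * y)) (u / (s\<^sup>2 + u\<^sup>2))"
  using has_bochner_integral_bounded_linear[OF bounded_linear_Im has_bochner_integral_lpos_exp_cis[of s u]]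
  by (simp add: Im_divide)



text \<open>Fubini in the form used throughout: both inner integrals are known in closed form, and
  integrability of \<open>h\<close> is part of the conclusion.\<close>

lemma (in pair_sigma_finite) has_bochner_integral_swap:
  fixes f :: "'a \<Rightarrow> 'b \<Rightarrow> 'c::{banach, second_countable_topology}"
  assumes "case_prod f \<in> borel_measurable (M1 \<Otimes>\<^sub>M M2)"
    and 1: "\<And>x. x \<in> space M1 \<Longrightarrow> has_bochner_integral M2 (f x) (g x)"
    and 2: "\<And>y. y \<in> space M2 \<Longrightarrow> has_bochner_integral M1 (\<lambda>x. f x y) (h y)"
    and "integrable M1 (\<lambda>x. \<integral>y. norm (f x y) \<partial>M2)"
  shows "has_bochner_integral M2 h (integral\<^sup>L M1 g)"
proof -
  have int: "integrable (M1 \<Otimes>\<^sub>M M2) (case_prod f)"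
    by (rule Fubini_integrable) (use assms in \<open>auto simp: has_bochner_integral_iff\<close>)
  have "integrable M2 (\<lambda>y. \<integral>x. f x y \<partial>M1)" using integrable_snd[OF int] .
  also have "?this \<longleftrightarrow> integrable M2 h"
    using 2 by (intro Bochner_Integration.integrable_cong) (auto simp: has_bochner_integral_iff)
  finally have "integrable M2 h" .
  moreover have "integral\<^sup>L M2 h = (\<integral>y. \<integral>x. f x y \<partial>M1 \<partial>M2)"
    using 2 by (intro Bochner_Integration.integral_cong) (auto simp: has_bochner_integral_iff)
  moreover have "(\<integral>x. \<integral>y. f x y \<partial>M2 \<partial>M1) = integral\<^sup>L M1 g"
    using 1 by (intro Bochner_Integration.integral_cong) (auto simp: has_bochner_integral_iff)
  ultimately show ?thesis using Fubini_integral[OF int] by (simp add: has_bochner_integral_iff)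
qed

lemma pair_sigma_finite_lpos: "sigma_finite_measure M \<Longrightarrow> pair_sigma_finite M lpos"
  by (simp add: pair_sigma_finite_def sigma_finite_lpos)

lemma measurable_lpos_pair:
  assumes "case_prod f \<in> borel_measurable (borel \<Otimes>\<^sub>M borel)" "(\<lambda>x. x) \<in> M \<rightarrow>\<^sub>M borel"
  shows "case_prod f \<in> borel_measurable (M \<Otimes>\<^sub>M lpos)"
proof -
  have [measurable]: "(\<lambda>x. x) \<in> lpos \<rightarrow>\<^sub>M borel" by (rule measurable_lpos) simp
  have "(\<lambda>p. (fst p, snd p)) \<in> M \<Otimes>\<^sub>M lpos \<rightarrow>\<^sub>M borel \<Otimes>\<^sub>M borel"
    by (intro measurable_Pair measurable_compose[OF measurable_fst assms(2)]
        measurable_compose[OF measurable_snd measurable_lpos]) auto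
  from measurable_compose[OF this assms(1)] show ?thesis by (simp add: split_beta')
qed

lemma einterval_0_infty: "einterval 0 \<infinity> = {0<..}"
  by (auto simp: einterval_def zero_ereal_def)

lemma integral_lpos_eq_interval: "integral\<^sup>L lpos f = (LBINT y=0..\<infinity>. f y)"
  unfolding interval_lebesgue_integral_def einterval_0_infty integral_lpos by simp

text \<open>The substitution theorem asks for integrability on both sides. That of the new integrand
  is obtained by substituting back with the inverse power 1/r in its absolute value, where
  nonnegativity makes integrability a conclusion.\<close>

lemma has_bochner_integral_lpos_subst_powr:
  fixes f :: "real \<Rightarrow> real"
  assumes "r > 0" "\<And>x. x > 0 \<Longrightarrow> isCont f x" "has_bochner_integral lpos f I"
  shows "has_bochner_integral lpos (\<lambda>x. r * x powr (r - 1) * f (x powr r)) I"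
proof -
  define g where "g = (\<lambda>x. r * x powr (r - 1) * f (x powr r))"
  have lim0: "((ereal \<circ> (\<lambda>x. x powr q) \<circ> real_of_ereal) \<longlongrightarrow> 0) (at_right 0)" if "q > 0" for q
  proof -
    have "((\<lambda>x::real. x powr q) \<longlongrightarrow> 0) (at_right 0)" using that by real_asymp
    then show ?thesis unfolding zero_ereal_def comp_assoc[symmetric] by (simp add: ereal_tendsto_simps)
  qed
  have liminf: "((ereal \<circ> (\<lambda>x. x powr q) \<circ> real_of_ereal) \<longlongrightarrow> \<infinity>) (at_left \<infinity>)" if "q > 0" for q
  proof -
    have "filterlim (\<lambda>x::real. x powr q) at_top at_top" using that by real_asymp
    then show ?thesis by (simp add: ereal_tendsto_simps)
  qed
  have contg: "isCont g x" if "x > 0" for x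
  proof -
    have "isCont (\<lambda>x. x powr r) x" using that by (intro continuous_intros) auto
    then have "isCont (\<lambda>x. f (x powr r)) x"
      by (rule isCont_o2) (use that assms(2) in auto)
    then show ?thesis unfolding g_def using that by (intro continuous_intros) auto
  qed
  have intf: "set_integrable lborel (einterval 0 \<infinity>) f"
    using assms(3) by (simp add: einterval_0_infty integrable_lpos_iff[symmetric] has_bochner_integral_iff)
  have "set_integrable lborel (einterval 0 \<infinity>) (\<lambda>x. \<bar>g x\<bar>)"
  proof (rule interval_integral_substitution_nonneg(1)[where g = "\<lambda>x. x powr (1/r)" and g' = "\<lambda>x. 1/r * x powr (1/r - 1)" and a = 0 and b = \<infinity>])
    show "((\<lambda>x. x powr (1/r)) has_real_derivative 1/r * x powr (1/r - 1)) (at x)" if "0 < ereal x" for x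
      using that by (auto intro!: derivative_eq_intros)
    show "isCont (\<lambda>x. \<bar>g x\<bar>) (x powr (1/r))" if "0 < ereal x" for x
      using that contg[of "x powr (1/r)"] by (intro continuous_intros) auto
    have "\<bar>g (x powr (1/r))\<bar> * (1/r * x powr (1/r - 1)) = \<bar>f x\<bar>" if "x > 0" for x
    proof -
      have "r * (x powr (1/r)) powr (r - 1) * (1/r * x powr (1/r - 1)) = 1"
        using that \<open>r > 0\<close> by (simp add: powr_powr powr_add[symmetric] field_simps)
      moreover have "(x powr (1/r)) powr r = x" using that \<open>r > 0\<close> by (simp add: powr_powr)
      ultimately show ?thesis unfolding g_def using \<open>r > 0\<close>
        by (simp add: abs_mult mult_ac)
    qed
    then show "set_integrable lborel (einterval 0 \<infinity>) (\<lambda>x. \<bar>g (x powr (1/r))\<bar> * (1/r * x powr (1/r - 1)))"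
      using set_integrable_abs[OF intf] unfolding einterval_0_infty
      by (subst set_integrable_cong[where f' = "\<lambda>x. \<bar>f x\<bar>"]) auto
  qed (use assms lim0[of "1/r"] liminf[of "1/r"] in \<open>auto intro!: continuous_intros\<close>)
  then have intg: "set_integrable lborel (einterval 0 \<infinity>) g"
  proof (subst (asm) set_integrable_abs_iff)
    show "set_borel_measurable lborel (einterval 0 \<infinity>) g"
      unfolding set_borel_measurable_def einterval_0_infty
      using contg borel_measurable_continuous_on_indicator[of "{0<..}" g]
      by (simp add: continuous_at_imp_continuous_on)
  qed
  have "(LBINT x=0..\<infinity>. f x) = (LBINT x=0..\<infinity>. (r * x powr (r - 1)) *\<^sub>R f (x powr r))"
  proof (rule interval_integral_substitution_integrable)
    show "((\<lambda>x. x powr r) has_real_derivative r * x powr (r - 1)) (at x)" if "0 < ereal x" for x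
      using that by (auto intro!: derivative_eq_intros)
    show "set_integrable lborel (einterval 0 \<infinity>) (\<lambda>x. (r * x powr (r - 1)) *\<^sub>R f (x powr r))"
      using intg by (simp add: g_def)
  qed (use assms lim0[of r] liminf[of r] intf in \<open>auto intro!: continuous_intros\<close>)
  then have "integral\<^sup>L lpos g = I"
    using assms(3) by (simp add: g_def integral_lpos_eq_interval[symmetric] has_bochner_integral_iff)
  with intg show ?thesis
    by (simp add: g_def einterval_0_infty integrable_lpos_iff[symmetric] has_bochner_integral_iff)
qed

section \<open>Mellin and Frullani integrals\<close>

lemma has_bochner_integral_lpos_powr_exp_square:
  assumes "0 < q" "v > 0"
  shows "has_bochner_integral lpos (\<lambda>s. s powr (q - 1) * exp (- (v * s\<^sup>2))) (Gamma (q / 2) * v powr (- (q / 2)) / 2)"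
proof -
  have "has_bochner_integral lpos (\<lambda>y. y powr (q/2 - 1) * exp (- (v * y))) (Gamma (q/2 - 1 + 1) * v powr (- (q/2 - 1) - 1))"
    using assms by (intro has_bochner_integral_lpos_powr_exp) auto
  then have "has_bochner_integral lpos (\<lambda>x. 2 * x powr (2 - 1) * ((x powr 2) powr (q/2 - 1) * exp (- (v * x powr 2))))
      (Gamma (q/2 - 1 + 1) * v powr (- (q/2 - 1) - 1))"
    by (intro has_bochner_integral_lpos_subst_powr) (auto intro!: continuous_intros)
  then have "has_bochner_integral lpos (\<lambda>x. 1/2 * (2 * x powr (2 - 1) * ((x powr 2) powr (q/2 - 1) * exp (- (v * x powr 2)))))
      (1/2 * (Gamma (q/2 - 1 + 1) * v powr (- (q/2 - 1) - 1)))"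
    by (rule has_bochner_integral_mult_right)
  also have "?this \<longleftrightarrow> ?thesis"
  proof (rule has_bochner_integral_lpos_cong)
    fix x :: real assume "x > 0"
    have "(x powr 2) powr (q/2 - 1) = x powr (q - 2)"
      using \<open>x > 0\<close> by (subst powr_powr) (simp add: algebra_simps)
    then have "x * (x powr 2) powr (q/2 - 1) = x powr 1 * x powr (q - 2)"
      using \<open>x > 0\<close> by simp
    also have "\<dots> = x powr (q - 1)" by (subst powr_add[symmetric]) simp
    finally show "1/2 * (2 * x powr (2 - 1) * ((x powr 2) powr (q/2 - 1) * exp (- (v * x powr 2)))) = x powr (q - 1) * exp (- (v * x\<^sup>2))"
      using \<open>x > 0\<close> by simp
  qed simp
  finally show ?thesis .
qed

text \<open>Writing 1 / (1 + s^2) as the integral of exp (- v (1 + s^2)) over v > 0 and exchanging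
  makes the s-integral a Gaussian moment and the v-integral a Gamma integral. The product Gamma
  (q/2) Gamma (1 - q/2) is evaluated by reflection; both arguments are positive exactly for 0 < q <
  2.\<close>

lemma has_bochner_integral_lpos_powr_div_square:
  assumes "0 < q" "q < 2"
  shows "has_bochner_integral lpos (\<lambda>s. s powr (q - 1) / (1 + s\<^sup>2)) (pi / (2 * sin (pi * q / 2)))"
proof -
  interpret pair_sigma_finite lpos lpos by (intro pair_sigma_finite_lpos sigma_finite_lpos)
  let ?f = "\<lambda>v s. s powr (q - 1) * exp (- (v * (1 + s\<^sup>2)))"
  let ?g = "\<lambda>v. exp (- v) * (Gamma (q / 2) * v powr (- (q / 2)) / 2)"
  have 1: "has_bochner_integral lpos (?f v) (?g v)" if "v > 0" for v
  proof -
    have "has_bochner_integral lpos (\<lambda>s. exp (- v) * (s powr (q - 1) * exp (- (v * s\<^sup>2)))) (?g v)"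
      by (intro has_bochner_integral_mult_right has_bochner_integral_lpos_powr_exp_square assms that)
    also have "?this \<longleftrightarrow> ?thesis"
      by (intro has_bochner_integral_lpos_cong) (simp_all add: distrib_left exp_add[symmetric] algebra_simps)
    finally show ?thesis .
  qed
  have g: "has_bochner_integral lpos ?g (pi / (2 * sin (pi * q / 2)))"
  proof -
    have "has_bochner_integral lpos (\<lambda>v. Gamma (q / 2) / 2 * (v powr (- (q / 2)) * exp (- (1 * v))))
       (Gamma (q / 2) / 2 * (Gamma (- (q / 2) + 1) * 1 powr (- (- (q / 2)) - 1)))"
      using assms by (intro has_bochner_integral_mult_right has_bochner_integral_lpos_powr_exp) auto
    also have "Gamma (q / 2) / 2 * (Gamma (- (q / 2) + 1) * 1 powr (- (- (q / 2)) - 1)) = Gamma (q / 2) * Gamma (1 - q / 2) / 2"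
      by simp
    also have "Gamma (q / 2) * Gamma (1 - q / 2) = pi / sin (pi * (q / 2))"
    proof -
      have "complex_of_real (Gamma (q / 2) * Gamma (1 - q / 2)) = of_real (pi / sin (pi * (q / 2)))"
        using Gamma_reflection_complex[of "of_real (q / 2)"]
        by (simp flip: Gamma_complex_of_real sin_of_real)
      then show ?thesis unfolding of_real_eq_iff .
    qed
    finally show ?thesis by (simp add: mult_ac)
  qed
  have "has_bochner_integral lpos (\<lambda>s. s powr (q - 1) / (1 + s\<^sup>2)) (integral\<^sup>L lpos ?g)"
  proof (rule has_bochner_integral_swap)
    show "(\<lambda>(v, s). ?f v s) \<in> borel_measurable (lpos \<Otimes>\<^sub>M lpos)"
      by (intro measurable_lpos_pair) (auto simp: measurable_restrict_space1)
    show "has_bochner_integral lpos (?f v) (?g v)" if "v \<in> space lpos" for v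
      using 1 that by (simp add: space_restrict_space)
    show "has_bochner_integral lpos (\<lambda>v. ?f v s) (s powr (q - 1) / (1 + s\<^sup>2))" if "s \<in> space lpos" for s
      using has_bochner_integral_mult_right[OF has_bochner_integral_lpos_exp[of "1 + s\<^sup>2"], of "s powr (q - 1)"]
      by (simp add: add_pos_nonneg mult_ac)
    have "integrable lpos ?g" using g by (auto simp: has_bochner_integral_iff)
    also have "?this \<longleftrightarrow> integrable lpos (\<lambda>v. integral\<^sup>L lpos (\<lambda>s. norm (?f v s)))"
      using 1 by (intro integrable_lpos_cong) (auto simp: has_bochner_integral_iff)
    finally show "integrable lpos (\<lambda>v. integral\<^sup>L lpos (\<lambda>s. norm (?f v s)))" .
  qed
  then show ?thesis using g by (simp add: has_bochner_integral_iff)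
qed

text \<open>For b \<ge> 0, sin (b s) / s is the integral of cos (u s) over u in [0, b]; exchanging
  leaves the Laplace transform a / (a^2 + u^2) of the cosine, the derivative of arctan (u / a).
  Negative b follows by oddness.\<close>

lemma has_bochner_integral_lpos_frullani:
  assumes "a > 0"
  shows "has_bochner_integral lpos (\<lambda>s. exp (- (a * s)) * (sin (b * s) / s)) (arctan (b / a))"
proof -
  have *: "has_bochner_integral lpos (\<lambda>s. exp (- (a * s)) * (sin (b * s) / s)) (arctan (b / a))" if "b \<ge> 0" for b
  proof -
    define N where "N = restrict_space lborel {0..b}"
    have "sigma_finite_measure N"
      unfolding N_def by (rule sigma_finite_measure_restrict_space) (auto intro: lborel.sigma_finite_measure_axioms)
    then interpret pair_sigma_finite N lpos by (rule pair_sigma_finite_lpos)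
    \<comment> \<open>The inner norms are at most 1/a, so finiteness of the measure in u suffices
      for Fubini.\<close>
    have fin: "finite_measure N" unfolding N_def
      by (rule finite_measureI) (use that in \<open>auto simp: space_restrict_space emeasure_restrict_space\<close>)
    let ?f = "\<lambda>u s. exp (- (a * s)) * cos (u * s)"
    have meas: "(\<lambda>(u, s). ?f u s) \<in> borel_measurable (N \<Otimes>\<^sub>M lpos)"
      by (intro measurable_lpos_pair) (auto simp: N_def measurable_restrict_space1)
    have "has_bochner_integral lpos (\<lambda>s. exp (- (a * s)) * (sin (b * s) / s)) (integral\<^sup>L N (\<lambda>u. a / (a\<^sup>2 + u\<^sup>2)))"
    proof (rule has_bochner_integral_swap[OF meas])
      show "has_bochner_integral lpos (?f u) (a / (a\<^sup>2 + u\<^sup>2))" for u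
        using assms by (rule has_bochner_integral_lpos_exp_cos)
      show "has_bochner_integral N (\<lambda>u. ?f u s) (exp (- (a * s)) * (sin (b * s) / s))" if "s \<in> space lpos" for s
      proof -
        have "s > 0" using that by (simp add: space_restrict_space)
        have "has_bochner_integral lborel (\<lambda>u. cos (u * s) * indicator {0..b} u) (sin (b * s) / s - sin (0 * s) / s)"
          by (rule has_bochner_integral_FTC_Icc_real) (use \<open>b \<ge> 0\<close> \<open>s > 0\<close> in \<open>auto intro!: derivative_eq_intros continuous_intros\<close>)
        then have "has_bochner_integral N (\<lambda>u. cos (u * s)) (sin (b * s) / s)"
          unfolding N_def by (subst has_bochner_integral_restrict_space) (auto simp: mult.commute)
        then show ?thesis by (rule has_bochner_integral_mult_right)
      qed
      have bound: "norm (integral\<^sup>L lpos (\<lambda>s. norm (?f u s))) \<le> 1 / a" for u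
      proof -
        have "integral\<^sup>L lpos (\<lambda>s. norm (?f u s)) \<le> integral\<^sup>L lpos (\<lambda>s. exp (- (a * s)))"
          using has_bochner_integral_lpos_exp_cos[OF assms, of u] has_bochner_integral_lpos_exp[OF assms]
          by (intro integral_mono integrable_norm) (auto simp: has_bochner_integral_iff abs_mult mult_left_le)
        then show ?thesis using has_bochner_integral_lpos_exp[OF assms] by (simp add: has_bochner_integral_iff)
      qed
      have "(\<lambda>u. integral\<^sup>L lpos (\<lambda>s. norm (?f u s))) \<in> borel_measurable N"
        using meas by (intro M2.borel_measurable_lebesgue_integral) auto
      then show "integrable N (\<lambda>u. integral\<^sup>L lpos (\<lambda>s. norm (?f u s)))"
        using bound by (intro finite_measure.integrable_const_bound[OF fin, of _ "1 / a"]) auto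
    qed
    moreover have "integral\<^sup>L N (\<lambda>u. a / (a\<^sup>2 + u\<^sup>2)) = arctan (b / a)"
    proof -
      have "has_bochner_integral lborel (\<lambda>u. a / (a\<^sup>2 + u\<^sup>2) * indicator {0..b} u) (arctan (b / a) - arctan (0 / a))"
      proof (rule has_bochner_integral_FTC_Icc_real)
        show "((\<lambda>u. arctan (u / a)) has_real_derivative a / (a\<^sup>2 + u\<^sup>2)) (at u)" for u
          using assms by (auto intro!: derivative_eq_intros simp: field_simps power2_eq_square)
        show "isCont (\<lambda>u. a / (a\<^sup>2 + u\<^sup>2)) u" for u
          using assms by (intro continuous_intros) (auto simp: sum_power2_eq_zero_iff)
      qed (use \<open>b \<ge> 0\<close> in auto)
      then show ?thesis unfolding N_def by (subst integral_restrict_space) (auto simp: mult.commute has_bochner_integral_iff)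
    qed
    ultimately show ?thesis by simp
  qed
  show ?thesis
  proof (cases "b \<ge> 0")
    case False
    then have "has_bochner_integral lpos (\<lambda>s. exp (- (a * s)) * (sin (- b * s) / s)) (arctan (- b / a))"
      by (intro *) auto
    then have "has_bochner_integral lpos (\<lambda>s. - (exp (- (a * s)) * (sin (- b * s) / s))) (- arctan (- b / a))"
      by (rule has_bochner_integral_minus)
    then show ?thesis by (simp add: arctan_minus)
  qed (rule *)
qed

text \<open>Writes \<open>\<Gamma>(p + 1) y\<^bsup>-p-1\<^esup>\<close> as a Laplace transform, which reduces Mellin-type integrals of
  trigonometric functions to rational ones.\<close>

lemma integral_lpos_laplace_powr:
  fixes h :: "real \<Rightarrow> real"
  assumes "p > -1" and [measurable]: "h \<in> borel_measurable borel"
    and int: "integrable lpos (\<lambda>y. h y * y powr (- p - 1))"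
  shows "Gamma (p + 1) * integral\<^sup>L lpos (\<lambda>y. h y * y powr (- p - 1)) =
         integral\<^sup>L lpos (\<lambda>s. s powr p * integral\<^sup>L lpos (\<lambda>y. exp (- (s * y)) * h y))"
proof -
  interpret pair_sigma_finite lpos lpos by (intro pair_sigma_finite_lpos sigma_finite_lpos)
  let ?f = "\<lambda>y s. h y * (s powr p * exp (- (y * s)))"
  have meas: "(\<lambda>(y, s). ?f y s) \<in> borel_measurable (lpos \<Otimes>\<^sub>M lpos)"
    by (intro measurable_lpos_pair) (auto simp: measurable_restrict_space1)
  have 1: "has_bochner_integral lpos (?f y) (h y * (Gamma (p + 1) * y powr (- p - 1)))" if "y > 0" for y
    using that assms by (intro has_bochner_integral_mult_right has_bochner_integral_lpos_powr_exp)
  have 2: "has_bochner_integral lpos (\<lambda>s. norm (?f y s)) (\<bar>h y\<bar> * (Gamma (p + 1) * y powr (- p - 1)))" if "y > 0" for y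
    using has_bochner_integral_mult_right[OF has_bochner_integral_lpos_powr_exp[OF assms(1) that], of "\<bar>h y\<bar>"]
    by (simp add: abs_mult)
  have "integrable lpos (\<lambda>y. Gamma (p + 1) * norm (h y * y powr (- p - 1)))"
    using int by (intro integrable_mult_right integrable_norm)
  also have "?this \<longleftrightarrow> integrable lpos (\<lambda>y. integral\<^sup>L lpos (\<lambda>s. norm (?f y s)))"
  proof (rule integrable_lpos_cong)
    show "Gamma (p + 1) * norm (h y * y powr (- p - 1)) = integral\<^sup>L lpos (\<lambda>s. norm (?f y s))" if "y > 0" for y
      unfolding has_bochner_integral_integral_eq[OF 2[OF that]] by (simp add: abs_mult)
  qed
  finally have int2: "integrable (lpos \<Otimes>\<^sub>M lpos) (\<lambda>(y, s). ?f y s)"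
  proof (intro Fubini_integrable[OF meas])
    have "integrable lpos (?f y)" if "y > 0" for y
      using 1[OF that] unfolding has_bochner_integral_iff by blast
    then show "AE y in lpos. integrable lpos (\<lambda>s. case (y, s) of (y, s) \<Rightarrow> ?f y s)"
      unfolding prod.case by (intro AE_I2) (simp only: space_restrict_space, blast)
  qed simp
  have "Gamma (p + 1) * integral\<^sup>L lpos (\<lambda>y. h y * y powr (- p - 1)) = integral\<^sup>L lpos (\<lambda>y. integral\<^sup>L lpos (?f y))"
  proof -
    have "integral\<^sup>L lpos (?f y) = Gamma (p + 1) * (h y * y powr (- p - 1))" if "y > 0" for y
      using has_bochner_integral_integral_eq[OF 1[OF that]] by (simp only: mult.left_commute)
    from this[symmetric] show ?thesis
      unfolding Bochner_Integration.integral_mult_right_zero[symmetric] by (rule integral_lpos_cong)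
  qed
  also have "\<dots> = integral\<^sup>L lpos (\<lambda>s. integral\<^sup>L lpos (\<lambda>y. ?f y s))"
    using Fubini_integral[OF int2] by simp
  also have "\<dots> = integral\<^sup>L lpos (\<lambda>s. s powr p * integral\<^sup>L lpos (\<lambda>y. exp (- (s * y)) * h y))"
    unfolding Bochner_Integration.integral_mult_right_zero[symmetric] by (simp add: mult_ac)
  finally show ?thesis .
qed

section \<open>The characteristic exponent\<close>

text \<open>The value of the integral of (1 - cos y) y^(-\<alpha> - 1) over y > 0. With Gamma
  (\<alpha> + 1) and a sine in place of Gamma (-\<alpha>) it stays meaningful at \<alpha> =
  1.\<close>

definition cos_const :: "real \<Rightarrow> real" where
  "cos_const \<alpha> = pi / (2 * Gamma (\<alpha> + 1) * sin (pi * \<alpha> / 2))"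

text \<open>The corresponding integral of sin y for \<alpha> < 1 and of sin y - y for \<alpha> > 1:
  one formula, with opposite signs of the cosine. All uses are for \<alpha> \<noteq> 1, as the
  cosine vanishes at \<alpha> = 1.\<close>

definition sin_const :: "real \<Rightarrow> real" where
  "sin_const \<alpha> = pi / (2 * Gamma (\<alpha> + 1) * cos (pi * \<alpha> / 2))"

lemma Gamma_plus1_pos: "\<alpha> > 0 \<Longrightarrow> Gamma (\<alpha> + 1) > (0 :: real)"
  by (rule Gamma_real_pos) simp

lemma one_minus_cos_le: "1 - cos x \<le> x\<^sup>2" for x :: real
proof -
  have "1 - cos x = 2 * (sin (x / 2))\<^sup>2" using cos_double_sin[of "x / 2"] by simp
  also have "(sin (x / 2))\<^sup>2 \<le> (x / 2)\<^sup>2"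
    using abs_sin_x_le_abs_x[of "x / 2"] by (simp only: abs_le_square_iff)
  finally have "1 - cos x \<le> x\<^sup>2 / 2" by (simp add: power_divide)
  then show ?thesis using zero_le_power2[of x] by linarith
qed

lemma divide_by_mult_left: "G \<noteq> 0 \<Longrightarrow> G * x = c / (2 * s) \<Longrightarrow> x = c / (2 * G * s)" for x :: real
  by (cases "s = 0") (auto simp: field_simps)

lemma abs_sin_minus_le: "\<bar>sin x - x\<bar> \<le> x\<^sup>2" for x :: real
proof -
  have "\<bar>sin x - (\<Sum>m<2. sin_coeff m * x ^ m)\<bar> \<le> inverse (fact 2) * \<bar>x\<bar> ^ 2"
    by (rule Maclaurin_sin_bound)
  then have "\<bar>sin x - x\<bar> \<le> x\<^sup>2 / 2" by (simp add: sin_coeff_def eval_nat_numeral)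
  then show ?thesis using zero_le_power2[of x] by linarith
qed

text \<open>Domination by one power near 0 and another beyond 1, each integrated explicitly. The
  minus sign in the bound is due to q + 1 < 0.\<close>

lemma integrable_lpos_powr_split:
  fixes h :: "real \<Rightarrow> real"
  assumes "h \<in> borel_measurable borel" "p > -1" "q < -1"
    and "\<And>y. 0 < y \<Longrightarrow> y < 1 \<Longrightarrow> \<bar>h y\<bar> \<le> K * y powr p" "\<And>y. y \<ge> 1 \<Longrightarrow> \<bar>h y\<bar> \<le> K' * y powr q"
  shows "integrable lpos h"
    and "\<bar>integral\<^sup>L lpos h\<bar> \<le> K / (p + 1) - K' / (q + 1)"
proof -
  let ?g = "\<lambda>y. K * (indicator {..<1} y * y powr p) + K' * (indicator {1..} y * y powr q)"
  have g: "has_bochner_integral lpos ?g (K * (1 / (p + 1)) + K' * (- 1 / (q + 1)))"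
    by (intro has_bochner_integral_add has_bochner_integral_mult_right
        has_bochner_integral_lpos_powr_lt1 has_bochner_integral_lpos_powr_ge1 assms)
  have le: "norm (h y) \<le> ?g y" if "y > 0" for y
    using that assms(4,5)[of y] by (cases "y < 1") (auto simp: indicator_def)
  show int: "integrable lpos h"
    by (rule integrable_lpos_bound[OF _ assms(1) le]) (use g in \<open>auto simp: has_bochner_integral_iff\<close>)
  have "\<bar>integral\<^sup>L lpos h\<bar> \<le> integral\<^sup>L lpos (\<lambda>y. norm (h y))"
    using integral_norm_bound[of lpos h] by simp
  also have "\<dots> \<le> integral\<^sup>L lpos ?g"
    using int g le by (intro integral_mono_AE AE_I2) (auto simp: has_bochner_integral_iff space_restrict_space)
  finally show "\<bar>integral\<^sup>L lpos h\<bar> \<le> K / (p + 1) - K' / (q + 1)"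
    using g by (simp add: has_bochner_integral_iff)
qed

text \<open>The Laplace transform of 1 - cos y is 1 / (s (1 + s^2)); times s^\<alpha> it leaves the
  Mellin integral with q = \<alpha>, which converges on the whole range (0, 2).\<close>

lemma has_bochner_integral_lpos_cos:
  assumes "0 < \<alpha>" "\<alpha> < 2"
  shows "has_bochner_integral lpos (\<lambda>y. (1 - cos y) * y powr (- \<alpha> - 1)) (cos_const \<alpha>)"
proof -
  have int: "integrable lpos (\<lambda>y. (1 - cos y) * y powr (- \<alpha> - 1))"
  proof (rule integrable_lpos_powr_split(1))
    show "\<bar>(1 - cos y) * y powr (- \<alpha> - 1)\<bar> \<le> 1 * y powr (1 - \<alpha>)" if "0 < y" for y
    proof -
      have "(1 - cos y) * y powr (- \<alpha> - 1) \<le> y\<^sup>2 * y powr (- \<alpha> - 1)"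
        by (intro mult_right_mono one_minus_cos_le) auto
      also have "\<dots> = y powr (1 - \<alpha>)"
        using that by (simp flip: powr_add powr_numeral)
      finally show ?thesis by (simp add: abs_mult)
    qed
    show "\<bar>(1 - cos y) * y powr (- \<alpha> - 1)\<bar> \<le> 2 * y powr (- \<alpha> - 1)" for y
      using cos_ge_minus_one[of y] by (auto simp: abs_mult intro!: mult_right_mono)
  qed (use assms in auto)
  have "Gamma (\<alpha> + 1) * integral\<^sup>L lpos (\<lambda>y. (1 - cos y) * y powr (- \<alpha> - 1)) =
        integral\<^sup>L lpos (\<lambda>s. s powr \<alpha> * integral\<^sup>L lpos (\<lambda>y. exp (- (s * y)) * (1 - cos y)))"
    by (rule integral_lpos_laplace_powr) (use assms int in auto)
  also have "\<dots> = integral\<^sup>L lpos (\<lambda>s. s powr (\<alpha> - 1) / (1 + s\<^sup>2))"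
  proof (rule integral_lpos_cong)
    fix s :: real assume s: "s > 0"
    have "has_bochner_integral lpos (\<lambda>y. exp (- (s * y)) - exp (- (s * y)) * cos (1 * y)) (1 / s - s / (s\<^sup>2 + 1\<^sup>2))"
      by (intro has_bochner_integral_diff has_bochner_integral_lpos_exp has_bochner_integral_lpos_exp_cos s)
    then have "integral\<^sup>L lpos (\<lambda>y. exp (- (s * y)) * (1 - cos y)) = 1 / s - s / (s\<^sup>2 + 1\<^sup>2)"
      by (simp add: has_bochner_integral_iff right_diff_distrib)
    also have "\<dots> = 1 / (s * (1 + s\<^sup>2))"
      using s by (simp add: divide_simps add_nonneg_eq_0_iff) (simp add: power2_eq_square algebra_simps)
    finally show "s powr \<alpha> * integral\<^sup>L lpos (\<lambda>y. exp (- (s * y)) * (1 - cos y)) = s powr (\<alpha> - 1) / (1 + s\<^sup>2)"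
      using s by (simp add: powr_diff)
  qed
  also have "\<dots> = pi / (2 * sin (pi * \<alpha> / 2))"
    by (intro has_bochner_integral_integral_eq has_bochner_integral_lpos_powr_div_square assms)
  finally have "integral\<^sup>L lpos (\<lambda>y. (1 - cos y) * y powr (- \<alpha> - 1)) = cos_const \<alpha>"
    unfolding cos_const_def using assms Gamma_plus1_pos[of \<alpha>, THEN less_imp_neq] by (intro divide_by_mult_left) auto
  with int show ?thesis by (simp add: has_bochner_integral_iff)
qed

lemma cos_const_pos: "0 < \<alpha> \<Longrightarrow> \<alpha> < 2 \<Longrightarrow> cos_const \<alpha> > 0"
  using Gamma_real_pos[of "\<alpha> + 1"] sin_gt_zero[of "pi * \<alpha> / 2"] pi_gt_zero
  by (simp add: cos_const_def)

text \<open>Here the Laplace transform is 1 / (1 + s^2) and the Mellin exponent is q = \<alpha> + 1,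
  which is below 2 exactly for \<alpha> < 1.\<close>

lemma has_bochner_integral_lpos_sin:
  assumes "0 < \<alpha>" "\<alpha> < 1"
  shows "has_bochner_integral lpos (\<lambda>y. sin y * y powr (- \<alpha> - 1)) (sin_const \<alpha>)"
proof -
  have int: "integrable lpos (\<lambda>y. sin y * y powr (- \<alpha> - 1))"
  proof (rule integrable_lpos_powr_split(1))
    show "\<bar>sin y * y powr (- \<alpha> - 1)\<bar> \<le> 1 * y powr (- \<alpha>)" if "0 < y" for y
    proof -
      have "\<bar>sin y\<bar> * y powr (- \<alpha> - 1) \<le> y * y powr (- \<alpha> - 1)"
        using abs_sin_x_le_abs_x[of y] that by (intro mult_right_mono) auto
      also have "\<dots> = y powr 1 * y powr (- \<alpha> - 1)" using that by simp
      also have "\<dots> = y powr (- \<alpha>)" by (subst powr_add[symmetric]) simp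
      finally show ?thesis by (simp add: abs_mult)
    qed
    show "\<bar>sin y * y powr (- \<alpha> - 1)\<bar> \<le> 1 * y powr (- \<alpha> - 1)" for y
      unfolding abs_mult by (intro mult_mono) auto
  qed (use assms in auto)
  have "Gamma (\<alpha> + 1) * integral\<^sup>L lpos (\<lambda>y. sin y * y powr (- \<alpha> - 1)) =
        integral\<^sup>L lpos (\<lambda>s. s powr \<alpha> * integral\<^sup>L lpos (\<lambda>y. exp (- (s * y)) * sin y))"
    by (rule integral_lpos_laplace_powr) (use assms int in auto)
  also have "\<dots> = integral\<^sup>L lpos (\<lambda>s. s powr (\<alpha> + 1 - 1) / (1 + s\<^sup>2))"
  proof (rule integral_lpos_cong)
    fix s :: real assume s: "s > 0"
    show "s powr \<alpha> * integral\<^sup>L lpos (\<lambda>y. exp (- (s * y)) * sin y) = s powr (\<alpha> + 1 - 1) / (1 + s\<^sup>2)"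
      using has_bochner_integral_lpos_exp_sin[OF s, of 1] by (simp add: has_bochner_integral_iff add.commute)
  qed
  also have "\<dots> = pi / (2 * sin (pi * (\<alpha> + 1) / 2))"
    by (intro has_bochner_integral_integral_eq has_bochner_integral_lpos_powr_div_square) (use assms in auto)
  also have "sin (pi * (\<alpha> + 1) / 2) = cos (pi * \<alpha> / 2)"
    by (simp add: cos_sin_eq[of "- (pi * \<alpha> / 2)", simplified] add_divide_distrib algebra_simps)
  finally have "integral\<^sup>L lpos (\<lambda>y. sin y * y powr (- \<alpha> - 1)) = sin_const \<alpha>"
    unfolding sin_const_def using assms Gamma_plus1_pos[of \<alpha>, THEN less_imp_neq] by (intro divide_by_mult_left) auto
  with int show ?thesis by (simp add: has_bochner_integral_iff)
qed

text \<open>Subtracting y turns the transform into - 1 / (s^2 (1 + s^2)) and the exponent into q =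
  \<alpha> - 1. The sign is absorbed by sin (pi (\<alpha> - 1) / 2) = - cos (pi \<alpha> / 2), so
  the same constant appears.\<close>

lemma has_bochner_integral_lpos_sin_compensated:
  assumes "1 < \<alpha>" "\<alpha> < 2"
  shows "has_bochner_integral lpos (\<lambda>y. (sin y - y) * y powr (- \<alpha> - 1)) (sin_const \<alpha>)"
proof -
  have int: "integrable lpos (\<lambda>y. (sin y - y) * y powr (- \<alpha> - 1))"
  proof (rule integrable_lpos_powr_split(1))
    show "\<bar>(sin y - y) * y powr (- \<alpha> - 1)\<bar> \<le> 1 * y powr (1 - \<alpha>)" if "0 < y" for y
    proof -
      have "\<bar>sin y - y\<bar> * y powr (- \<alpha> - 1) \<le> y\<^sup>2 * y powr (- \<alpha> - 1)"
        by (intro mult_right_mono abs_sin_minus_le) auto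
      also have "\<dots> = y powr (1 - \<alpha>)"
        using that by (simp flip: powr_add powr_numeral)
      finally show ?thesis by (simp add: abs_mult)
    qed
    show "\<bar>(sin y - y) * y powr (- \<alpha> - 1)\<bar> \<le> 2 * y powr (- \<alpha>)" if "1 \<le> y" for y
    proof -
      have "\<bar>sin y - y\<bar> * y powr (- \<alpha> - 1) \<le> (2 * y) * y powr (- \<alpha> - 1)"
        using abs_sin_x_le_abs_x[of y] that by (intro mult_right_mono) auto
      also have "\<dots> = 2 * (y powr 1 * y powr (- \<alpha> - 1))" using that by simp
      also have "\<dots> = 2 * y powr (- \<alpha>)" by (subst powr_add[symmetric]) simp
      finally show ?thesis by (simp add: abs_mult)
    qed
  qed (use assms in auto)
  have "Gamma (\<alpha> + 1) * integral\<^sup>L lpos (\<lambda>y. (sin y - y) * y powr (- \<alpha> - 1)) =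
        integral\<^sup>L lpos (\<lambda>s. s powr \<alpha> * integral\<^sup>L lpos (\<lambda>y. exp (- (s * y)) * (sin y - y)))"
    by (rule integral_lpos_laplace_powr) (use assms int in auto)
  also have "\<dots> = integral\<^sup>L lpos (\<lambda>s. - (s powr (\<alpha> - 1 - 1) / (1 + s\<^sup>2)))"
  proof (rule integral_lpos_cong)
    fix s :: real assume s: "s > 0"
    have "has_bochner_integral lpos (\<lambda>y. exp (- (s * y)) * sin (1 * y) - y * exp (- (s * y))) (1 / (s\<^sup>2 + 1\<^sup>2) - 1 / s\<^sup>2)"
      by (intro has_bochner_integral_diff has_bochner_integral_lpos_times_exp has_bochner_integral_lpos_exp_sin s)
    then have "integral\<^sup>L lpos (\<lambda>y. exp (- (s * y)) * (sin y - y)) = 1 / (s\<^sup>2 + 1\<^sup>2) - 1 / s\<^sup>2"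
      by (simp add: has_bochner_integral_iff right_diff_distrib mult.commute[of "exp _"] left_diff_distrib)
    also have "\<dots> = - 1 / (s\<^sup>2 * (1 + s\<^sup>2))"
      using s by (simp add: divide_simps add_nonneg_eq_0_iff)
    moreover have "s powr (\<alpha> - 1 - 1) = s powr \<alpha> / s\<^sup>2"
    proof -
      have "s powr (\<alpha> - 1 - 1) = s powr (\<alpha> - 2)" by simp
      also have "\<dots> = s powr \<alpha> / s powr 2" by (rule powr_diff)
      finally show ?thesis using s by simp
    qed
    ultimately show "s powr \<alpha> * integral\<^sup>L lpos (\<lambda>y. exp (- (s * y)) * (sin y - y)) = - (s powr (\<alpha> - 1 - 1) / (1 + s\<^sup>2))"
      by simp
  qed
  also have "\<dots> = - (pi / (2 * sin (pi * (\<alpha> - 1) / 2)))"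
    by (intro has_bochner_integral_integral_eq has_bochner_integral_minus has_bochner_integral_lpos_powr_div_square) (use assms in auto)
  also have "sin (pi * (\<alpha> - 1) / 2) = - cos (pi * \<alpha> / 2)"
    by (simp add: cos_sin_eq algebra_simps diff_divide_distrib flip: sin_minus)
  finally have "integral\<^sup>L lpos (\<lambda>y. (sin y - y) * y powr (- \<alpha> - 1)) = sin_const \<alpha>"
    unfolding sin_const_def using assms Gamma_plus1_pos[of \<alpha>, THEN less_imp_neq] by (intro divide_by_mult_left) auto
  with int show ?thesis by (simp add: has_bochner_integral_iff)
qed

lemma has_bochner_integral_lpos_scale_powr:
  fixes h :: "real \<Rightarrow> real"
  assumes "l > 0" "has_bochner_integral lpos (\<lambda>y. h y * y powr (- \<alpha> - 1)) I"
  shows "has_bochner_integral lpos (\<lambda>y. h (l * y) * y powr (- \<alpha> - 1)) (l powr \<alpha> * I)"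
proof -
  have "has_bochner_integral lpos (\<lambda>y. l powr (\<alpha> + 1) * (h (l * y) * (l * y) powr (- \<alpha> - 1))) (l powr (\<alpha> + 1) * (I /\<^sub>R l))"
    using has_bochner_integral_lpos_scale[OF assms(1), THEN iffD1, OF assms(2)]
    by (intro has_bochner_integral_mult_right)
  also have "?this \<longleftrightarrow> ?thesis"
  proof (rule has_bochner_integral_lpos_cong)
    show "l powr (\<alpha> + 1) * (h (l * y) * (l * y) powr (- \<alpha> - 1)) = h (l * y) * y powr (- \<alpha> - 1)" if "y > 0" for y
    proof -
      have "l powr (\<alpha> + 1) * (l * y) powr (- \<alpha> - 1) = (l powr (\<alpha> + 1) * l powr (- \<alpha> - 1)) * y powr (- \<alpha> - 1)"
        using that assms(1) by (simp add: powr_mult)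
      also have "l powr (\<alpha> + 1) * l powr (- \<alpha> - 1) = 1"
        using assms(1) by (subst powr_add[symmetric]) simp
      finally show ?thesis by simp
    qed
    show "l powr (\<alpha> + 1) * (I /\<^sub>R l) = l powr \<alpha> * I"
      using assms(1) by (simp add: powr_add)
  qed
  finally show ?thesis .
qed

lemma has_bochner_integral_lpos_cos_scale:
  assumes "0 < \<alpha>" "\<alpha> < 2"
  shows "has_bochner_integral lpos (\<lambda>y. (1 - cos (l * y)) * y powr (- \<alpha> - 1)) (\<bar>l\<bar> powr \<alpha> * cos_const \<alpha>)"
proof (cases "l = 0")
  case False
  have "has_bochner_integral lpos (\<lambda>y. (1 - cos (\<bar>l\<bar> * y)) * y powr (- \<alpha> - 1)) (\<bar>l\<bar> powr \<alpha> * cos_const \<alpha>)"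
    using False by (intro has_bochner_integral_lpos_scale_powr has_bochner_integral_lpos_cos assms) auto
  moreover have "cos (\<bar>l\<bar> * y) = cos (l * y)" for y by (cases "l \<ge> 0") auto
  ultimately show ?thesis by simp
qed auto

text \<open>The cutoff is the one in the exponent; it makes the integral converge for every \<alpha>
  in (0, 2), at the price of homogeneity in l.\<close>

definition sin_integral :: "real \<Rightarrow> real \<Rightarrow> real" where
  "sin_integral \<alpha> l = integral\<^sup>L lpos (\<lambda>y. (sin (l * y) - l * y * indicator {..<1} y) * y powr (- \<alpha> - 1))"

lemma
  assumes "0 < \<alpha>" "\<alpha> < 2"
  shows integrable_sin_integral: "integrable lpos (\<lambda>y. (sin (l * y) - l * y * indicator {..<1} y) * y powr (- \<alpha> - 1))"
    and sin_integral_bound: "\<bar>sin_integral \<alpha> l\<bar> \<le> l\<^sup>2 / (2 - \<alpha>) + 1 / \<alpha>"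
proof -
  let ?h = "\<lambda>y. (sin (l * y) - l * y * indicator {..<1} y) * y powr (- \<alpha> - 1)"
  have 1: "\<bar>?h y\<bar> \<le> l\<^sup>2 * y powr (1 - \<alpha>)" if "0 < y" "y < 1" for y
  proof -
    have "\<bar>sin (l * y) - l * y\<bar> * y powr (- \<alpha> - 1) \<le> (l * y)\<^sup>2 * y powr (- \<alpha> - 1)"
      by (intro mult_right_mono abs_sin_minus_le) auto
    also have "\<dots> = l\<^sup>2 * (y powr 2 * y powr (- \<alpha> - 1))"
      using that by (simp add: power_mult_distrib)
    also have "\<dots> = l\<^sup>2 * y powr (1 - \<alpha>)" by (subst powr_add[symmetric]) simp
    finally show ?thesis using that by (simp add: abs_mult)
  qed
  have 2: "\<bar>?h y\<bar> \<le> 1 * y powr (- \<alpha> - 1)" if "1 \<le> y" for y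
    unfolding abs_mult using that by (intro mult_mono) auto
  show "integrable lpos ?h"
    by (rule integrable_lpos_powr_split(1)[OF _ _ _ 1 2]) (use assms in auto)
  have "\<bar>integral\<^sup>L lpos ?h\<bar> \<le> l\<^sup>2 / ((1 - \<alpha>) + 1) - 1 / ((- \<alpha> - 1) + 1)"
    by (rule integrable_lpos_powr_split(2)[OF _ _ _ 1 2]) (use assms in auto)
  then show "\<bar>sin_integral \<alpha> l\<bar> \<le> l\<^sup>2 / (2 - \<alpha>) + 1 / \<alpha>" unfolding sin_integral_def by simp
qed

text \<open>The cutoff term is split off on (0, 1) if \<alpha> < 1, or completed by its part on [1,
  \<infinity>) if \<alpha> > 1; both contribute - l / (1 - \<alpha>). The drift is chosen to cancel
  this term.\<close>

lemma sin_integral_eq: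
  assumes "0 < \<alpha>" "\<alpha> < 2" "\<alpha> \<noteq> 1" "l > 0"
  shows "sin_integral \<alpha> l = l powr \<alpha> * sin_const \<alpha> - l / (1 - \<alpha>)"
proof -
  have powr: "y * y powr (- \<alpha> - 1) = y powr (- \<alpha>)" if "y > 0" for y
  proof -
    have "y * y powr (- \<alpha> - 1) = y powr 1 * y powr (- \<alpha> - 1)" using that by simp
    also have "\<dots> = y powr (- \<alpha>)" by (subst powr_add[symmetric]) simp
    finally show ?thesis .
  qed
  have "has_bochner_integral lpos (\<lambda>y. (sin (l * y) - l * y * indicator {..<1} y) * y powr (- \<alpha> - 1))
    (l powr \<alpha> * sin_const \<alpha> - l / (1 - \<alpha>))"
  proof (cases "\<alpha> < 1")
    case True
    have "has_bochner_integral lpos (\<lambda>y. sin (l * y) * y powr (- \<alpha> - 1) - l * (indicator {..<1} y * y powr (- \<alpha>)))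
       (l powr \<alpha> * sin_const \<alpha> - l * (1 / (- \<alpha> + 1)))"
      by (intro has_bochner_integral_diff has_bochner_integral_lpos_scale_powr has_bochner_integral_lpos_sin
           has_bochner_integral_mult_right has_bochner_integral_lpos_powr_lt1) (use assms True in auto)
    also have "?this \<longleftrightarrow> ?thesis"
      by (intro has_bochner_integral_lpos_cong) (auto simp: powr[symmetric] algebra_simps)
    finally show ?thesis .
  next
    case False
    have "has_bochner_integral lpos (\<lambda>y. (sin (l * y) - l * y) * y powr (- \<alpha> - 1) + l * (indicator {1..} y * y powr (- \<alpha>)))
       (l powr \<alpha> * sin_const \<alpha> + l * (- 1 / (- \<alpha> + 1)))"
      by (intro has_bochner_integral_add has_bochner_integral_lpos_scale_powr[of l "\<lambda>y. sin y - y"] has_bochner_integral_lpos_sin_compensated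
           has_bochner_integral_mult_right has_bochner_integral_lpos_powr_ge1) (use assms False in auto)
    also have "?this \<longleftrightarrow> ?thesis"
      by (intro has_bochner_integral_lpos_cong) (auto simp: powr[symmetric] algebra_simps indicator_def)
    finally show ?thesis .
  qed
  then show ?thesis by (simp add: sin_integral_def has_bochner_integral_iff)
qed

lemma has_bochner_integral_stable_density:
  fixes h :: "real \<Rightarrow> real"
  assumes "has_bochner_integral lpos (\<lambda>y. h y * y powr (- \<alpha> - 1)) I"
    and "has_bochner_integral lpos (\<lambda>y. h (- y) * y powr (- \<alpha> - 1)) J"
  shows "has_bochner_integral lborel (\<lambda>y. h y * stable_density \<alpha> cp cm y) (cp * I + cm * J)"
proof -
  have J: "has_bochner_integral lborel (\<lambda>y. indicator {0<..} (0 + -1 * y) *\<^sub>R (h (- (0 + -1 * y)) * (0 + -1 * y) powr (- \<alpha> - 1))) (J /\<^sub>R \<bar>-1\<bar>)"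
    using assms(2)[unfolded has_bochner_integral_lpos_iff]
    by (subst lborel_has_bochner_integral_real_affine_iff[symmetric]) auto
  have "has_bochner_integral lborel (\<lambda>y. cp * (indicator {0<..} y *\<^sub>R (h y * y powr (- \<alpha> - 1))) +
     cm * (indicator {0<..} (0 + -1 * y) *\<^sub>R (h (- (0 + -1 * y)) * (0 + -1 * y) powr (- \<alpha> - 1))))
     (cp * I + cm * (J /\<^sub>R \<bar>-1\<bar>))"
    by (intro has_bochner_integral_add has_bochner_integral_mult_right J assms(1)[unfolded has_bochner_integral_lpos_iff])
  also have "?this \<longleftrightarrow> ?thesis"
    by (intro has_bochner_integral_cong) (auto simp: stable_density_def indicator_def)
  finally show ?thesis .
qed

text \<open>The real part of the integrand bracket is even in y and the imaginary part odd, so the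
  half-lines contribute with weights c_+ + c_- and c_+ - c_-. Leaving \<open>sin_integral\<close>
  unevaluated covers \<alpha> = 1.\<close>

lemma stable_exponent_eq:
  assumes "0 < \<alpha>" "\<alpha> < 2"
  shows "stable_exponent \<alpha> cp cm l = Complex (- (cp + cm) * cos_const \<alpha> * \<bar>l\<bar> powr \<alpha>)
           (stable_drift \<alpha> cp cm * l + (cp - cm) * sin_integral \<alpha> l)"
proof -
  let ?c = "\<lambda>y. (cos (l * y) - 1) * stable_density \<alpha> cp cm y"
  let ?s = "\<lambda>y. (sin (l * y) - l * y * indicator {y. \<bar>y\<bar> < 1} y) * stable_density \<alpha> cp cm y"
  have c: "has_bochner_integral lborel ?c (- (cp + cm) * cos_const \<alpha> * \<bar>l\<bar> powr \<alpha>)"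
  proof -
    have 1: "has_bochner_integral lpos (\<lambda>y. (cos (l * y) - 1) * y powr (- \<alpha> - 1)) (- (\<bar>l\<bar> powr \<alpha> * cos_const \<alpha>))"
      using has_bochner_integral_minus[OF has_bochner_integral_lpos_cos_scale[OF assms, of l]]
      by (simp add: algebra_simps)
    have "has_bochner_integral lborel ?c (cp * - (\<bar>l\<bar> powr \<alpha> * cos_const \<alpha>) + cm * - (\<bar>l\<bar> powr \<alpha> * cos_const \<alpha>))"
      by (rule has_bochner_integral_stable_density) (use 1 in auto)
    then show ?thesis by (simp add: algebra_simps)
  qed
  have s: "has_bochner_integral lborel ?s ((cp - cm) * sin_integral \<alpha> l)"
  proof -
    have 1: "has_bochner_integral lpos (\<lambda>y. (sin (l * y) - l * y * indicator {..<1} y) * y powr (- \<alpha> - 1)) (sin_integral \<alpha> l)"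
      using integrable_sin_integral[OF assms] by (simp add: has_bochner_integral_iff sin_integral_def)
    have "has_bochner_integral lborel ?s (cp * sin_integral \<alpha> l + cm * - sin_integral \<alpha> l)"
    proof (rule has_bochner_integral_stable_density)
      show "has_bochner_integral lpos (\<lambda>y. (sin (l * y) - l * y * indicator {y. \<bar>y\<bar> < 1} y) * y powr (- \<alpha> - 1)) (sin_integral \<alpha> l)"
        using 1 by (subst (asm) has_bochner_integral_lpos_cong) (auto simp: indicator_def)
      show "has_bochner_integral lpos (\<lambda>y. (sin (l * - y) - l * - y * indicator {y. \<bar>y\<bar> < 1} (- y)) * y powr (- \<alpha> - 1)) (- sin_integral \<alpha> l)"
        using has_bochner_integral_minus[OF 1] by (subst (asm) has_bochner_integral_lpos_cong) (auto simp: indicator_def algebra_simps)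
    qed
    then show ?thesis by (simp add: algebra_simps)
  qed
  have "has_bochner_integral lborel (\<lambda>y. of_real (?c y) + \<i> * of_real (?s y))
      (of_real (- (cp + cm) * cos_const \<alpha> * \<bar>l\<bar> powr \<alpha>) + \<i> * of_real ((cp - cm) * sin_integral \<alpha> l))"
    by (intro has_bochner_integral_add has_bochner_integral_mult_right has_bochner_integral_of_real c s)
  moreover have "(\<lambda>y. of_real (?c y) + \<i> * of_real (?s y)) = (\<lambda>y. (exp (\<i> * of_real (l * y)) - 1 - \<i> * of_real (l * y * indicator {y. \<bar>y\<bar> < 1} y))
        * of_real (stable_density \<alpha> cp cm y))"
    by (auto simp: fun_eq_iff complex_eq_iff Re_exp Im_exp)
  ultimately have "(CLINT y|lborel. (exp (\<i> * of_real (l * y)) - 1 - \<i> * of_real (l * y * indicator {y. \<bar>y\<bar> < 1} y))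
        * of_real (stable_density \<alpha> cp cm y)) = of_real (- (cp + cm) * cos_const \<alpha> * \<bar>l\<bar> powr \<alpha>) + \<i> * of_real ((cp - cm) * sin_integral \<alpha> l)"
    by (simp add: has_bochner_integral_iff)
  then show ?thesis unfolding stable_exponent_def by (simp add: complex_eq_iff)
qed

lemma stable_exponent_eq_pos:
  assumes "0 < \<alpha>" "\<alpha> < 2" "\<alpha> \<noteq> 1" "l > 0"
  shows "stable_exponent \<alpha> cp cm l = of_real (l powr \<alpha>) * Complex (- (cp + cm) * cos_const \<alpha>) ((cp - cm) * sin_const \<alpha>)"
  using assms unfolding stable_exponent_eq[OF assms(1,2)] sin_integral_eq[OF assms]
  by (simp add: complex_eq_iff stable_drift_def algebra_simps)

text \<open>A quadratic bound is enough: it will be integrated against an exponential density, and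
  only the dependence on time has to be sharp there.\<close>

lemma stable_exponent_bound:
  assumes "0 < \<alpha>" "\<alpha> < 2"
  obtains C where "C \<ge> 0" "\<And>l. norm (stable_exponent \<alpha> cp cm l) \<le> C * (1 + l\<^sup>2)"
proof -
  \<comment> \<open>The summands account for the real part, the drift and the sine integral, each
    bounded by a multiple of 1 + l^2.\<close>
  define C where "C = \<bar>(cp + cm) * cos_const \<alpha>\<bar> + (\<bar>stable_drift \<alpha> cp cm\<bar> + \<bar>cp - cm\<bar> * (1 / (2 - \<alpha>) + 1 / \<alpha>))"
  have "norm (stable_exponent \<alpha> cp cm l) \<le> C * (1 + l\<^sup>2)" for l
  proof -
    have l1: "\<bar>l\<bar> \<le> 1 + l\<^sup>2" using sum_squares_bound[of "\<bar>l\<bar>" 1] by (simp add: power2_eq_square)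
    have l2: "\<bar>l\<bar> powr \<alpha> \<le> 1 + l\<^sup>2"
    proof (cases "\<bar>l\<bar> \<le> 1")
      case True
      then have "\<bar>l\<bar> powr \<alpha> \<le> 1" using assms by (intro powr_le1) auto
      then show ?thesis by (simp add: add_increasing2)
    next
      case False
      then have "\<bar>l\<bar> powr \<alpha> \<le> \<bar>l\<bar> powr 2" using assms by (intro powr_mono) auto
      then show ?thesis using False by simp
    qed
    have l3: "\<bar>sin_integral \<alpha> l\<bar> \<le> (1 / (2 - \<alpha>) + 1 / \<alpha>) * (1 + l\<^sup>2)"
    proof -
      have "0 \<le> 1 / (2 - \<alpha>)" "0 \<le> l\<^sup>2 / \<alpha>" using assms by auto
      moreover have "(1 / (2 - \<alpha>) + 1 / \<alpha>) * (1 + l\<^sup>2) = l\<^sup>2 / (2 - \<alpha>) + 1 / \<alpha> + (1 / (2 - \<alpha>) + l\<^sup>2 / \<alpha>)"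
        by (simp add: distrib_left distrib_right)
      ultimately show ?thesis using sin_integral_bound[OF assms, of l] by linarith
    qed
    have "norm (stable_exponent \<alpha> cp cm l) \<le> \<bar>- (cp + cm) * cos_const \<alpha> * \<bar>l\<bar> powr \<alpha>\<bar> + \<bar>stable_drift \<alpha> cp cm * l + (cp - cm) * sin_integral \<alpha> l\<bar>"
      unfolding stable_exponent_eq[OF assms] using cmod_le by (metis complex.sel)
    also have "\<bar>- (cp + cm) * cos_const \<alpha> * \<bar>l\<bar> powr \<alpha>\<bar> = \<bar>(cp + cm) * cos_const \<alpha>\<bar> * \<bar>l\<bar> powr \<alpha>"
      unfolding mult_minus_left abs_minus_cancel by (simp add: abs_mult)
    also have "\<dots> \<le> \<bar>(cp + cm) * cos_const \<alpha>\<bar> * (1 + l\<^sup>2)" by (intro mult_left_mono l2) auto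
    also have "\<bar>stable_drift \<alpha> cp cm * l + (cp - cm) * sin_integral \<alpha> l\<bar> \<le> \<bar>stable_drift \<alpha> cp cm\<bar> * \<bar>l\<bar> + \<bar>cp - cm\<bar> * \<bar>sin_integral \<alpha> l\<bar>"
      unfolding abs_mult[symmetric] by (rule abs_triangle_ineq)
    also have "\<dots> \<le> \<bar>stable_drift \<alpha> cp cm\<bar> * (1 + l\<^sup>2) + \<bar>cp - cm\<bar> * ((1 / (2 - \<alpha>) + 1 / \<alpha>) * (1 + l\<^sup>2))"
      by (intro add_mono mult_left_mono l1 l3) auto
    finally show ?thesis by (simp add: C_def algebra_simps)
  qed
  moreover have "C \<ge> 0" unfolding C_def using assms by auto
  ultimately show ?thesis using that by blast
qed

section \<open>Characteristic functions, tails and positivity\<close>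

text \<open>On the convex half-plane Re z \<le> 0 the derivative of exp has norm at most 1, so exp
  is 1-Lipschitz there.\<close>

lemma norm_exp_minus_one_le: "norm (exp z - 1) \<le> norm z" if "Re z \<le> 0" for z :: complex
proof -
  have "norm (exp z - exp 0) \<le> 1 * norm (z - 0)"
  proof (rule field_differentiable_bound[where S = "{z. Re z \<le> 0}" and f' = exp])
    show "(exp has_field_derivative exp w) (at w within {z. Re z \<le> 0})" for w :: complex
      by (rule has_field_derivative_at_within) (rule DERIV_exp)
  qed (use that in \<open>auto simp: convex_halfspace_Re_le\<close>)
  then show ?thesis by simp
qed

context real_distribution
begin

lemma has_bochner_integral_cos_char: "has_bochner_integral M (\<lambda>x. cos (t * x)) (Re (char M t))"
proof -
  have "has_bochner_integral M (\<lambda>x. iexp (t * x)) (char M t)"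
    using integrable_iexp[of "\<lambda>x. of_real (t * x)"] by (simp add: char_def has_bochner_integral_iff)
  from has_bochner_integral_bounded_linear[OF bounded_linear_Re this] show ?thesis by (simp add: Re_exp)
qed

lemma has_bochner_integral_sin_char: "has_bochner_integral M (\<lambda>x. sin (t * x)) (Im (char M t))"
proof -
  have "has_bochner_integral M (\<lambda>x. iexp (t * x)) (char M t)"
    using integrable_iexp[of "\<lambda>x. of_real (t * x)"] by (simp add: char_def has_bochner_integral_iff)
  from has_bochner_integral_bounded_linear[OF bounded_linear_Im this] show ?thesis by (simp add: Im_exp)
qed

lemma pair_sigma_finite_dist_lpos: "pair_sigma_finite M lpos"
  by (intro pair_sigma_finite_lpos sigma_finite_measure_axioms)

text \<open>The kernel \<epsilon>^2 / (\<epsilon>^2 + z^2) is the mean of cos (u z / \<epsilon>) for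
  a standard exponential u, so its expectation is read off the characteristic function without any
  moment assumption. It is comparable to the indicator of |z| \<le> \<epsilon> and serves for
  concentration as well as for tails.\<close>

lemma has_bochner_integral_poisson_kernel_char:
  assumes "\<epsilon> > 0"
  shows "has_bochner_integral lpos (\<lambda>u. exp (- u) * Re (char M (u / \<epsilon>))) (integral\<^sup>L M (\<lambda>z. \<epsilon>\<^sup>2 / (\<epsilon>\<^sup>2 + z\<^sup>2)))"
proof -
  interpret pair_sigma_finite M lpos by (rule pair_sigma_finite_dist_lpos)
  let ?f = "\<lambda>z u. exp (- u) * cos (u / \<epsilon> * z)"
  have meas: "(\<lambda>(z, u). ?f z u) \<in> borel_measurable (M \<Otimes>\<^sub>M lpos)"
    by (intro measurable_lpos_pair) auto
  have 1: "has_bochner_integral lpos (?f z) (\<epsilon>\<^sup>2 / (\<epsilon>\<^sup>2 + z\<^sup>2))" for z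
  proof -
    have "has_bochner_integral lpos (\<lambda>u. exp (- (1 * u)) * cos ((z / \<epsilon>) * u)) (1 / (1\<^sup>2 + (z / \<epsilon>)\<^sup>2))"
      by (rule has_bochner_integral_lpos_exp_cos) simp
    also have "1 / (1\<^sup>2 + (z / \<epsilon>)\<^sup>2) = \<epsilon>\<^sup>2 / (\<epsilon>\<^sup>2 + z\<^sup>2)"
      using assms by (simp add: field_simps)
    finally show ?thesis by (simp add: mult_ac)
  qed
  show ?thesis
  proof (rule has_bochner_integral_swap[OF meas 1])
    show "has_bochner_integral M (\<lambda>z. ?f z u) (exp (- u) * Re (char M (u / \<epsilon>)))" for u
      by (intro has_bochner_integral_mult_right has_bochner_integral_cos_char)
    have bound: "norm (integral\<^sup>L lpos (\<lambda>u. norm (?f z u))) \<le> 1" for z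
    proof -
      have "integral\<^sup>L lpos (\<lambda>u. norm (?f z u)) \<le> integral\<^sup>L lpos (\<lambda>u. exp (- (1 * u)))"
        using 1[of z] has_bochner_integral_lpos_exp[of 1]
        by (intro integral_mono integrable_norm) (auto simp: has_bochner_integral_iff abs_mult mult_left_le)
      then show ?thesis using has_bochner_integral_lpos_exp[of 1] by (simp add: has_bochner_integral_iff)
    qed
    have "(\<lambda>z. integral\<^sup>L lpos (\<lambda>u. norm (?f z u))) \<in> borel_measurable M"
      using meas by (intro M2.borel_measurable_lebesgue_integral) auto
    then show "integrable M (\<lambda>z. integral\<^sup>L lpos (\<lambda>u. norm (?f z u)))"
      using bound by (intro integrable_const_bound[of _ 1]) auto
  qed
qed

text \<open>The kernel is at least 1/2 where |z| \<le> \<epsilon>, whence the factor 2. As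
  \<epsilon> tends to 0, decay of the characteristic function excludes an atom at 0.\<close>

lemma prob_abs_le_char:
  assumes "\<epsilon> > 0"
  shows "prob {z. \<bar>z\<bar> \<le> \<epsilon>} \<le> 2 * integral\<^sup>L lpos (\<lambda>u. exp (- u) * norm (char M (u / \<epsilon>)))"
proof -
  have "prob {z. \<bar>z\<bar> \<le> \<epsilon>} = integral\<^sup>L M (indicator {z. \<bar>z\<bar> \<le> \<epsilon>})" by simp
  also have "\<dots> \<le> integral\<^sup>L M (\<lambda>z. 2 * (\<epsilon>\<^sup>2 / (\<epsilon>\<^sup>2 + z\<^sup>2)))"
  proof (rule integral_mono)
    have pos: "\<epsilon>\<^sup>2 + z\<^sup>2 > 0" for z using assms by (simp add: add_pos_nonneg)
    show "integrable M (\<lambda>z. 2 * (\<epsilon>\<^sup>2 / (\<epsilon>\<^sup>2 + z\<^sup>2)))"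
      using pos by (intro integrable_mult_right integrable_const_bound[of _ 1]) (auto simp: divide_le_eq abs_of_pos abs_divide)
    show "indicator {z. \<bar>z\<bar> \<le> \<epsilon>} z \<le> 2 * (\<epsilon>\<^sup>2 / (\<epsilon>\<^sup>2 + z\<^sup>2))" for z
    proof (cases "\<bar>z\<bar> \<le> \<epsilon>")
      case True
      then have "z\<^sup>2 \<le> \<epsilon>\<^sup>2" using assms by (simp add: abs_le_square_iff[symmetric])
      then show ?thesis using True pos[of z] by (simp add: field_simps)
    qed (use pos[of z] in simp)
    show "integrable M (indicat_real {z. \<bar>z\<bar> \<le> \<epsilon>})"
      by (intro integrable_const_bound[of _ 1]) auto
  qed
  also have "\<dots> = 2 * integral\<^sup>L lpos (\<lambda>u. exp (- u) * Re (char M (u / \<epsilon>)))"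
    unfolding Bochner_Integration.integral_mult_right_zero
      has_bochner_integral_integral_eq[OF has_bochner_integral_poisson_kernel_char[OF assms]] by simp
  also have "\<dots> \<le> 2 * integral\<^sup>L lpos (\<lambda>u. exp (- u) * norm (char M (u / \<epsilon>)))"
  proof (intro mult_left_mono integral_mono)
    show "integrable lpos (\<lambda>u. exp (- u) * Re (char M (u / \<epsilon>)))"
      using has_bochner_integral_poisson_kernel_char[OF assms] by (simp add: has_bochner_integral_iff)
    show "integrable lpos (\<lambda>u. exp (- u) * norm (char M (u / \<epsilon>)))"
      using integrable_lpos_exp_bounded[of 1 "\<lambda>u. norm (char M (u / \<epsilon>))" 1] cmod_char_le_1 by auto
  qed (auto intro!: complex_Re_le_cmod)
  finally show ?thesis .
qed

text \<open>Where |z| > \<eta>, one minus the kernel is at least 1/2, and 1 - Re (char) is at most s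
  times the norm of \<psi>. Integrating C (1 + u^2 / \<eta>^2) against exp (- u) gives the constant,
  the second moment being Gamma 3 = 2. Linearity in s is what makes exit by time t an event of order
  t.\<close>

lemma prob_abs_gt_char:
  assumes "\<eta> > 0" "s \<ge> 0" "\<And>l. char M l = exp (of_real s * \<psi> l)" "\<And>l. norm (\<psi> l) \<le> C * (1 + l\<^sup>2)"
  shows "prob {z. \<bar>z\<bar> > \<eta>} \<le> 2 * C * (1 + 2 / \<eta>\<^sup>2) * s"
proof -
  have pos: "\<eta>\<^sup>2 + z\<^sup>2 > 0" for z using assms by (simp add: add_pos_nonneg)
  have int: "integrable M (\<lambda>z. \<eta>\<^sup>2 / (\<eta>\<^sup>2 + z\<^sup>2))"
    using pos by (intro integrable_const_bound[of _ 1]) (auto simp: divide_le_eq abs_of_pos abs_divide)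
  have "prob {z. \<bar>z\<bar> > \<eta>} = integral\<^sup>L M (indicator {z. \<bar>z\<bar> > \<eta>})" by simp
  also have "\<dots> \<le> integral\<^sup>L M (\<lambda>z. 2 * (1 - \<eta>\<^sup>2 / (\<eta>\<^sup>2 + z\<^sup>2)))"
  proof (rule integral_mono)
    show "integrable M (\<lambda>z. 2 * (1 - \<eta>\<^sup>2 / (\<eta>\<^sup>2 + z\<^sup>2)))"
      by (intro integrable_mult_right Bochner_Integration.integrable_diff int) auto
    show "indicator {z. \<bar>z\<bar> > \<eta>} z \<le> 2 * (1 - \<eta>\<^sup>2 / (\<eta>\<^sup>2 + z\<^sup>2))" for z
    proof (cases "\<bar>z\<bar> > \<eta>")
      case True
      then have "\<eta>\<^sup>2 \<le> z\<^sup>2" using assms by (simp add: abs_le_square_iff[symmetric])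
      then show ?thesis using True pos[of z] by (simp add: field_simps)
    qed (use pos[of z] in \<open>simp add: field_simps\<close>)
    show "integrable M (indicat_real {z. \<bar>z\<bar> > \<eta>})"
      by (intro integrable_const_bound[of _ 1]) auto
  qed
  also have "\<dots> = 2 * (1 - integral\<^sup>L lpos (\<lambda>u. exp (- u) * Re (char M (u / \<eta>))))"
    unfolding Bochner_Integration.integral_mult_right_zero
      has_bochner_integral_integral_eq[OF has_bochner_integral_poisson_kernel_char[OF assms(1)]]
    using int by (simp add: prob_space[simplified])
  also have "1 - integral\<^sup>L lpos (\<lambda>u. exp (- u) * Re (char M (u / \<eta>))) = integral\<^sup>L lpos (\<lambda>u. exp (- u) - exp (- u) * Re (char M (u / \<eta>)))"
    using has_bochner_integral_lpos_exp[of 1] has_bochner_integral_poisson_kernel_char[OF assms(1)]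
    by (simp add: has_bochner_integral_iff)
  also have "\<dots> \<le> integral\<^sup>L lpos (\<lambda>u. s * C * (exp (- (1 * u)) + 1 / \<eta>\<^sup>2 * (u powr 2 * exp (- (1 * u)))))"
  proof (rule integral_mono_AE)
    show "integrable lpos (\<lambda>u. exp (- u) - exp (- u) * Re (char M (u / \<eta>)))"
      using has_bochner_integral_lpos_exp[of 1] has_bochner_integral_poisson_kernel_char[OF assms(1)]
      by (simp add: has_bochner_integral_iff)
    show "integrable lpos (\<lambda>u. s * C * (exp (- (1 * u)) + 1 / \<eta>\<^sup>2 * (u powr 2 * exp (- (1 * u)))))"
      using has_bochner_integral_lpos_exp[of 1] has_bochner_integral_lpos_powr_exp[of 2 1]
      by (intro integrable_mult_right Bochner_Integration.integrable_add) (auto simp: has_bochner_integral_iff)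
    have *: "exp (- u) - exp (- u) * Re (char M (u / \<eta>)) \<le> s * C * (exp (- (1 * u)) + 1 / \<eta>\<^sup>2 * (u powr 2 * exp (- (1 * u))))" if "u > 0" for u
    proof -
      \<comment> \<open>A characteristic function has modulus at most 1, which for the exponent
        means a nonpositive real part.\<close>
      have "Re (of_real s * \<psi> (u / \<eta>)) \<le> 0"
        using cmod_char_le_1[of "u / \<eta>"] unfolding assms(3) by simp
      then have "norm (exp (of_real s * \<psi> (u / \<eta>)) - 1) \<le> norm (of_real s * \<psi> (u / \<eta>))"
        by (rule norm_exp_minus_one_le)
      then have "1 - Re (char M (u / \<eta>)) \<le> norm (of_real s * \<psi> (u / \<eta>))"
        using abs_Re_le_cmod[of "exp (of_real s * \<psi> (u / \<eta>)) - 1"] unfolding assms(3) by simp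
      also have "\<dots> \<le> s * (C * (1 + (u / \<eta>)\<^sup>2))"
        using assms(2,4) by (simp add: norm_mult mult_left_mono)
      finally have "exp (- u) * (1 - Re (char M (u / \<eta>))) \<le> exp (- u) * (s * (C * (1 + (u / \<eta>)\<^sup>2)))"
        by (intro mult_left_mono) auto
      then show ?thesis using that by (simp add: algebra_simps power_divide)
    qed
    show "AE u in lpos. exp (- u) - exp (- u) * Re (char M (u / \<eta>)) \<le> s * C * (exp (- (1 * u)) + 1 / \<eta>\<^sup>2 * (u powr 2 * exp (- (1 * u))))"
      by (rule AE_I2) (rule *, simp add: space_restrict_space)
  qed
  also have "\<dots> = s * C * (1 / 1 + 1 / \<eta>\<^sup>2 * (Gamma (2 + 1) * 1 powr (- 2 - 1)))"
    by (intro has_bochner_integral_integral_eq has_bochner_integral_mult_right has_bochner_integral_add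
        has_bochner_integral_lpos_exp has_bochner_integral_lpos_powr_exp) auto
  also have "Gamma (2 + 1) = (2::real)" using Gamma_fact[of 2, where 'a = real] by (simp add: numeral_2_eq_2)
  finally show ?thesis by (simp add: mult_ac)
qed

text \<open>The kernel sin (l z) / l is bounded near l = 0 only by |z|, which need not be
  integrable, and is not absolutely integrable at infinity. The factor exp (- \<epsilon> l) - exp (-
  N l) repairs both ends: the product is at most (N - \<epsilon>) exp (- \<epsilon> l), uniformly in
  z.\<close>

lemma integral_arctan_char:
  assumes "0 < \<epsilon>" "\<epsilon> \<le> N"
  shows "has_bochner_integral lpos (\<lambda>l. (exp (- (\<epsilon> * l)) - exp (- (N * l))) / l * Im (char M l))
           (integral\<^sup>L M (\<lambda>z. arctan (z / \<epsilon>) - arctan (z / N)))"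
proof -
  interpret pair_sigma_finite M lpos by (rule pair_sigma_finite_dist_lpos)
  let ?f = "\<lambda>z l. (exp (- (\<epsilon> * l)) - exp (- (N * l))) / l * sin (l * z)"
  have meas: "(\<lambda>(z, l). ?f z l) \<in> borel_measurable (M \<Otimes>\<^sub>M lpos)"
    by (intro measurable_lpos_pair) auto
  have 1: "has_bochner_integral lpos (?f z) (arctan (z / \<epsilon>) - arctan (z / N))" for z
  proof -
    have "has_bochner_integral lpos (\<lambda>l. exp (- (\<epsilon> * l)) * (sin (z * l) / l) - exp (- (N * l)) * (sin (z * l) / l))
       (arctan (z / \<epsilon>) - arctan (z / N))"
      using assms by (intro has_bochner_integral_diff has_bochner_integral_lpos_frullani) auto
    also have "?this \<longleftrightarrow> ?thesis"
      by (intro has_bochner_integral_lpos_cong) (simp_all add: field_simps)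
    finally show ?thesis .
  qed
  show ?thesis
  proof (rule has_bochner_integral_swap[OF meas 1])
    show "has_bochner_integral M (\<lambda>z. ?f z l) ((exp (- (\<epsilon> * l)) - exp (- (N * l))) / l * Im (char M l))" for l
      by (intro has_bochner_integral_mult_right has_bochner_integral_sin_char)
    have le: "norm (?f z l) \<le> (N - \<epsilon>) * exp (- (\<epsilon> * l))" if "l > 0" for z l
    proof -
      have "exp (- (\<epsilon> * l)) - exp (- (N * l)) = exp (- (\<epsilon> * l)) * (1 - exp (- ((N - \<epsilon>) * l)))"
        by (simp add: right_diff_distrib mult_exp_exp algebra_simps)
      also have "\<dots> \<le> exp (- (\<epsilon> * l)) * ((N - \<epsilon>) * l)"
      proof (rule mult_left_mono)
        show "1 - exp (- ((N - \<epsilon>) * l)) \<le> (N - \<epsilon>) * l"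
          using exp_ge_add_one_self[of "- ((N - \<epsilon>) * l)"] by linarith
      qed simp
      finally have "(exp (- (\<epsilon> * l)) - exp (- (N * l))) / l \<le> (N - \<epsilon>) * exp (- (\<epsilon> * l))"
        using that by (simp add: divide_le_eq mult_ac)
      moreover have "0 \<le> (exp (- (\<epsilon> * l)) - exp (- (N * l))) / l"
        using that assms by auto
      ultimately have "\<bar>(exp (- (\<epsilon> * l)) - exp (- (N * l))) / l\<bar> * \<bar>sin (l * z)\<bar> \<le> ((N - \<epsilon>) * exp (- (\<epsilon> * l))) * 1"
        by (intro mult_mono) auto
      then show ?thesis by (simp add: abs_mult)
    qed
    have bound: "norm (integral\<^sup>L lpos (\<lambda>l. norm (?f z l))) \<le> (N - \<epsilon>) * (1 / \<epsilon>)" for z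
    proof -
      have "integral\<^sup>L lpos (\<lambda>l. norm (?f z l)) \<le> integral\<^sup>L lpos (\<lambda>l. (N - \<epsilon>) * exp (- (\<epsilon> * l)))"
        using 1[of z] has_bochner_integral_lpos_exp[of \<epsilon>] assms le
        by (intro integral_mono_AE integrable_norm AE_I2) (auto simp: has_bochner_integral_iff space_restrict_space simp del: real_norm_def)
      then show ?thesis using has_bochner_integral_lpos_exp[of \<epsilon>] assms by (simp add: has_bochner_integral_iff)
    qed
    have "(\<lambda>(z, l). norm (?f z l)) \<in> borel_measurable (M \<Otimes>\<^sub>M lpos)"
      by (intro measurable_lpos_pair) auto
    then have "(\<lambda>z. integral\<^sup>L lpos (\<lambda>l. norm (?f z l))) \<in> borel_measurable M"
      by (rule M2.borel_measurable_lebesgue_integral)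
    then show "integrable M (\<lambda>z. integral\<^sup>L lpos (\<lambda>l. norm (?f z l)))"
      using bound by (intro integrable_const_bound[of _ "(N - \<epsilon>) * (1 / \<epsilon>)"]) auto
  qed
qed

text \<open>Both sides of \<open>integral_arctan_char\<close> are taken to the limit along
  \<epsilon> = 1/(n+1), N = n+1. The difference of arctangents tends to (pi/2) sgn z, while the
  substitution s = l^\<alpha> turns Im (char) / l into the Frullani integrand. An atom at 0 would
  enter with weight 1/2, hence the last hypothesis.\<close>

lemma prob_neg_stable:
  assumes "\<alpha> > 0" "A > 0" "\<And>l. l > 0 \<Longrightarrow> char M l = exp (of_real (l powr \<alpha>) * Complex (- A) B)"
    and "prob {0} = 0"
  shows "prob {..<0} = 1 / 2 - arctan (B / A) / (pi * \<alpha>)"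
proof -
  have lim: "has_bochner_integral lpos (\<lambda>l. Im (char M l) / l) (arctan (B / A) / \<alpha>)"
  proof -
    have "has_bochner_integral lpos (\<lambda>s. exp (- (A * s)) * (sin (B * s) / s)) (arctan (B / A))"
      by (rule has_bochner_integral_lpos_frullani) fact
    then have "has_bochner_integral lpos (\<lambda>l. \<alpha> * l powr (\<alpha> - 1) * (exp (- (A * l powr \<alpha>)) * (sin (B * l powr \<alpha>) / l powr \<alpha>))) (arctan (B / A))"
      by (intro has_bochner_integral_lpos_subst_powr) (use assms(1) in \<open>auto intro!: continuous_intros\<close>)
    then have "has_bochner_integral lpos (\<lambda>l. 1 / \<alpha> * (\<alpha> * l powr (\<alpha> - 1) * (exp (- (A * l powr \<alpha>)) * (sin (B * l powr \<alpha>) / l powr \<alpha>)))) (1 / \<alpha> * arctan (B / A))"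
      by (rule has_bochner_integral_mult_right)
    also have "?this \<longleftrightarrow> ?thesis"
      using assms(1) by (intro has_bochner_integral_lpos_cong) (auto simp: assms(3) Im_exp powr_diff mult_ac)
    finally show ?thesis .
  qed
  define k where "k n l = exp (- (1 / real (Suc n) * l)) - exp (- (real (Suc n) * l))" for n and l :: real
  have "(\<lambda>n. integral\<^sup>L lpos (\<lambda>l. k n l * (Im (char M l) / l))) \<longlonglongrightarrow> integral\<^sup>L lpos (\<lambda>l. Im (char M l) / l)"
  \<comment> \<open>The limit is itself absolutely integrable by \<open>lim\<close>, and it
    dominates because the regularising factor is at most 1 in modulus.\<close>
  proof (rule integral_dominated_convergence[where w = "\<lambda>l. \<bar>Im (char M l) / l\<bar>"])
    show "integrable lpos (\<lambda>l. \<bar>Im (char M l) / l\<bar>)"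
      by (rule integrable_abs) (use lim in \<open>simp add: has_bochner_integral_iff\<close>)
    show "(\<lambda>l. Im (char M l) / l) \<in> borel_measurable lpos" by (rule measurable_lpos) measurable
    show "(\<lambda>l. k n l * (Im (char M l) / l)) \<in> borel_measurable lpos" for n
      unfolding k_def by (rule measurable_lpos) measurable
    have "(\<lambda>n. k n l * (Im (char M l) / l)) \<longlonglongrightarrow> 1 * (Im (char M l) / l)" if "l > 0" for l
    proof (intro tendsto_mult tendsto_const)
      show "(\<lambda>n. k n l) \<longlonglongrightarrow> 1" unfolding k_def using that by real_asymp
    qed
    then show "AE l in lpos. (\<lambda>n. k n l * (Im (char M l) / l)) \<longlonglongrightarrow> Im (char M l) / l"
      by (intro AE_I2) (auto simp: space_restrict_space)
    have "norm (k n l * (Im (char M l) / l)) \<le> \<bar>Im (char M l) / l\<bar>" if "l > 0" for n l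
    proof -
      have "1 / real (Suc n) \<le> real (Suc n)" by (simp add: field_simps)
      then have "1 / real (Suc n) * l \<le> real (Suc n) * l" using that by (intro mult_right_mono) auto
      moreover have "exp (- (1 / real (Suc n) * l)) \<le> 1" using that by simp
      moreover have "exp (- (real (Suc n) * l)) > 0" by simp
      ultimately have "\<bar>k n l\<bar> \<le> 1" unfolding k_def by (smt (verit) exp_le_cancel_iff)
      then have "\<bar>k n l\<bar> * \<bar>Im (char M l) / l\<bar> \<le> 1 * \<bar>Im (char M l) / l\<bar>"
        by (rule mult_right_mono) simp
      then show ?thesis by (simp only: real_norm_def abs_mult mult_1)
    qed
    then show "AE l in lpos. norm (k n l * (Im (char M l) / l)) \<le> \<bar>Im (char M l) / l\<bar>" for n
      by (intro AE_I2) (auto simp: space_restrict_space)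
  qed
  also have "(\<lambda>n. integral\<^sup>L lpos (\<lambda>l. k n l * (Im (char M l) / l))) =
     (\<lambda>n. integral\<^sup>L M (\<lambda>z. arctan (z / (1 / real (Suc n))) - arctan (z / real (Suc n))))"
  proof
    fix n
    have "has_bochner_integral lpos (\<lambda>l. (exp (- (1 / real (Suc n) * l)) - exp (- (real (Suc n) * l))) / l * Im (char M l))
           (integral\<^sup>L M (\<lambda>z. arctan (z / (1 / real (Suc n))) - arctan (z / real (Suc n))))"
      by (rule integral_arctan_char) (simp_all add: field_simps)
    then show "integral\<^sup>L lpos (\<lambda>l. k n l * (Im (char M l) / l)) =
       integral\<^sup>L M (\<lambda>z. arctan (z / (1 / real (Suc n))) - arctan (z / real (Suc n)))"
      unfolding k_def has_bochner_integral_iff by simp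
  qed
  finally have "(\<lambda>n. integral\<^sup>L M (\<lambda>z. arctan (z / (1 / real (Suc n))) - arctan (z / real (Suc n)))) \<longlonglongrightarrow> arctan (B / A) / \<alpha>"
    using lim by (simp add: has_bochner_integral_iff)
  moreover have "(\<lambda>n. integral\<^sup>L M (\<lambda>z. arctan (z / (1 / real (Suc n))) - arctan (z / real (Suc n)))) \<longlonglongrightarrow>
      integral\<^sup>L M (\<lambda>z. pi / 2 * sgn z)"
  proof (rule integral_dominated_convergence[where w = "\<lambda>_. pi"])
    have "(\<lambda>n. arctan (z / (1 / real (Suc n))) - arctan (z / real (Suc n))) \<longlonglongrightarrow> pi / 2 * sgn z" for z
    proof -
      consider "z > 0" | "z = 0" | "z < 0" by linarith
      then show ?thesis by cases (simp, real_asymp, simp, simp, real_asymp)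
    qed
    then show "AE z in M. (\<lambda>n. arctan (z / (1 / real (Suc n))) - arctan (z / real (Suc n))) \<longlonglongrightarrow> pi / 2 * sgn z"
      by simp
    have "\<bar>arctan x - arctan y\<bar> \<le> pi" for x y
      using arctan_bounded[of x] arctan_bounded[of y] by linarith
    then show "AE z in M. norm (arctan (z / (1 / real (Suc n))) - arctan (z / real (Suc n))) \<le> pi" for n
      by simp
  qed auto
  ultimately have eq: "arctan (B / A) / \<alpha> = integral\<^sup>L M (\<lambda>z. pi / 2 * sgn z)"
    by (rule LIMSEQ_unique)
  have "integral\<^sup>L M (\<lambda>z. pi / 2 * sgn z) = integral\<^sup>L M (\<lambda>z. pi / 2 * (1 - indicator {0} z - 2 * indicator {..<0} z))"
    by (intro Bochner_Integration.integral_cong) (auto simp: sgn_if indicator_def)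
  also have "\<dots> = pi / 2 * (1 - prob {0} - 2 * prob {..<0})"
  proof -
    have "integrable M (indicat_real S)" if "S \<in> sets borel" for S
      using that by (intro integrable_const_bound[of _ 1]) auto
    then show ?thesis by (simp add: prob_space[simplified])
  qed
  finally have "arctan (B / A) / \<alpha> = pi / 2 * (1 - 2 * prob {..<0})" unfolding eq assms(4) by simp
  moreover have "p = 1 / 2 - x / pi" if "x = pi / 2 * (1 - 2 * p)" for x p using that by (simp add: field_simps)
  ultimately have "prob {..<0} = 1 / 2 - arctan (B / A) / \<alpha> / pi" by blast
  then show ?thesis by (simp add: mult.commute)
qed

end

section \<open>The value of the killing constant\<close>

lemma tendsto_integral_exp_powr:
  assumes "\<alpha> > 0" "c > 0"
  shows "(\<lambda>n. integral\<^sup>L lpos (\<lambda>u. exp (- u) * exp (- (c * (u * real (Suc n)) powr \<alpha>)))) \<longlonglongrightarrow> 0"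
proof -
  have "(\<lambda>n. integral\<^sup>L lpos (\<lambda>u. exp (- u) * exp (- (c * (u * real (Suc n)) powr \<alpha>)))) \<longlonglongrightarrow> integral\<^sup>L lpos (\<lambda>u. 0)"
  proof (rule integral_dominated_convergence[where w = "\<lambda>u. exp (- (1 * u))"])
    show "integrable lpos (\<lambda>u. exp (- (1 * u)))"
      using has_bochner_integral_lpos_exp[of 1] by (simp add: has_bochner_integral_iff)
    show "(\<lambda>u. exp (- u) * exp (- (c * (u * real (Suc n)) powr \<alpha>))) \<in> borel_measurable lpos" for n
      by (rule measurable_lpos) measurable
    have "(\<lambda>n. exp (- u) * exp (- (c * (u * real (Suc n)) powr \<alpha>))) \<longlonglongrightarrow> 0" if "u > 0" for u
      using assms that by real_asymp
    then show "AE u in lpos. (\<lambda>n. exp (- u) * exp (- (c * (u * real (Suc n)) powr \<alpha>))) \<longlonglongrightarrow> 0"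
      by (intro AE_I2) (auto simp: space_restrict_space)
    show "AE u in lpos. norm (exp (- u) * exp (- (c * (u * real (Suc n)) powr \<alpha>))) \<le> exp (- (1 * u))" for n
      using assms by (intro AE_I2) (auto simp: space_restrict_space)
  qed auto
  then show ?thesis by simp
qed

text \<open>Reflection at -\<alpha> together with sin (pi \<alpha>) = 2 sin (pi \<alpha> / 2) cos
  (pi \<alpha> / 2). It identifies the scale c in the definition of k as - Re \<psi>(1).\<close>

lemma Gamma_minus_cos:
  assumes "0 < \<alpha>" "\<alpha> < 2" "\<alpha> \<noteq> 1"
  shows "- Gamma (- \<alpha>) * cos (pi * \<alpha> / 2) = cos_const \<alpha>"
proof -
  have c: "cos (pi * \<alpha> / 2) \<noteq> 0"
  proof (cases "\<alpha> < 1")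
    case True
    then show ?thesis using assms cos_gt_zero[of "pi * \<alpha> / 2"] by simp
  next
    case False
    then have "cos (pi * \<alpha> / 2) < cos (pi / 2)"
      using assms by (intro cos_monotone_0_pi) auto
    then show ?thesis by simp
  qed
  have s: "sin (pi * \<alpha> / 2) > 0" using assms by (intro sin_gt_zero) auto
  have "complex_of_real (Gamma (- \<alpha>) * Gamma (\<alpha> + 1)) = of_real (- pi / sin (pi * \<alpha>))"
    using Gamma_reflection_complex[of "- of_real \<alpha>"]
    by (simp add: add.commute flip: Gamma_complex_of_real sin_of_real)
  then have "Gamma (- \<alpha>) * Gamma (\<alpha> + 1) = - pi / sin (pi * \<alpha>)" unfolding of_real_eq_iff .
  also have "sin (pi * \<alpha>) = 2 * sin (pi * \<alpha> / 2) * cos (pi * \<alpha> / 2)"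
    using sin_double[of "pi * \<alpha> / 2"] by simp
  finally have *: "Gamma (- \<alpha>) * Gamma (\<alpha> + 1) = - pi / (2 * sin (pi * \<alpha> / 2) * cos (pi * \<alpha> / 2))" .
  have "Gamma (\<alpha> + 1) \<noteq> 0" using Gamma_plus1_pos[OF assms(1)] by linarith
  from iffD2[OF nonzero_eq_divide_eq[OF this] *]
  have "Gamma (- \<alpha>) = - pi / (2 * sin (pi * \<alpha> / 2) * cos (pi * \<alpha> / 2)) / Gamma (\<alpha> + 1)" .
  then show ?thesis using c s unfolding cos_const_def by (simp add: mult_ac)
qed

text \<open>With \<psi>(1) = - A + i B and r its modulus, c times the square root in k is r, and the
  subtraction formula gives r sin (pi \<alpha> \<rho>) = A sin (pi \<alpha> / 2) - B cos (pi
  \<alpha> / 2). There the c_+ parts cancel and c_- pi / Gamma (\<alpha> + 1) remains.\<close>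

lemma kill_const_eq:
  assumes "0 < \<alpha>" "\<alpha> < 2" "\<alpha> \<noteq> 1" "cp + cm > 0"
    and \<rho>: "\<rho> = 1 / 2 - arctan (((cp - cm) * sin_const \<alpha>) / ((cp + cm) * cos_const \<alpha>)) / (pi * \<alpha>)"
  shows "kill_const \<alpha> cp cm \<rho> = cm / \<alpha>"
proof -
  define A where "A = (cp + cm) * cos_const \<alpha>"
  define B where "B = (cp - cm) * sin_const \<alpha>"
  define r where "r = sqrt (A\<^sup>2 + B\<^sup>2)"
  have c: "cos (pi * \<alpha> / 2) \<noteq> 0"
    using Gamma_minus_cos[OF assms(1-3)] cos_const_pos[OF assms(1,2)] by auto
  have s: "sin (pi * \<alpha> / 2) > 0" using assms by (intro sin_gt_zero) auto
  have A: "A > 0" using assms cos_const_pos unfolding A_def by auto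
  have r: "r > 0" unfolding r_def using A by (simp add: add_pos_nonneg)
  have sq: "sqrt (1 + (B / A)\<^sup>2) = r / A"
  proof -
    have "1 + (B / A)\<^sup>2 = (A\<^sup>2 + B\<^sup>2) / A\<^sup>2" using A by (simp add: field_simps)
    then show ?thesis using A by (simp add: r_def real_sqrt_divide)
  qed
  have skew: "stable_skew cp cm * tan (pi * \<alpha> / 2) = B / A"
  proof -
    have "sin_const \<alpha> / cos_const \<alpha> = tan (pi * \<alpha> / 2)"
      using Gamma_plus1_pos[OF assms(1), THEN less_imp_neq] by (simp add: tan_def sin_const_def cos_const_def)
    then show ?thesis
      by (simp add: stable_skew_def A_def B_def flip: times_divide_times_eq)
  qed
  have "pi * \<alpha> * \<rho> = pi * \<alpha> / 2 - arctan (B / A)"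
    using assms(1) by (simp add: \<rho> A_def B_def field_simps)
  then have "sin (pi * \<alpha> * \<rho>) = sin (pi * \<alpha> / 2) * (A / r) - cos (pi * \<alpha> / 2) * (B / r)"
    using A r by (simp add: sin_diff sin_arctan cos_arctan sq)
  also have "\<dots> = (sin (pi * \<alpha> / 2) * A - cos (pi * \<alpha> / 2) * B) / r" by (simp add: diff_divide_distrib)
  also have "sin (pi * \<alpha> / 2) * A - cos (pi * \<alpha> / 2) * B = (cp + cm) * pi / (2 * Gamma (\<alpha> + 1)) - (cp - cm) * pi / (2 * Gamma (\<alpha> + 1))"
    using c s by (simp add: A_def B_def sin_const_def cos_const_def)
  also have "\<dots> = (2 * (cm * pi)) / (2 * Gamma (\<alpha> + 1))"
    unfolding diff_divide_distrib[symmetric] by (simp add: algebra_simps)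
  also have "\<dots> = cm * pi / Gamma (\<alpha> + 1)" by simp
  finally have sin: "sin (pi * \<alpha> * \<rho>) = cm * pi / Gamma (\<alpha> + 1) / r" .
  have "stable_scale \<alpha> cp cm = A"
    unfolding stable_scale_def A_def Gamma_minus_cos[OF assms(1-3), symmetric] by (simp add: algebra_simps)
  then have "kill_const \<alpha> cp cm \<rho> = A * sqrt (1 + (B / A)\<^sup>2) * Gamma \<alpha> * (cm * pi / Gamma (\<alpha> + 1) / r) / pi"
    using assms(3) by (simp add: kill_const_def sin skew[symmetric] power_mult_distrib)
  also have "\<dots> = cm * Gamma \<alpha> / Gamma (\<alpha> + 1)" unfolding sq using A r by simp
  also have "Gamma (\<alpha> + 1) = \<alpha> * Gamma \<alpha>"
    using assms(1) by (intro Gamma_plus1) (auto simp: nonpos_Ints_def)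
  finally show ?thesis using Gamma_real_pos[OF assms(1)] by simp
qed

lemma norm_exp_stable_exponent:
  assumes "0 < \<alpha>" "\<alpha> < 2"
  shows "norm (exp (of_real t * stable_exponent \<alpha> cp cm l)) = exp (- (t * ((cp + cm) * cos_const \<alpha>) * \<bar>l\<bar> powr \<alpha>))"
  by (simp add: stable_exponent_eq[OF assms] algebra_simps)

lemma kill_const_neg_prob:
  assumes "0 < \<alpha>" "\<alpha> < 2" "cp + cm > 0" "\<alpha> = 1 \<Longrightarrow> cp = cm" "stable_family \<alpha> cp cm P X"
  shows "kill_const \<alpha> cp cm (neg_prob P X) = cm / \<alpha>"
proof (cases "\<alpha> = 1")
  case False
  have levy: "levy_process (P 0) X" using assms(5) by (simp add: stable_family_def)
  then interpret prob_space "P 0" by (simp add: levy_process_def)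
  have [measurable]: "X 1 \<in> borel_measurable (P 0)" using levy by (simp add: levy_process_def)
  \<comment> \<open>Subtracting 0 matches the form in which the family prescribes the law of
    \<open>X t\<close> minus the starting point.\<close>
  define M where "M = distr (P 0) borel (\<lambda>\<omega>. X 1 \<omega> - 0)"
  interpret M: real_distribution M unfolding M_def by (rule real_distribution_distr) simp
  have "char M l = exp (of_real 1 * stable_exponent \<alpha> cp cm l)" for l
    unfolding M_def using assms(5) unfolding stable_family_def by (metis zero_le_one)
  then have char: "char M l = exp (stable_exponent \<alpha> cp cm l)" for l by simp
  define K where "K = (cp + cm) * cos_const \<alpha>"
  have K: "K > 0" using assms cos_const_pos unfolding K_def by auto
  \<comment> \<open>The concentration bound with \<epsilon> = 1/(n+1): the modulus exp (- K
    |l|^\<alpha>) of the characteristic function makes the right-hand side vanish in the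
    limit.\<close>
  have "M.prob {0} \<le> 2 * integral\<^sup>L lpos (\<lambda>u. exp (- u) * exp (- (K * (u * real (Suc n)) powr \<alpha>)))" for n
  proof -
    have "M.prob {0} \<le> M.prob {z. \<bar>z\<bar> \<le> 1 / real (Suc n)}"
      by (intro M.finite_measure_mono) auto
    also have "\<dots> \<le> 2 * integral\<^sup>L lpos (\<lambda>u. exp (- u) * norm (char M (u / (1 / real (Suc n)))))"
      by (rule M.prob_abs_le_char) simp
    also have "integral\<^sup>L lpos (\<lambda>u. exp (- u) * norm (char M (u / (1 / real (Suc n))))) = integral\<^sup>L lpos (\<lambda>u. exp (- u) * exp (- (K * (u * real (Suc n)) powr \<alpha>)))"
      using norm_exp_stable_exponent[OF assms(1,2), of 1 cp cm]
      by (intro integral_lpos_cong) (simp add: char K_def abs_mult del: norm_exp_eq_Re)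
    finally show ?thesis .
  qed
  then have "M.prob {0} \<le> 2 * 0"
    by (intro LIMSEQ_le_const[OF tendsto_mult_left[OF tendsto_integral_exp_powr[OF assms(1) K], of 2]]) auto
  then have "M.prob {0} = 0" by (simp add: measure_le_0_iff)
  then have "M.prob {..<0} = 1 / 2 - arctan (((cp - cm) * sin_const \<alpha>) / K) / (pi * \<alpha>)"
    by (intro M.prob_neg_stable)
      (use assms K False in \<open>auto simp: char stable_exponent_eq_pos K_def algebra_simps\<close>)
  moreover have "M.prob {..<0} = neg_prob P X"
    unfolding M_def neg_prob_def by (subst measure_distr) (auto intro!: arg_cong[where f = prob])
  ultimately show ?thesis
    using kill_const_eq[OF assms(1,2) False assms(3)] by (simp add: K_def)
qed (use assms in \<open>simp add: kill_const_def\<close>)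

section \<open>Random walks\<close>

context prob_space
begin

text \<open>Decompose by the first index j whose sum is at most c. If the final sum exceeds c + b,
  the increments from j on add up to more than b, and this is independent of j being first, which
  depends on the increments before j.\<close>

lemma maximal_inequality_first_passage:
  fixes Y :: "nat \<Rightarrow> 'a \<Rightarrow> real"
  assumes indep: "indep_vars (\<lambda>_. borel) Y {..<n}" and "q \<ge> 0"
    and q: "\<And>j. j \<le> n \<Longrightarrow> prob {\<omega> \<in> space M. (\<Sum>i<n. Y i \<omega>) - (\<Sum>i<j. Y i \<omega>) > b} \<le> q"
  shows "prob {\<omega> \<in> space M. (\<exists>j\<le>n. (\<Sum>i<j. Y i \<omega>) \<le> c) \<and> (\<Sum>i<n. Y i \<omega>) > c + b}
     \<le> q * prob {\<omega> \<in> space M. \<exists>j\<le>n. (\<Sum>i<j. Y i \<omega>) \<le> c}" (is "prob ?L \<le> q * prob ?A")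
proof -
  have [measurable]: "Y i \<in> borel_measurable M" if "i < n" for i
    using indep that by (auto simp: indep_vars_def)
  have meas[measurable]: "(\<lambda>\<omega>. \<Sum>i<j. Y i \<omega>) \<in> borel_measurable M" if "j \<le> n" for j
    using that by (intro borel_measurable_sum) auto
  define F where "F j = {\<omega> \<in> space M. (\<Sum>i<j. Y i \<omega>) \<le> c \<and> (\<forall>k<j. (\<Sum>i<k. Y i \<omega>) > c)}" for j
  define G where "G j = {\<omega> \<in> space M. (\<Sum>i<n. Y i \<omega>) - (\<Sum>i<j. Y i \<omega>) > b}" for j
  have F[measurable]: "F j \<in> events" if "j \<le> n" for j
  proof -
    have "{\<omega> \<in> space M. (\<Sum>i<j. Y i \<omega>) \<le> c} \<in> events"
      using meas[OF that] by measurable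
    moreover have "{\<omega> \<in> space M. (\<Sum>i<k. Y i \<omega>) > c} \<in> events" if "k < j" for k
    proof -
      have "k \<le> n" using that \<open>j \<le> n\<close> by simp
      from meas[OF this] show ?thesis by measurable
    qed
    then have "{\<omega> \<in> space M. \<forall>k\<in>{..<j}. (\<Sum>i<k. Y i \<omega>) > c} \<in> events"
      by (intro sets.sets_Collect_finite_All) auto
    ultimately have "{\<omega> \<in> space M. (\<Sum>i<j. Y i \<omega>) \<le> c} \<inter> {\<omega> \<in> space M. \<forall>k\<in>{..<j}. (\<Sum>i<k. Y i \<omega>) > c} \<in> events"
      by (rule sets.Int)
    moreover have "{\<omega> \<in> space M. (\<Sum>i<j. Y i \<omega>) \<le> c} \<inter> {\<omega> \<in> space M. \<forall>k\<in>{..<j}. (\<Sum>i<k. Y i \<omega>) > c} = F j"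
      by (auto simp: F_def)
    ultimately show ?thesis by simp
  qed
  have G[measurable]: "G j \<in> events" if "j \<le> n" for j
    unfolding G_def using meas[OF that] meas[of n] by measurable
  have disj: "disjoint_family_on F {..n}"
    unfolding disjoint_family_on_def
  proof safe
    fix i j \<omega> assume "i \<noteq> j" "\<omega> \<in> F i" "\<omega> \<in> F j"
    then show "\<omega> \<in> {}" unfolding F_def by (cases i j rule: linorder_cases) fastforce+
  qed
  have first: "\<exists>j\<le>n. \<omega> \<in> F j" if "\<omega> \<in> ?A" for \<omega>
  proof -
    from that obtain j where j: "j \<le> n" "(\<Sum>i<j. Y i \<omega>) \<le> c" by auto
    define k where "k = (LEAST k. (\<Sum>i<k. Y i \<omega>) \<le> c)"
    have "(\<Sum>i<k. Y i \<omega>) \<le> c" unfolding k_def using j(2) by (rule LeastI)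
    moreover have "k \<le> j" unfolding k_def using j(2) by (rule Least_le)
    moreover have "(\<Sum>i<m. Y i \<omega>) > c" if "m < k" for m
      using not_less_Least[OF that[unfolded k_def]] by simp
    ultimately show ?thesis using that j by (intro exI[of _ k]) (auto simp: F_def)
  qed
  have FA: "(\<Union>j\<le>n. F j) = ?A"
    using first by (auto simp: F_def)
  have indep_FG: "prob (F j \<inter> G j) = prob (F j) * prob (G j)" if "j \<le> n" for j
  proof -
    \<comment> \<open>The event \<open>F j\<close> is encoded as a {0, 1}-valued function of the
      first j coordinates, so that independence of the two blocks carries over by
      composition.\<close>
    let ?p = "\<lambda>y::nat \<Rightarrow> real. (\<Sum>i<j. y i) \<le> c \<and> (\<forall>k\<in>{..<j}. (\<Sum>i<k. y i) > c)"
    let ?u = "\<lambda>y. if ?p y then 1 else 0 :: real"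
    let ?v = "\<lambda>y::nat \<Rightarrow> real. \<Sum>i\<in>{j..<n}. y i"
    have "indep_var (PiM {..<j} (\<lambda>_. borel)) (\<lambda>\<omega>. restrict (\<lambda>i. Y i \<omega>) {..<j}) (PiM {j..<n} (\<lambda>_. borel)) (\<lambda>\<omega>. restrict (\<lambda>i. Y i \<omega>) {j..<n})"
      using that by (intro indep_var_restrict[OF indep]) auto
    moreover have "?u \<in> borel_measurable (PiM {..<j} (\<lambda>_. borel))"
    proof -
      have *: "(\<lambda>y. \<Sum>i<k. y i) \<in> borel_measurable (PiM {..<j} (\<lambda>_. borel :: real measure))" if "k \<le> j" for k
        using that by (intro borel_measurable_sum measurable_component_singleton) auto
      have "Measurable.pred (PiM {..<j} (\<lambda>_. borel :: real measure)) (\<lambda>y. (\<Sum>i<j. y i) \<le> c)"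
        using *[of j] by measurable
      moreover have "Measurable.pred (PiM {..<j} (\<lambda>_. borel :: real measure)) (\<lambda>y. (\<Sum>i<k. y i) > c)" if "k < j" for k
        using *[OF less_imp_le[OF that]] by measurable
      ultimately have "Measurable.pred (PiM {..<j} (\<lambda>_. borel :: real measure)) ?p"
        by (intro pred_intros_logic pred_intros_finite) auto
      then show ?thesis by measurable
    qed
    moreover have "?v \<in> borel_measurable (PiM {j..<n} (\<lambda>_. borel))"
      by (intro borel_measurable_sum measurable_component_singleton) auto
    ultimately have "indep_var borel (?u \<circ> (\<lambda>\<omega>. restrict (\<lambda>i. Y i \<omega>) {..<j})) borel (?v \<circ> (\<lambda>\<omega>. restrict (\<lambda>i. Y i \<omega>) {j..<n}))"
      by (rule indep_var_compose)
    from indep_varD[OF this, of "{1}" "{b<..}"]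
    have "prob ((\<lambda>\<omega>. (?u (restrict (\<lambda>i. Y i \<omega>) {..<j}), ?v (restrict (\<lambda>i. Y i \<omega>) {j..<n}))) -` ({1} \<times> {b<..}) \<inter> space M) =
       prob ((\<lambda>\<omega>. ?u (restrict (\<lambda>i. Y i \<omega>) {..<j})) -` {1} \<inter> space M) * prob ((\<lambda>\<omega>. ?v (restrict (\<lambda>i. Y i \<omega>) {j..<n})) -` {b<..} \<inter> space M)"
      by (simp add: comp_def)
    moreover have u: "?p (restrict (\<lambda>i. Y i \<omega>) {..<j}) \<longleftrightarrow> (\<Sum>i<j. Y i \<omega>) \<le> c \<and> (\<forall>k<j. (\<Sum>i<k. Y i \<omega>) > c)" for \<omega>
    proof -
      have "(\<Sum>i<k. restrict (\<lambda>i. Y i \<omega>) {..<j} i) = (\<Sum>i<k. Y i \<omega>)" if "k \<le> j" for k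
        using that by (intro sum.cong) auto
      then show ?thesis by auto
    qed
    moreover have v: "?v (restrict (\<lambda>i. Y i \<omega>) {j..<n}) = (\<Sum>i<n. Y i \<omega>) - (\<Sum>i<j. Y i \<omega>)" for \<omega>
    proof -
      have "(\<Sum>i<n. Y i \<omega>) = (\<Sum>i<j. Y i \<omega>) + (\<Sum>i\<in>{j..<n}. Y i \<omega>)"
        using that by (subst sum.union_disjoint[symmetric]) (auto intro!: sum.cong)
      then show ?thesis by simp
    qed
    moreover have "(\<lambda>\<omega>. (?u (restrict (\<lambda>i. Y i \<omega>) {..<j}), ?v (restrict (\<lambda>i. Y i \<omega>) {j..<n}))) -` ({1} \<times> {b<..}) \<inter> space M = F j \<inter> G j"
      unfolding u v F_def G_def by (auto split: if_splits)
    moreover have "(\<lambda>\<omega>. ?u (restrict (\<lambda>i. Y i \<omega>) {..<j})) -` {1} \<inter> space M = F j"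
      unfolding u F_def by (auto split: if_splits)
    moreover have "(\<lambda>\<omega>. ?v (restrict (\<lambda>i. Y i \<omega>) {j..<n})) -` {b<..} \<inter> space M = G j"
      unfolding v G_def by auto
    ultimately show ?thesis by simp
  qed
  have "?L \<subseteq> (\<Union>j\<le>n. F j \<inter> G j)"
  proof
    fix \<omega> assume \<omega>: "\<omega> \<in> ?L"
    then obtain j where "j \<le> n" "\<omega> \<in> F j" using first[of \<omega>] by auto
    moreover then have "\<omega> \<in> G j" using \<omega> unfolding F_def G_def by auto
    ultimately show "\<omega> \<in> (\<Union>j\<le>n. F j \<inter> G j)" by auto
  qed
  then have "prob ?L \<le> prob (\<Union>j\<le>n. F j \<inter> G j)"
    by (intro finite_measure_mono) auto
  also have "\<dots> \<le> (\<Sum>j\<le>n. prob (F j \<inter> G j))"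
    by (intro finite_measure_subadditive_finite) auto
  also have "\<dots> \<le> (\<Sum>j\<le>n. prob (F j) * q)"
    using q[folded G_def] by (intro sum_mono) (auto simp: indep_FG intro!: mult_left_mono)
  also have "\<dots> = q * prob (\<Union>j\<le>n. F j)"
    using disj by (subst finite_measure_finite_Union) (auto simp: sum_distrib_left mult.commute)
  finally show ?thesis unfolding FA .
qed

text \<open>With q = 1/2 in the first-passage inequality, the paths that go low and come back make
  up at most half of the left-hand event; the others end at or below c + b.\<close>

lemma maximal_inequality_ottaviani:
  fixes Y :: "nat \<Rightarrow> 'a \<Rightarrow> real"
  assumes indep: "indep_vars (\<lambda>_. borel) Y {..<n}"
    and q: "\<And>j. j \<le> n \<Longrightarrow> prob {\<omega> \<in> space M. (\<Sum>i<n. Y i \<omega>) - (\<Sum>i<j. Y i \<omega>) > b} \<le> 1 / 2"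
  shows "prob {\<omega> \<in> space M. \<exists>j\<le>n. (\<Sum>i<j. Y i \<omega>) \<le> c} \<le> 2 * prob {\<omega> \<in> space M. (\<Sum>i<n. Y i \<omega>) \<le> c + b}"
    (is "prob ?A \<le> 2 * prob ?B")
proof -
  have [measurable]: "Y i \<in> borel_measurable M" if "i < n" for i
    using indep that by (auto simp: indep_vars_def)
  have meas[measurable]: "(\<lambda>\<omega>. \<Sum>i<j. Y i \<omega>) \<in> borel_measurable M" if "j \<le> n" for j
    using that by (intro borel_measurable_sum) auto
  let ?L = "{\<omega> \<in> space M. (\<exists>j\<le>n. (\<Sum>i<j. Y i \<omega>) \<le> c) \<and> (\<Sum>i<n. Y i \<omega>) > c + b}"
  have "{\<omega> \<in> space M. (\<Sum>i<j. Y i \<omega>) \<le> c} \<in> events" if "j \<le> n" for j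
    using meas[OF that] by measurable
  then have "{\<omega> \<in> space M. \<exists>j\<in>{..n}. (\<Sum>i<j. Y i \<omega>) \<le> c} \<in> events"
    by (intro sets.sets_Collect_finite_Ex) auto
  then have A[measurable]: "?A \<in> events" by (simp add: Bex_def)
  have B[measurable]: "?B \<in> events" "{\<omega> \<in> space M. (\<Sum>i<n. Y i \<omega>) > c + b} \<in> events"
    using meas[of n] by measurable
  have eq: "?L = ?A \<inter> {\<omega> \<in> space M. (\<Sum>i<n. Y i \<omega>) > c + b}" by auto
  have L[measurable]: "?L \<in> events" unfolding eq using A B(2) by (rule sets.Int)
  have "prob ?A \<le> prob (?L \<union> ?B)"
    using A B(1) L by (intro finite_measure_mono) auto
  also have "\<dots> \<le> prob ?L + prob ?B"
    using B(1) L by (intro measure_Un_le) auto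
  also have "prob ?L \<le> 1 / 2 * prob ?A"
    by (rule maximal_inequality_first_passage[OF indep _ q]) auto
  finally show ?thesis by simp
qed

text \<open>The characteristic function of V has modulus at most 1, so the concentration bound for U
  survives the addition of any independent V. This is how a single smooth increment makes a minimum
  atomless.\<close>

lemma prob_abs_add_le_char:
  fixes U V :: "'a \<Rightarrow> real"
  assumes "indep_var borel U borel V" "\<epsilon> > 0"
  shows "prob {\<omega> \<in> space M. \<bar>U \<omega> + V \<omega>\<bar> \<le> \<epsilon>} \<le> 2 * integral\<^sup>L lpos (\<lambda>u. exp (- u) * norm (char (distr M borel U) (u / \<epsilon>)))"
proof -
  from assms have [measurable]: "random_variable borel U" by (elim indep_var_rv1)
  from assms have [measurable]: "random_variable borel V" by (elim indep_var_rv2)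
  interpret UV: real_distribution "distr M borel (\<lambda>\<omega>. U \<omega> + V \<omega>)" by (rule real_distribution_distr) simp
  interpret U: real_distribution "distr M borel U" by (rule real_distribution_distr) simp
  interpret V: real_distribution "distr M borel V" by (rule real_distribution_distr) simp
  have "prob {\<omega> \<in> space M. \<bar>U \<omega> + V \<omega>\<bar> \<le> \<epsilon>} = UV.prob {z. \<bar>z\<bar> \<le> \<epsilon>}"
    by (subst measure_distr) (auto intro!: arg_cong[where f = prob])
  also have "\<dots> \<le> 2 * integral\<^sup>L lpos (\<lambda>u. exp (- u) * norm (char (distr M borel (\<lambda>\<omega>. U \<omega> + V \<omega>)) (u / \<epsilon>)))"
    by (rule UV.prob_abs_le_char) fact
  also have "\<dots> \<le> 2 * integral\<^sup>L lpos (\<lambda>u. exp (- u) * norm (char (distr M borel U) (u / \<epsilon>)))"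
  proof (intro mult_left_mono integral_mono)
    show "integrable lpos (\<lambda>u. exp (- u) * norm (char (distr M borel (\<lambda>\<omega>. U \<omega> + V \<omega>)) (u / \<epsilon>)))"
      using integrable_lpos_exp_bounded[of 1 "\<lambda>u. norm (char (distr M borel (\<lambda>\<omega>. U \<omega> + V \<omega>)) (u / \<epsilon>))" 1] UV.cmod_char_le_1 by auto
    show "integrable lpos (\<lambda>u. exp (- u) * norm (char (distr M borel U) (u / \<epsilon>)))"
      using integrable_lpos_exp_bounded[of 1 "\<lambda>u. norm (char (distr M borel U) (u / \<epsilon>))" 1] U.cmod_char_le_1 by auto
    show "norm (char (distr M borel (\<lambda>\<omega>. U \<omega> + V \<omega>)) (u / \<epsilon>)) \<le> norm (char (distr M borel U) (u / \<epsilon>))" for u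
      using V.cmod_char_le_1[of "u / \<epsilon>"] by (simp add: char_distr_add[OF assms(1)] norm_mult mult_left_le)
  qed auto
  finally show ?thesis .
qed

text \<open>The minimum of the partial sums from m on is the sum of the first m terms plus a minimum
  of sums of later terms, and these depend on disjoint blocks. The shift \<open>a\<close> carries
  the level.\<close>

lemma indep_var_sum_Min:
  fixes Y :: "nat \<Rightarrow> 'a \<Rightarrow> real"
  assumes indep: "indep_vars (\<lambda>_. borel) Y {..<n}" and "m \<le> n"
  shows "indep_var borel (\<lambda>\<omega>. \<Sum>i<m. Y i \<omega>) borel (\<lambda>\<omega>. a + Min ((\<lambda>j. \<Sum>i\<in>{m..<j}. Y i \<omega>) ` {m..n}))"
proof -
  let ?u = "\<lambda>y::nat \<Rightarrow> real. \<Sum>i<m. y i"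
  let ?v = "\<lambda>y::nat \<Rightarrow> real. a + Min ((\<lambda>j. \<Sum>i\<in>{m..<j}. y i) ` {m..n})"
  have "indep_var (PiM {..<m} (\<lambda>_. borel)) (\<lambda>\<omega>. restrict (\<lambda>i. Y i \<omega>) {..<m}) (PiM {m..<n} (\<lambda>_. borel)) (\<lambda>\<omega>. restrict (\<lambda>i. Y i \<omega>) {m..<n})"
    using assms(2) by (intro indep_var_restrict[OF indep]) auto
  moreover have "?u \<in> borel_measurable (PiM {..<m} (\<lambda>_. borel))"
    by (intro borel_measurable_sum measurable_component_singleton) auto
  moreover have "?v \<in> borel_measurable (PiM {m..<n} (\<lambda>_. borel))"
    by (intro borel_measurable_add borel_measurable_Min borel_measurable_sum borel_measurable_const measurable_component_singleton) auto
  ultimately have "indep_var borel (?u \<circ> (\<lambda>\<omega>. restrict (\<lambda>i. Y i \<omega>) {..<m})) borel (?v \<circ> (\<lambda>\<omega>. restrict (\<lambda>i. Y i \<omega>) {m..<n}))"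
    by (rule indep_var_compose)
  moreover have "?u \<circ> (\<lambda>\<omega>. restrict (\<lambda>i. Y i \<omega>) {..<m}) = (\<lambda>\<omega>. \<Sum>i<m. Y i \<omega>)"
    by (auto simp: fun_eq_iff intro!: sum.cong)
  moreover have "?v \<circ> (\<lambda>\<omega>. restrict (\<lambda>i. Y i \<omega>) {m..<n}) = (\<lambda>\<omega>. a + Min ((\<lambda>j. \<Sum>i\<in>{m..<j}. Y i \<omega>) ` {m..n}))"
    by (auto simp: fun_eq_iff intro!: sum.cong arg_cong[where f = Min] image_cong)
  ultimately show ?thesis by simp
qed

end

section \<open>Running minima of the stable process\<close>

text \<open>The exponent is attached to \<open>X t - X 0\<close>, so that the locale can be
  instantiated at every \<open>P x\<close>; the starting point enters later as an almost sure
  statement about \<open>X 0\<close>.\<close>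

locale stable_process = prob_space M for M :: "'a measure" +
  fixes X :: "real \<Rightarrow> 'a \<Rightarrow> real" and \<alpha> cp cm :: real
  assumes \<alpha>: "0 < \<alpha>" "\<alpha> < 2" and cpm: "0 < cp + cm"
    and levy: "levy_process M X"
    and char_increment: "\<And>t l. t \<ge> 0 \<Longrightarrow>
       char (distr M borel (\<lambda>\<omega>. X t \<omega> - X 0 \<omega>)) l = exp (of_real t * stable_exponent \<alpha> cp cm l)"
begin

lemma measurable_X: "t \<ge> 0 \<Longrightarrow> X t \<in> borel_measurable M"
  using levy by (simp add: levy_process_def)

lemma right_continuous: "\<omega> \<in> space M \<Longrightarrow> t \<ge> 0 \<Longrightarrow> ((\<lambda>s. X s \<omega>) \<longlongrightarrow> X t \<omega>) (at_right t)"
  using levy by (simp add: levy_process_def)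

lemma distr_increment:
  assumes "s \<ge> 0" "s \<le> t"
  shows "distr M borel (\<lambda>\<omega>. X t \<omega> - X s \<omega>) = distr M borel (\<lambda>\<omega>. X (t - s) \<omega> - X 0 \<omega>)"
proof -
  have "\<forall>s\<ge>0. \<forall>h\<ge>0. distr M borel (\<lambda>\<omega>. X (s + h) \<omega> - X s \<omega>) = distr M borel (\<lambda>\<omega>. X h \<omega> - X 0 \<omega>)"
    using levy by (simp add: levy_process_def)
  from this[rule_format, of s "t - s"] show ?thesis using assms by simp
qed

lemma indep_increments:
  assumes "h \<ge> 0"
  shows "indep_vars (\<lambda>_. borel) (\<lambda>i \<omega>. X (real (Suc i) * h) \<omega> - X (real i * h) \<omega>) {..<n}"
proof -
  have *: "\<forall>ts::nat \<Rightarrow> real. 0 \<le> ts 0 \<and> incseq ts \<longrightarrow>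
        (\<forall>n. indep_vars (\<lambda>_. borel) (\<lambda>i \<omega>. X (ts (Suc i)) \<omega> - X (ts i) \<omega>) {..<n})"
    using levy by (simp add: levy_process_def)
  have "0 \<le> real 0 * h \<and> incseq (\<lambda>i. real i * h)"
    using assms by (auto simp: incseq_def intro!: mult_right_mono)
  from *[THEN spec, of "\<lambda>i. real i * h", THEN mp, OF this] show ?thesis by (rule spec)
qed

lemma sum_increments: "(\<Sum>i<j. X (real (Suc i) * h) \<omega> - X (real i * h) \<omega>) = X (real j * h) \<omega> - X 0 \<omega>"
  using sum_lessThan_telescope[of "\<lambda>i. X (real i * h) \<omega>" j] by simp

lemma tail_bound:
  assumes "\<eta> > 0"
  obtains C where "C \<ge> 0" "\<And>s t. 0 \<le> s \<Longrightarrow> s \<le> t \<Longrightarrow> prob {\<omega> \<in> space M. \<bar>X t \<omega> - X s \<omega>\<bar> > \<eta>} \<le> C * (t - s)"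
proof -
  obtain C where C: "C \<ge> 0" "\<And>l. norm (stable_exponent \<alpha> cp cm l) \<le> C * (1 + l\<^sup>2)"
    by (rule stable_exponent_bound[OF \<alpha>, of cp cm]) auto
  have "prob {\<omega> \<in> space M. \<bar>X t \<omega> - X s \<omega>\<bar> > \<eta>} \<le> 2 * C * (1 + 2 / \<eta>\<^sup>2) * (t - s)" if "0 \<le> s" "s \<le> t" for s t
  proof -
    have [measurable]: "X s \<in> borel_measurable M" "X t \<in> borel_measurable M" "X (t - s) \<in> borel_measurable M" "X 0 \<in> borel_measurable M"
      using that by (auto intro!: measurable_X)
    interpret D: real_distribution "distr M borel (\<lambda>\<omega>. X (t - s) \<omega> - X 0 \<omega>)" by (rule real_distribution_distr) simp
    have "prob {\<omega> \<in> space M. \<bar>X t \<omega> - X s \<omega>\<bar> > \<eta>} = measure (distr M borel (\<lambda>\<omega>. X t \<omega> - X s \<omega>)) {z. \<bar>z\<bar> > \<eta>}"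
      by (subst measure_distr) (auto intro!: arg_cong[where f = prob])
    also have "\<dots> \<le> 2 * C * (1 + 2 / \<eta>\<^sup>2) * (t - s)"
      unfolding distr_increment[OF that] by (rule D.prob_abs_gt_char) (use assms that C char_increment in auto)
    finally show ?thesis .
  qed
  then show ?thesis using C by (intro that[of "2 * C * (1 + 2 / \<eta>\<^sup>2)"]) auto
qed

text \<open>By right continuity the dyadic grids of \<open>[0, t]\<close> detect
  every strict passage below a level.\<close>

definition low_grid :: "real \<Rightarrow> real \<Rightarrow> nat \<Rightarrow> 'a set" where
  "low_grid t c n = {\<omega> \<in> space M. \<exists>j\<le>2 ^ n. X (real j * (t / 2 ^ n)) \<omega> - X 0 \<omega> \<le> c}"

definition low :: "real \<Rightarrow> real \<Rightarrow> 'a set" where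
  "low t c = (\<Union>n. low_grid t c n)"

lemma measurable_grid [measurable]: "t \<ge> 0 \<Longrightarrow> X (real j * (t / 2 ^ n)) \<in> borel_measurable M"
  by (intro measurable_X) auto

lemma measurable_X0 [measurable]: "X 0 \<in> borel_measurable M"
  by (intro measurable_X) auto

lemma low_grid_events [measurable]: "t \<ge> 0 \<Longrightarrow> low_grid t c n \<in> events"
  unfolding low_grid_def by measurable

lemma low_events [measurable]: "t \<ge> 0 \<Longrightarrow> low t c \<in> events"
  unfolding low_def by measurable

text \<open>Point j of grid n is point 2 j of grid n + 1. The predicate is left open to cover
  passages as well as near-minimal values.\<close>

lemma incseq_grid_ex: "incseq (\<lambda>n. {\<omega> \<in> A. \<exists>j\<le>2 ^ n. Q (X (real j * (t / 2 ^ n)) \<omega>) \<omega>})"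
proof (rule incseq_SucI, safe)
  fix n \<omega> and j :: nat assume "\<omega> \<in> A" "j \<le> 2 ^ n" "Q (X (real j * (t / 2 ^ n)) \<omega>) \<omega>"
  then show "\<exists>j\<le>2 ^ Suc n. Q (X (real j * (t / 2 ^ Suc n)) \<omega>) \<omega>"
    by (intro exI[of _ "2 * j"]) (auto simp: field_simps)
qed

lemma incseq_low_grid: "incseq (low_grid t c)"
  using incseq_grid_ex[of "space M" "\<lambda>x \<omega>. x - X 0 \<omega> \<le> c" t] by (simp add: low_grid_def [abs_def])

lemma prob_incseq_le:
  assumes "incseq A" "\<And>n. A n \<in> events" "\<And>n. n \<ge> n0 \<Longrightarrow> prob (A n) \<le> K"
  shows "prob (\<Union>n. A n) \<le> K"
proof (rule LIMSEQ_le_const2)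
  show "(\<lambda>n. prob (A n)) \<longlonglongrightarrow> prob (\<Union>n. A n)"
    using assms by (intro finite_Lim_measure_incseq) auto
qed (use assms in blast)

text \<open>The grid values form a walk of 2^n increments. What remains after any index lasts at
  most t, so C t bounds all its tails at once; the bound is free of n and can pass to the union over
  n.\<close>

lemma prob_low_grid_and_high:
  assumes "t \<ge> 0" and C: "\<And>s t. 0 \<le> s \<Longrightarrow> s \<le> t \<Longrightarrow> prob {\<omega> \<in> space M. \<bar>X t \<omega> - X s \<omega>\<bar> > b} \<le> C * (t - s)"
    and "C \<ge> 0"
  shows "prob (low_grid t c n \<inter> {\<omega> \<in> space M. X t \<omega> - X 0 \<omega> > c + b}) \<le> C * t * prob (low_grid t c n)"
    and "C * t \<le> 1 / 2 \<Longrightarrow> prob (low_grid t c n) \<le> 2 * prob {\<omega> \<in> space M. X t \<omega> - X 0 \<omega> \<le> c + b}"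
proof -
  let ?h = "t / 2 ^ n"
  let ?Y = "\<lambda>i \<omega>. X (real (Suc i) * ?h) \<omega> - X (real i * ?h) \<omega>"
  have q: "prob {\<omega> \<in> space M. (\<Sum>i<2 ^ n. ?Y i \<omega>) - (\<Sum>i<j. ?Y i \<omega>) > b} \<le> C * t" if "j \<le> 2 ^ n" for j
  proof -
    have jt: "real j * ?h \<le> t"
    proof -
      have "real j \<le> real (2 ^ n)" using that by (simp only: of_nat_le_iff)
      then have "real j * t \<le> 2 ^ n * t" using assms(1) by (intro mult_right_mono) auto
      then show ?thesis by (simp add: field_simps)
    qed
    have [measurable]: "X t \<in> borel_measurable M" "X (real j * ?h) \<in> borel_measurable M"
      using assms(1) by (auto intro!: measurable_X)
    have "prob {\<omega> \<in> space M. (\<Sum>i<2 ^ n. ?Y i \<omega>) - (\<Sum>i<j. ?Y i \<omega>) > b} = prob {\<omega> \<in> space M. X t \<omega> - X (real j * ?h) \<omega> > b}"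
      unfolding sum_increments by simp
    also have "\<dots> \<le> prob {\<omega> \<in> space M. \<bar>X t \<omega> - X (real j * ?h) \<omega>\<bar> > b}"
    proof (rule finite_measure_mono)
      show "{\<omega> \<in> space M. \<bar>X t \<omega> - X (real j * ?h) \<omega>\<bar> > b} \<in> events" by measurable
    qed auto
    also have "\<dots> \<le> C * (t - real j * ?h)"
      using assms(1) jt by (intro C) auto
    also have "\<dots> \<le> C * t" using assms by (intro mult_left_mono) auto
    finally show ?thesis .
  qed
  have indep: "indep_vars (\<lambda>_. borel) ?Y {..<2 ^ n}"
    using assms(1) by (intro indep_increments) auto
  have eq: "low_grid t c n \<inter> {\<omega> \<in> space M. X t \<omega> - X 0 \<omega> > c + b} =
       {\<omega> \<in> space M. (\<exists>j\<le>2 ^ n. X (real j * ?h) \<omega> - X 0 \<omega> \<le> c) \<and> X t \<omega> - X 0 \<omega> > c + b}"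
    by (auto simp: low_grid_def)
  show "prob (low_grid t c n \<inter> {\<omega> \<in> space M. X t \<omega> - X 0 \<omega> > c + b}) \<le> C * t * prob (low_grid t c n)"
    using maximal_inequality_first_passage[OF indep _ q, of c] assms
    unfolding eq unfolding sum_increments low_grid_def by simp
  show "prob (low_grid t c n) \<le> 2 * prob {\<omega> \<in> space M. X t \<omega> - X 0 \<omega> \<le> c + b}" if "C * t \<le> 1 / 2"
    using maximal_inequality_ottaviani[OF indep order_trans[OF q that], of c] assms
    unfolding sum_increments low_grid_def by simp
qed

text \<open>The second maximal inequality with b = - c / 2 reduces the passage to a terminal
  displacement of at most c / 2, which has probability of order t.\<close>

lemma prob_low_le:
  assumes "c < 0"
  obtains K \<delta> where "K \<ge> 0" "\<delta> > 0" "\<And>t. 0 \<le> t \<Longrightarrow> t \<le> \<delta> \<Longrightarrow> prob (low t c) \<le> K * t"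
proof -
  obtain C where C: "C \<ge> 0" "\<And>s t. 0 \<le> s \<Longrightarrow> s \<le> t \<Longrightarrow> prob {\<omega> \<in> space M. \<bar>X t \<omega> - X s \<omega>\<bar> > - c / 2} \<le> C * (t - s)"
    by (rule tail_bound[of "- c / 2"]) (use assms in auto)
  \<comment> \<open>A quarter, so that a displacement of at most c / 2 satisfies the strict
    inequality of the tail event.\<close>
  obtain C' where C': "C' \<ge> 0" "\<And>s t. 0 \<le> s \<Longrightarrow> s \<le> t \<Longrightarrow> prob {\<omega> \<in> space M. \<bar>X t \<omega> - X s \<omega>\<bar> > - c / 4} \<le> C' * (t - s)"
    by (rule tail_bound[of "- c / 4"]) (use assms in auto)
  \<comment> \<open>Ensures C t \<le> 1/2 for t \<le> \<delta>, as the maximal inequality requires;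
    adding 1 covers C = 0.\<close>
  define \<delta> where "\<delta> = 1 / (2 * (C + 1))"
  have "\<delta> > 0" using C by (simp add: \<delta>_def)
  have "prob (low t c) \<le> 2 * C' * t" if t: "0 \<le> t" "t \<le> \<delta>" for t
  proof -
    have [measurable]: "X t \<in> borel_measurable M" using t by (intro measurable_X)
    have "C * t \<le> C * \<delta>" using C t by (intro mult_left_mono)
    also have "\<dots> \<le> 1 / 2" unfolding \<delta>_def using C by (simp add: field_simps)
    finally have half: "C * t \<le> 1 / 2" .
    have "prob (low_grid t c n) \<le> 2 * C' * t" for n
    proof -
      have "prob (low_grid t c n) \<le> 2 * prob {\<omega> \<in> space M. X t \<omega> - X 0 \<omega> \<le> c + - c / 2}"
        by (rule prob_low_grid_and_high(2)[OF t(1) C(2) C(1) half])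
      also have "prob {\<omega> \<in> space M. X t \<omega> - X 0 \<omega> \<le> c + - c / 2} \<le> prob {\<omega> \<in> space M. \<bar>X t \<omega> - X 0 \<omega>\<bar> > - c / 4}"
        using assms by (intro finite_measure_mono) auto
      also have "\<dots> \<le> C' * (t - 0)" using t by (intro C') auto
      finally show ?thesis by simp
    qed
    then show ?thesis unfolding low_def using t by (intro prob_incseq_le[where ?n0.0 = 0] incseq_low_grid) auto
  qed
  then show ?thesis using that[of "2 * C'" \<delta>] C' \<open>\<delta> > 0\<close> by auto
qed

text \<open>After the passage below c an independent upward displacement of more than c' - c is
  needed, which costs a second factor of order t.\<close>

lemma prob_low_and_high_le:
  assumes "c < 0" "c < c'"
  obtains K \<delta> where "K \<ge> 0" "\<delta> > 0" "\<And>t. 0 \<le> t \<Longrightarrow> t \<le> \<delta> \<Longrightarrow> prob (low t c \<inter> {\<omega> \<in> space M. X t \<omega> - X 0 \<omega> > c'}) \<le> K * t\<^sup>2"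
proof -
  obtain K \<delta> where K: "K \<ge> 0" "\<delta> > 0" "\<And>t. 0 \<le> t \<Longrightarrow> t \<le> \<delta> \<Longrightarrow> prob (low t c) \<le> K * t"
    by (rule prob_low_le[of c]) (use assms in auto)
  obtain C where C: "C \<ge> 0" "\<And>s t. 0 \<le> s \<Longrightarrow> s \<le> t \<Longrightarrow> prob {\<omega> \<in> space M. \<bar>X t \<omega> - X s \<omega>\<bar> > c' - c} \<le> C * (t - s)"
    by (rule tail_bound[of "c' - c"]) (use assms in auto)
  have "prob (low t c \<inter> {\<omega> \<in> space M. X t \<omega> - X 0 \<omega> > c'}) \<le> (C * K) * t\<^sup>2" if t: "0 \<le> t" "t \<le> \<delta>" for t
  proof -
    have [measurable]: "X t \<in> borel_measurable M" using t by (intro measurable_X)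
    have "prob (low_grid t c n \<inter> {\<omega> \<in> space M. X t \<omega> - X 0 \<omega> > c'}) \<le> (C * K) * t\<^sup>2" for n
    proof -
      have "prob (low_grid t c n \<inter> {\<omega> \<in> space M. X t \<omega> - X 0 \<omega> > c'}) \<le> C * t * prob (low_grid t c n)"
        using prob_low_grid_and_high(1)[OF t(1) C(2) C(1), of c n] by simp
      also have "\<dots> \<le> C * t * prob (low t c)"
        using t C by (intro mult_left_mono finite_measure_mono) (auto simp: low_def)
      also have "\<dots> \<le> C * t * (K * t)" using K t C by (intro mult_left_mono) auto
      finally show ?thesis by (simp add: power2_eq_square mult_ac)
    qed
    moreover have "incseq (\<lambda>n. low_grid t c n \<inter> {\<omega> \<in> space M. X t \<omega> - X 0 \<omega> > c'})"
      using incseq_low_grid[of t c] unfolding incseq_def by blast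
    moreover have low: "low t c \<inter> {\<omega> \<in> space M. X t \<omega> - X 0 \<omega> > c'} = (\<Union>n. low_grid t c n \<inter> {\<omega> \<in> space M. X t \<omega> - X 0 \<omega> > c'})"
      unfolding low_def by auto
    ultimately have "prob (\<Union>n. low_grid t c n \<inter> {\<omega> \<in> space M. X t \<omega> - X 0 \<omega> > c'}) \<le> (C * K) * t\<^sup>2"
      using t by (intro prob_incseq_le[where ?n0.0 = 0]) auto
    then show ?thesis using low by simp
  qed
  then show ?thesis using that[of "C * K" \<delta>] C K by auto
qed

text \<open>The event that the infimum over the dyadic points of \<open>[0, t]\<close> is exactly \<open>c\<close>.  On the complement
  of this null set, exit before \<open>t\<close> can be read off the grid.\<close>

definition touch :: "real \<Rightarrow> real \<Rightarrow> 'a set" where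
  "touch t c = {\<omega> \<in> space M. (\<forall>k. \<exists>n. \<exists>j\<le>2 ^ n. X (real j * (t / 2 ^ n)) \<omega> - X 0 \<omega> < c + 1 / real (Suc k))
      \<and> (\<forall>n. \<forall>j\<le>2 ^ n. X (real j * (t / 2 ^ n)) \<omega> - X 0 \<omega> \<ge> c)}"

lemma touch_events [measurable]: "t \<ge> 0 \<Longrightarrow> touch t c \<in> events"
  unfolding touch_def by measurable

lemma touchD:
  assumes "\<omega> \<in> touch t c"
  shows "\<omega> \<in> space M" and "\<exists>n. \<exists>j\<le>2 ^ n. X (real j * (t / 2 ^ n)) \<omega> - X 0 \<omega> < c + 1 / real (Suc k)"
    and "j \<le> 2 ^ n \<Longrightarrow> X (real j * (t / 2 ^ n)) \<omega> - X 0 \<omega> \<ge> c"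
  using assms unfolding touch_def by blast+

text \<open>The index 2^(n - m) is the time t / 2^m in grid n. The minimum from there on has the
  increment up to t / 2^m as an independent summand, so the bound depends on m but is uniform in
  n.\<close>

lemma prob_Min_grid_le:
  assumes "t > 0" "m \<le> n" "\<epsilon> > 0"
  shows "prob {\<omega> \<in> space M. \<bar>Min ((\<lambda>j. X (real j * (t / 2 ^ n)) \<omega> - X 0 \<omega>) ` {2 ^ (n - m)..2 ^ n}) - c\<bar> \<le> \<epsilon>}
    \<le> 2 * integral\<^sup>L lpos (\<lambda>u. exp (- u) * exp (- (t / 2 ^ m * ((cp + cm) * cos_const \<alpha>) * (\<bar>u / \<epsilon>\<bar> powr \<alpha>))))"
proof -
  let ?h = "t / 2 ^ n"
  let ?Y = "\<lambda>i \<omega>. X (real (Suc i) * ?h) \<omega> - X (real i * ?h) \<omega>"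
  let ?k = "2 ^ (n - m) :: nat"
  have indep: "indep_vars (\<lambda>_. borel) ?Y {..<2 ^ n}"
    using assms(1) by (intro indep_increments) auto
  have k: "?k \<le> 2 ^ n" by simp
  have kh: "real ?k * ?h = t / 2 ^ m"
  proof -
    have "(2::real) ^ n = 2 ^ (n - m) * 2 ^ m" using assms(2) by (simp flip: power_add)
    then show ?thesis by simp
  qed
  note iv = indep_var_sum_Min[OF indep k, of "- c"]
  have eq: "(\<Sum>i<?k. ?Y i \<omega>) + (- c + Min ((\<lambda>j. \<Sum>i\<in>{?k..<j}. ?Y i \<omega>) ` {?k..2 ^ n}))
      = Min ((\<lambda>j. X (real j * ?h) \<omega> - X 0 \<omega>) ` {?k..2 ^ n}) - c" for \<omega>
  proof -
    have "(\<Sum>i<?k. ?Y i \<omega>) + Min ((\<lambda>j. \<Sum>i\<in>{?k..<j}. ?Y i \<omega>) ` {?k..2 ^ n}) = Min ((\<lambda>x. (\<Sum>i<?k. ?Y i \<omega>) + x) ` ((\<lambda>j. \<Sum>i\<in>{?k..<j}. ?Y i \<omega>) ` {?k..2 ^ n}))"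
      using k by (intro mono_Min_commute) (auto simp: mono_def)
    also have "(\<lambda>x. (\<Sum>i<?k. ?Y i \<omega>) + x) ` ((\<lambda>j. \<Sum>i\<in>{?k..<j}. ?Y i \<omega>) ` {?k..2 ^ n}) = (\<lambda>j. X (real j * ?h) \<omega> - X 0 \<omega>) ` {?k..2 ^ n}"
      unfolding image_image
    proof (rule image_cong)
      fix j assume "j \<in> {?k..2 ^ n}"
      then have "(\<Sum>i<?k. ?Y i \<omega>) + (\<Sum>i\<in>{?k..<j}. ?Y i \<omega>) = (\<Sum>i<j. ?Y i \<omega>)"
        by (subst sum.union_disjoint[symmetric]) (auto intro!: sum.cong simp del: of_nat_Suc)
      then show "(\<Sum>i<?k. ?Y i \<omega>) + (\<Sum>i\<in>{?k..<j}. ?Y i \<omega>) = X (real j * ?h) \<omega> - X 0 \<omega>"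
        unfolding sum_increments .
    qed simp
    finally show ?thesis by simp
  qed
  have "prob {\<omega> \<in> space M. \<bar>(\<Sum>i<?k. ?Y i \<omega>) + (- c + Min ((\<lambda>j. \<Sum>i\<in>{?k..<j}. ?Y i \<omega>) ` {?k..2 ^ n}))\<bar> \<le> \<epsilon>}
    \<le> 2 * integral\<^sup>L lpos (\<lambda>u. exp (- u) * norm (char (distr M borel (\<lambda>\<omega>. \<Sum>i<?k. ?Y i \<omega>)) (u / \<epsilon>)))"
    by (rule prob_abs_add_le_char[OF iv assms(3)])
  also have "(\<lambda>u. exp (- u) * norm (char (distr M borel (\<lambda>\<omega>. \<Sum>i<?k. ?Y i \<omega>)) (u / \<epsilon>))) =
     (\<lambda>u. exp (- u) * exp (- (t / 2 ^ m * ((cp + cm) * cos_const \<alpha>) * (\<bar>u / \<epsilon>\<bar> powr \<alpha>))))"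
    unfolding sum_increments kh using assms(1) by (simp only: char_increment norm_exp_stable_exponent[OF \<alpha>] divide_nonneg_pos zero_less_power zero_less_numeral less_imp_le)
  finally show ?thesis unfolding eq .
qed

text \<open>Outside \<open>low (t / 2 ^ m) (c / 2)\<close> no grid value before t / 2^m is within
  1/(k+1) of c, since 1/(k+1) \<le> - c / 2. On \<open>touch\<close> all grid values are at least c,
  so the minimum over the later part of a fine grid lies within 1/(k+1) of c.\<close>

lemma prob_touch_diff_low_le:
  fixes m k :: nat
  assumes "t > 0" "c < 0" and k: "1 / real (Suc k) \<le> - c / 2"
  defines "\<kappa> \<equiv> (cp + cm) * cos_const \<alpha>"
  shows "prob (touch t c - low (t / 2 ^ m) (c / 2))
    \<le> 2 * integral\<^sup>L lpos (\<lambda>u. exp (- u) * exp (- (t / 2 ^ m * \<kappa> * (u * real (Suc k)) powr \<alpha>)))"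
proof -
  let ?E = "low (t / 2 ^ m) (c / 2)"
  let ?Q = "\<lambda>k. 2 * integral\<^sup>L lpos (\<lambda>u. exp (- u) * exp (- (t / 2 ^ m * \<kappa> * (u * real (Suc k)) powr \<alpha>)))"
  define W where "W n = {\<omega> \<in> touch t c - ?E. \<exists>j\<le>2 ^ n. X (real j * (t / 2 ^ n)) \<omega> - X 0 \<omega> < c + 1 / real (Suc k)}" for n
  have un: "touch t c - ?E = (\<Union>n. W n)"
    using touchD(2)[of _ t c k] unfolding W_def by blast
  have "prob (\<Union>n. W n) \<le> ?Q k"
  \<comment> \<open>From n = m on, the time t / 2^m belongs to the grid; the earlier sets are
    contained in the later ones.\<close>
  proof (rule prob_incseq_le[where ?n0.0 = m])
    show "incseq W"
      unfolding W_def by (rule incseq_grid_ex)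
    show "W n \<in> events" for n
    proof -
      have eq: "W n = (touch t c - ?E) \<inter> {\<omega> \<in> space M. \<exists>j\<le>2 ^ n. X (real j * (t / 2 ^ n)) \<omega> - X 0 \<omega> < c + 1 / real (Suc k)}"
        using touchD(1) unfolding W_def by blast
      have "{\<omega> \<in> space M. \<exists>j\<le>2 ^ n. X (real j * (t / 2 ^ n)) \<omega> - X 0 \<omega> < c + 1 / real (Suc k)} \<in> events"
        using less_imp_le[OF assms(1)] by measurable
      moreover have "touch t c - ?E \<in> events"
        using assms(1) by (intro sets.Diff touch_events low_events) simp_all
      ultimately show ?thesis unfolding eq by (intro sets.Int)
    qed
    fix n assume n: "m \<le> n"
    let ?V = "\<lambda>\<omega>. Min ((\<lambda>j. X (real j * (t / 2 ^ n)) \<omega> - X 0 \<omega>) ` {2 ^ (n - m)..2 ^ n})"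
    have "W n \<subseteq> {\<omega> \<in> space M. \<bar>?V \<omega> - c\<bar> \<le> 1 / real (Suc k)}"
    proof
      fix \<omega> assume "\<omega> \<in> W n"
      then have \<omega>: "\<omega> \<in> touch t c" "\<omega> \<notin> ?E" "\<omega> \<in> space M"
        using touchD(1) by (auto simp: W_def)
      from \<open>\<omega> \<in> W n\<close> obtain j where j: "j \<le> 2 ^ n" "X (real j * (t / 2 ^ n)) \<omega> - X 0 \<omega> < c + 1 / real (Suc k)"
        by (auto simp: W_def)
      \<comment> \<open>Grid n - m of [0, t / 2^m] is the initial part of grid n of [0, t], so an
        early low value would put the path into the excluded event.\<close>
      have jm: "2 ^ (n - m) \<le> j"
      proof (rule ccontr)
        assume "\<not> 2 ^ (n - m) \<le> j"
        then have jle: "j \<le> 2 ^ (n - m)" by simp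
        have "(2::real) ^ n = 2 ^ m * 2 ^ (n - m)" using n by (simp flip: power_add)
        then have e: "real j * (t / 2 ^ m / 2 ^ (n - m)) = real j * (t / 2 ^ n)" by simp
        have "X (real j * (t / 2 ^ m / 2 ^ (n - m))) \<omega> - X 0 \<omega> \<le> c / 2"
          unfolding e using j(2) k by linarith
        then have "\<omega> \<in> low_grid (t / 2 ^ m) (c / 2) (n - m)"
          unfolding low_grid_def using \<omega>(3) jle by blast
        then show False using \<omega>(2) by (auto simp: low_def)
      qed
      have "?V \<omega> \<le> X (real j * (t / 2 ^ n)) \<omega> - X 0 \<omega>"
        using j(1) jm by (intro Min_le) auto
      moreover have "?V \<omega> \<ge> c"
        using touchD(3)[OF \<omega>(1)] by (subst Min_ge_iff) auto
      ultimately show "\<omega> \<in> {\<omega> \<in> space M. \<bar>?V \<omega> - c\<bar> \<le> 1 / real (Suc k)}"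
        using j(2) \<omega>(3) by simp
    qed
    moreover have "{\<omega> \<in> space M. \<bar>?V \<omega> - c\<bar> \<le> 1 / real (Suc k)} \<in> events"
    proof -
      have "?V \<in> borel_measurable M"
        using assms by (intro borel_measurable_Min borel_measurable_diff measurable_grid measurable_X0) auto
      then show ?thesis by measurable
    qed
    ultimately have "prob (W n) \<le> prob {\<omega> \<in> space M. \<bar>?V \<omega> - c\<bar> \<le> 1 / real (Suc k)}"
      by (intro finite_measure_mono)
    also have "\<dots> \<le> 2 * integral\<^sup>L lpos (\<lambda>u. exp (- u) * exp (- (t / 2 ^ m * \<kappa> * (\<bar>u / (1 / real (Suc k))\<bar> powr \<alpha>))))"
      unfolding \<kappa>_def using assms n by (intro prob_Min_grid_le) auto
    also have "integral\<^sup>L lpos (\<lambda>u. exp (- u) * exp (- (t / 2 ^ m * \<kappa> * (\<bar>u / (1 / real (Suc k))\<bar> powr \<alpha>)))) =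
        integral\<^sup>L lpos (\<lambda>u. exp (- u) * exp (- (t / 2 ^ m * \<kappa> * (u * real (Suc k)) powr \<alpha>)))"
      by (rule integral_lpos_cong) (simp add: abs_mult)
    finally show "prob (W n) \<le> ?Q k" .
  qed
  then show ?thesis unfolding un .
qed

text \<open>The order of the limits matters: for fixed m, letting k tend to infinity removes the
  part outside \<open>low (t / 2 ^ m) (c / 2)\<close>; only then does m tend to infinity, and that
  event disappears by its linear bound.\<close>

lemma prob_touch_eq_0:
  assumes "t > 0" "c < 0"
  shows "prob (touch t c) = 0"
proof -
  define \<kappa> where "\<kappa> = (cp + cm) * cos_const \<alpha>"
  have "\<kappa> > 0" unfolding \<kappa>_def using cpm cos_const_pos[OF \<alpha>] by simp
  have not_low: "prob (touch t c - low (t / 2 ^ m) (c / 2)) \<le> 0" for m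
  proof -
    let ?E = "low (t / 2 ^ m) (c / 2)"
    let ?Q = "\<lambda>k. 2 * integral\<^sup>L lpos (\<lambda>u. exp (- u) * exp (- (t / 2 ^ m * \<kappa> * (u * real (Suc k)) powr \<alpha>)))"
    have *: "prob (touch t c - ?E) \<le> ?Q k" if "1 / real (Suc k) \<le> - c / 2" for k
      unfolding \<kappa>_def using that by (intro prob_touch_diff_low_le assms)
    have "?Q \<longlonglongrightarrow> 2 * 0"
      by (intro tendsto_mult_left tendsto_integral_exp_powr) (use \<alpha> assms \<open>\<kappa> > 0\<close> in auto)
    moreover have "eventually (\<lambda>k. prob (touch t c - ?E) \<le> ?Q k) sequentially"
    proof -
      have "(\<lambda>k. 1 / real (Suc k)) \<longlonglongrightarrow> 0" by real_asymp
      then have "eventually (\<lambda>k. 1 / real (Suc k) < - c / 2) sequentially"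
        using assms by (intro order_tendstoD) auto
      then show ?thesis by (rule eventually_mono) (rule *, simp)
    qed
    ultimately have "prob (touch t c - ?E) \<le> 2 * 0"
      by (rule tendsto_lowerbound) simp
    then show ?thesis by simp
  qed
  obtain K \<delta> where K: "K \<ge> 0" "\<delta> > 0" "\<And>t. 0 \<le> t \<Longrightarrow> t \<le> \<delta> \<Longrightarrow> prob (low t (c / 2)) \<le> K * t"
    by (rule prob_low_le[of "c / 2"]) (use assms in auto)
  have "(\<lambda>m. K * (t / 2 ^ m)) \<longlonglongrightarrow> K * 0" by (intro tendsto_mult_left) real_asymp
  moreover have "eventually (\<lambda>m. prob (touch t c) \<le> K * (t / 2 ^ m)) sequentially"
  proof -
    have "(\<lambda>m. t / 2 ^ m) \<longlonglongrightarrow> 0" by real_asymp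
    then have "eventually (\<lambda>m. t / 2 ^ m < \<delta>) sequentially"
      using K by (intro order_tendstoD) auto
    then show ?thesis
    proof eventually_elim
      case (elim m)
      let ?E = "low (t / 2 ^ m) (c / 2)"
      have "prob (touch t c) \<le> prob ((touch t c - ?E) \<union> ?E)"
        using assms by (intro finite_measure_mono sets.Un sets.Diff touch_events low_events) auto
      also have "\<dots> \<le> prob (touch t c - ?E) + prob ?E"
        using assms by (intro measure_Un_le sets.Diff touch_events low_events) auto
      also have "\<dots> \<le> K * (t / 2 ^ m)"
        using not_low[of m] K(3)[of "t / 2 ^ m"] elim assms by simp
      finally show ?case .
    qed
  qed
  ultimately have "prob (touch t c) \<le> K * 0"
    by (rule tendsto_lowerbound) simp
  then show ?thesis by (simp add: measure_le_0_iff)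
qed

end

section \<open>The killed process\<close>

text \<open>Measurability of F is not assumed: agreement with h off a null set makes F measurable
  for the completion. This is the situation of the killed process.\<close>

lemma integral_completion_cong_AE:
  fixes F h :: "'a \<Rightarrow> real"
  assumes [measurable]: "h \<in> borel_measurable M" and ae: "AE x in M. F x = h x"
  shows "integral\<^sup>L (completion M) F = integral\<^sup>L M h"
proof -
  obtain N where N: "N \<in> null_sets M" "{x \<in> space M. F x \<noteq> h x} \<subseteq> N"
    using ae unfolding eventually_ae_filter by blast
  have "F \<in> borel_measurable (completion M)"
  proof (rule measurableI)
    fix S :: "real set" assume [measurable]: "S \<in> sets borel"
    show "F -` S \<inter> space (completion M) \<in> sets (completion M)"
    proof (rule sets_completionI)
      show "F -` S \<inter> space (completion M) = (h -` S \<inter> space M - N) \<union> (F -` S \<inter> N \<inter> space M)"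
        using N(2) by auto
      show "h -` S \<inter> space M - N \<in> sets M"
        using null_setsD2[OF N(1)] by (intro sets.Diff measurable_sets[OF assms(1)]) auto
    qed (use N in auto)
  qed simp
  then have "integral\<^sup>L (completion M) F = integral\<^sup>L (completion M) h"
    by (rule integral_cong_AE[OF _ measurable_completion[OF assms(1)] AE_completion[OF ae]])
  also have "\<dots> = integral\<^sup>L M h" by (rule integral_completion) simp
  finally show ?thesis .
qed

lemma killed_eq_0: "0 \<le> s \<Longrightarrow> s \<le> t \<Longrightarrow> X s \<omega> \<le> 0 \<Longrightarrow> killed X t \<omega> = 0"
proof -
  assume "0 \<le> s" "s \<le> t" "X s \<omega> \<le> 0"
  then have "exit_time X \<omega> \<le> ereal s" unfolding exit_time_def by (intro Inf_lower) auto
  also have "\<dots> \<le> ereal t" using \<open>s \<le> t\<close> by simp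
  finally show ?thesis by (simp add: killed_def)
qed

context stable_process
begin

text \<open>If the path were positive on all of [0, t], right continuity at t would keep it positive
  a little longer, and the exit time would exceed t.\<close>

lemma exit_attained:
  assumes "\<omega> \<in> space M" "t \<ge> 0" "exit_time X \<omega> \<le> ereal t"
  shows "\<exists>s. 0 \<le> s \<and> s \<le> t \<and> X s \<omega> \<le> 0"
proof (rule ccontr)
  assume neg: "\<not> ?thesis"
  then have "X t \<omega> > 0" using assms(2) by force
  then have "eventually (\<lambda>s. X s \<omega> > 0) (at_right t)"
    by (rule order_tendstoD[OF right_continuous[OF assms(1,2)]])
  then obtain b where b: "b > t" "\<And>s. t < s \<Longrightarrow> s < b \<Longrightarrow> X s \<omega> > 0"
    by (auto simp: eventually_at_right[of t "t + 1"])
  have "exit_time X \<omega> < ereal b" using assms(3) b(1) by (simp add: le_less_trans)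
  then obtain s where s: "0 \<le> s" "X s \<omega> \<le> 0" "s < b"
    unfolding exit_time_def Inf_less_iff by auto
  then show False using neg b(2)[of s] by force
qed

text \<open>A strict inequality at s persists to the right of s, and a fine enough grid hits that
  interval inside [0, t]. The time t has no such interval but is itself a grid point.\<close>

lemma grid_below:
  assumes "\<omega> \<in> space M" "0 \<le> s" "s \<le> t" "t > 0" "X s \<omega> < y"
  shows "\<exists>n. \<exists>j\<le>2 ^ n. X (real j * (t / 2 ^ n)) \<omega> < y"
proof (cases "s = t")
  case True
  then show ?thesis using assms(5) by (intro exI[of _ 0] exI[of _ 1]) auto
next
  case False
  have "eventually (\<lambda>s. X s \<omega> < y) (at_right s)"
    by (rule order_tendstoD[OF right_continuous[OF assms(1,2)]]) fact
  then obtain b where b: "b > s" "\<And>r. s < r \<Longrightarrow> r < b \<Longrightarrow> X r \<omega> < y"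
    by (auto simp: eventually_at_right[of s "s + 1"])
  define d where "d = min b t - s"
  have d: "d > 0" using b(1) False assms(3) by (simp add: d_def)
  obtain n :: nat where n: "t / d < 2 ^ n" using real_arch_pow[of 2 "t / d"] by auto
  define h where "h = t / 2 ^ n"
  have h: "0 < h" "h < d" using n d assms(4) by (auto simp: h_def field_simps)
  \<comment> \<open>Adding 1 to the floor places the grid point strictly to the right of s.\<close>
  define j where "j = nat \<lfloor>s / h\<rfloor> + 1"
  have "real j = of_int \<lfloor>s / h\<rfloor> + 1" using assms(2) h(1) by (simp add: j_def)
  then have j: "s / h < real j" "real j \<le> s / h + 1" by linarith+
  have 1: "s < real j * h" using j(1) h(1) by (simp add: field_simps)
  have "real j * h \<le> (s / h + 1) * h" using j(2) h(1) by (intro mult_right_mono) auto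
  also have "\<dots> = s + h" using h(1) by (simp add: field_simps)
  finally have 2: "real j * h < min b t" using h(2) unfolding d_def by linarith
  then have "real j * h < real (2 ^ n) * h" by (simp add: h_def)
  then have "j \<le> 2 ^ n" using h(1) by (simp del: of_nat_power)
  moreover have "X (real j * h) \<omega> < y" using 1 2 by (intro b(2)) auto
  ultimately show ?thesis unfolding h_def by blast
qed

text \<open>A grid value at most 0 means killed, and f vanishes at 0. Exit while all grid values are
  positive forces some of them arbitrarily close to 0, which is \<open>touch\<close>. Otherwise the
  path has not been killed and is positive at t.\<close>

lemma killed_eq_not_low:
  assumes "\<omega> \<in> space M" "X 0 \<omega> = x" "t > 0" "f 0 = 0" "\<omega> \<notin> touch t (- x)"
  shows "f (killed X t \<omega>) = zero_ext f (X t \<omega>) * indicator (space M - low t (- x)) \<omega>"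
proof (cases "\<omega> \<in> low t (- x)")
  case True
  then obtain n j where j: "j \<le> 2 ^ n" "X (real j * (t / 2 ^ n)) \<omega> - X 0 \<omega> \<le> - x"
    by (auto simp: low_def low_grid_def)
  have "real j \<le> real (2 ^ n)" using j(1) by (simp only: of_nat_le_iff)
  then have "real j * (t / 2 ^ n) \<le> 2 ^ n * (t / 2 ^ n)" using assms(3) by (intro mult_right_mono) auto
  then have "killed X t \<omega> = 0"
    using j(2) assms by (intro killed_eq_0[of "real j * (t / 2 ^ n)"]) auto
  then show ?thesis using True assms(4) by simp
next
  case False
  then have pos: "X (real j * (t / 2 ^ n)) \<omega> - X 0 \<omega> > - x" if "j \<le> 2 ^ n" for n j
    using that assms(1) unfolding low_def low_grid_def by force
  \<comment> \<open>Index 1 of the grid with n = 0 is the time t.\<close>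
  from pos[of 1 0] have "X t \<omega> > 0" using assms(2) by simp
  moreover have "ereal t < exit_time X \<omega>"
  proof (rule ccontr)
    assume "\<not> ereal t < exit_time X \<omega>"
    then have "exit_time X \<omega> \<le> ereal t" by simp
    then obtain s where s: "0 \<le> s" "s \<le> t" "X s \<omega> \<le> 0"
      using exit_attained[OF assms(1) less_imp_le[OF assms(3)]] by blast
    have "\<exists>n. \<exists>j\<le>2 ^ n. X (real j * (t / 2 ^ n)) \<omega> - X 0 \<omega> < - x + 1 / real (Suc k)" for k
    proof -
      have "0 < 1 / real (Suc k)" by simp
      then have "X s \<omega> < 1 / real (Suc k)" using s(3) by linarith
      from grid_below[OF assms(1) s(1,2) assms(3) this] show ?thesis
        unfolding assms(2) by (simp add: algebra_simps)
    qed
    then have "\<omega> \<in> touch t (- x)"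
      unfolding touch_def using assms(1) less_imp_le[OF pos] by blast
    then show False using assms(5) by simp
  qed
  ultimately show ?thesis using False assms(1) by (simp add: killed_def zero_ext_def)
qed

lemma integral_killed:
  assumes "AE \<omega> in M. X 0 \<omega> = x" "x > 0" "t > 0" "f 0 = 0" and [measurable]: "zero_ext f \<in> borel_measurable borel"
  shows "(LINT \<omega>|completion M. f (killed X t \<omega>)) = (LINT \<omega>|M. zero_ext f (X t \<omega>) * indicator (space M - low t (- x)) \<omega>)"
proof (rule integral_completion_cong_AE)
  have [measurable]: "X t \<in> borel_measurable M" using assms(3) by (intro measurable_X) simp
  have [measurable]: "low t (- x) \<in> events" using assms(3) by (intro low_events) simp
  show "(\<lambda>\<omega>. zero_ext f (X t \<omega>) * indicator (space M - low t (- x)) \<omega>) \<in> borel_measurable M"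
    by measurable
  have "touch t (- x) \<in> null_sets M"
    using prob_touch_eq_0[of t "- x"] assms(2,3) touch_events[of t "- x"]
    by (simp add: null_sets_def emeasure_eq_measure)
  then have "AE \<omega> in M. \<omega> \<notin> touch t (- x)" by (rule AE_not_in)
  with assms(1) AE_space show "AE \<omega> in M. f (killed X t \<omega>) = zero_ext f (X t \<omega>) * indicator (space M - low t (- x)) \<omega>"
    by eventually_elim (use assms in \<open>auto intro!: killed_eq_not_low\<close>)
qed

text \<open>Split by the level at time t: up to d the function is at most e in modulus, and above d,
  where only B is available, the path has to have returned.\<close>

lemma integral_low_le:
  assumes "AE \<omega> in M. X 0 \<omega> = x" "t \<ge> 0" and [measurable]: "g \<in> borel_measurable borel"
    and B: "\<And>y. \<bar>g y\<bar> \<le> B" and e: "e \<ge> 0" "\<And>y. y \<le> d \<Longrightarrow> \<bar>g y\<bar> \<le> e"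
  shows "\<bar>LINT \<omega>|M. g (X t \<omega>) * indicator (low t (- x)) \<omega>\<bar> \<le>
    e * prob (low t (- x)) + B * prob (low t (- x) \<inter> {\<omega> \<in> space M. X t \<omega> - X 0 \<omega> > d - x})"
proof -
  let ?V = "low t (- x)" and ?H = "{\<omega> \<in> space M. X t \<omega> - X 0 \<omega> > d - x}"
  have [measurable]: "X t \<in> borel_measurable M" using assms(2) by (intro measurable_X) simp
  have V[measurable]: "?V \<in> events" using assms(2) by (intro low_events) simp
  have H[measurable]: "?H \<in> events" by measurable
  have "B \<ge> 0" using B[of 0] by linarith
  have intg: "integrable M (\<lambda>\<omega>. g (X t \<omega>) * indicator ?V \<omega>)"
    using B \<open>B \<ge> 0\<close> by (intro integrable_const_bound[of _ B]) (auto simp: abs_mult indicator_def)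
  have int: "integrable M (indicat_real S)" if "S \<in> events" for S
    using that by (intro integrable_const_bound[of _ 1]) auto
  have "\<bar>LINT \<omega>|M. g (X t \<omega>) * indicator ?V \<omega>\<bar> \<le> (LINT \<omega>|M. norm (g (X t \<omega>) * indicator ?V \<omega>))"
    using integral_norm_bound[of M "\<lambda>\<omega>. g (X t \<omega>) * indicator ?V \<omega>"] by simp
  also have "\<dots> \<le> (LINT \<omega>|M. e * indicator ?V \<omega> + B * indicator (?V \<inter> ?H) \<omega>)"
  proof (rule integral_mono_AE)
    show "integrable M (\<lambda>\<omega>. norm (g (X t \<omega>) * indicator ?V \<omega>))" using intg by (rule integrable_norm)
    show "integrable M (\<lambda>\<omega>. e * indicator ?V \<omega> + B * indicator (?V \<inter> ?H) \<omega>)"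
      by (intro Bochner_Integration.integrable_add integrable_mult_right int sets.Int V H)
    from assms(1) AE_space show "AE \<omega> in M. norm (g (X t \<omega>) * indicator ?V \<omega>) \<le> e * indicator ?V \<omega> + B * indicator (?V \<inter> ?H) \<omega>"
    proof eventually_elim
      case (elim \<omega>)
      show ?case
      proof (cases "X t \<omega> \<le> d")
        case True
        then show ?thesis using e \<open>B \<ge> 0\<close> by (auto simp: indicator_def abs_mult intro: add_increasing2)
      next
        case False
        then have "\<omega> \<in> ?H" using elim by auto
        then show ?thesis using B e(1) by (auto simp: indicator_def abs_mult intro: add_increasing)
      qed
    qed
  qed
  also have "\<dots> = e * prob ?V + B * prob (?V \<inter> ?H)"
    using int[OF V] int[OF sets.Int[OF V H]] V H by simp
  finally show ?thesis .
qed

lemma tendsto_integral_low: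
  assumes start: "AE \<omega> in M. X 0 \<omega> = x" and "x > 0" and cont: "continuous_on UNIV g"
    and B: "\<And>y. \<bar>g y\<bar> \<le> B" and neg: "\<And>y. y \<le> 0 \<Longrightarrow> g y = 0"
  shows "((\<lambda>t. (LINT \<omega>|M. g (X t \<omega>) * indicator (low t (- x)) \<omega>) / t) \<longlongrightarrow> 0) (at_right 0)"
proof (rule tendstoI)
  fix \<epsilon> :: real assume "\<epsilon> > 0"
  have [measurable]: "g \<in> borel_measurable borel" using cont by (rule borel_measurable_continuous_onI)
  obtain K \<delta> where K: "K \<ge> 0" "\<delta> > 0" "\<And>t. 0 \<le> t \<Longrightarrow> t \<le> \<delta> \<Longrightarrow> prob (low t (- x)) \<le> K * t"
    by (rule prob_low_le[of "- x"]) (use assms in auto)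
  \<comment> \<open>With this choice e K < \<epsilon> / 2; adding 1 covers K = 0.\<close>
  define e where "e = \<epsilon> / (2 * (K + 1))"
  have e: "e > 0" using \<open>\<epsilon> > 0\<close> K(1) by (simp add: e_def)
  have "isCont g 0" using cont by (simp add: continuous_on_eq_continuous_at)
  then obtain d where d: "d > 0" "\<And>y. \<bar>y\<bar> < d \<Longrightarrow> \<bar>g y\<bar> < e"
    using e neg[of 0] unfolding continuous_at_eps_delta by (auto simp: dist_real_def)
  \<comment> \<open>Half of d leaves room for a non-strict condition on y; at negative y the
    function vanishes.\<close>
  have ge: "\<bar>g y\<bar> \<le> e" if "y \<le> d / 2" for y
    using that d(1) d(2)[of y] neg[of y] e by (cases "y \<le> 0") auto
  obtain K' \<delta>' where K': "K' \<ge> 0" "\<delta>' > 0"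
    "\<And>t. 0 \<le> t \<Longrightarrow> t \<le> \<delta>' \<Longrightarrow> prob (low t (- x) \<inter> {\<omega> \<in> space M. X t \<omega> - X 0 \<omega> > d / 2 - x}) \<le> K' * t\<^sup>2"
    by (rule prob_low_and_high_le[of "- x" "d / 2 - x"]) (use assms d in auto)
  have "B \<ge> 0" using B[of 0] by linarith
  have "((\<lambda>t. e * K + B * K' * t) \<longlongrightarrow> e * K + B * K' * 0) (at_right 0)"
    by (intro tendsto_intros)
  moreover have "e * K + B * K' * 0 < \<epsilon>"
    using K(1) \<open>\<epsilon> > 0\<close> by (simp add: e_def field_simps add_nonneg_pos)
  ultimately have "eventually (\<lambda>t. e * K + B * K' * t < \<epsilon>) (at_right 0)"
    by (rule order_tendstoD)
  moreover have "eventually (\<lambda>t. 0 < t \<and> t < min \<delta> \<delta>') (at_right (0::real))"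
    using K(2) K'(2) by (auto simp: eventually_at_right[of 0 1] intro!: exI[of _ "min \<delta> \<delta>'"])
  ultimately show "eventually (\<lambda>t. dist ((LINT \<omega>|M. g (X t \<omega>) * indicator (low t (- x)) \<omega>) / t) 0 < \<epsilon>) (at_right 0)"
  proof eventually_elim
    case (elim t)
    have "\<bar>LINT \<omega>|M. g (X t \<omega>) * indicator (low t (- x)) \<omega>\<bar> \<le>
       e * prob (low t (- x)) + B * prob (low t (- x) \<inter> {\<omega> \<in> space M. X t \<omega> - X 0 \<omega> > d / 2 - x})"
      using elim e by (intro integral_low_le[OF start] B ge) auto
    also have "\<dots> \<le> e * (K * t) + B * (K' * t\<^sup>2)"
      using elim e \<open>B \<ge> 0\<close> by (intro add_mono mult_left_mono K(3) K'(3)) auto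
    also have "\<dots> = (e * K + B * K' * t) * t" by (simp add: algebra_simps power2_eq_square)
    also have "\<dots> < \<epsilon> * t" using elim by (intro mult_strict_right_mono) auto
    finally show ?case using elim by (simp add: dist_real_def abs_divide divide_less_eq)
  qed
qed

end

section \<open>Limits of the difference quotients\<close>

lemma stable_family_stable_process:
  assumes "0 < \<alpha>" "\<alpha> < 2" "0 < cp + cm" "stable_family \<alpha> cp cm P X"
  shows "stable_process (P x) X \<alpha> cp cm"
proof -
  have levy: "levy_process (P x) X" and start: "AE \<omega> in P x. X 0 \<omega> = x"
    and char: "\<And>t l. t \<ge> 0 \<Longrightarrow> char (distr (P x) borel (\<lambda>\<omega>. X t \<omega> - x)) l = exp (of_real t * stable_exponent \<alpha> cp cm l)"
    using assms(4) by (auto simp: stable_family_def)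
  have X[measurable]: "X t \<in> borel_measurable (P x)" if "t \<ge> 0" for t
    using levy that by (simp add: levy_process_def)
  interpret prob_space "P x" using levy by (simp add: levy_process_def)
  show ?thesis
  proof
    fix t l :: real assume t: "t \<ge> 0"
    have "distr (P x) borel (\<lambda>\<omega>. X t \<omega> - X 0 \<omega>) = distr (P x) borel (\<lambda>\<omega>. X t \<omega> - x)"
      using start X[OF t] X[of 0] by (intro distr_cong_AE) (auto elim!: eventually_mono)
    then show "char (distr (P x) borel (\<lambda>\<omega>. X t \<omega> - X 0 \<omega>)) l = exp (of_real t * stable_exponent \<alpha> cp cm l)"
      using char[OF t] by simp
  qed (use assms levy in auto)
qed

text \<open>For x > 0 the two quotients subtract the same value f x and differ exactly by the
  integral of the extended function over \<open>low t (- x)\<close>, divided by t.\<close>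

lemma killed_quotient_tendsto:
  assumes "0 < \<alpha>" "\<alpha> < 2" "0 < cp + cm" "stable_family \<alpha> cp cm P X"
    and g: "continuous_on UNIV (zero_ext f)" "bounded (range (zero_ext f))" and "f 0 = 0" "x > 0"
    and lim: "(free_quotient P X (zero_ext f) x \<longlongrightarrow> l) (at_right 0)"
  shows "(killed_quotient P X f x \<longlongrightarrow> l) (at_right 0)"
proof -
  interpret stable_process "P x" X \<alpha> cp cm by (rule stable_family_stable_process) fact+
  have start: "AE \<omega> in P x. X 0 \<omega> = x" using assms(4) by (simp add: stable_family_def)
  obtain B where B: "\<And>y. \<bar>zero_ext f y\<bar> \<le> B" using g(2) by (auto simp: bounded_iff)
  have [measurable]: "zero_ext f \<in> borel_measurable borel" using g(1) by (rule borel_measurable_continuous_onI)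
  let ?R = "\<lambda>t. (LINT \<omega>|P x. zero_ext f (X t \<omega>) * indicator (low t (- x)) \<omega>) / t"
  have "(?R \<longlongrightarrow> 0) (at_right 0)"
    by (rule tendsto_integral_low[OF start assms(8) g(1) B]) (simp add: zero_ext_def)
  from tendsto_diff[OF lim this] have "((\<lambda>t. free_quotient P X (zero_ext f) x t - ?R t) \<longlongrightarrow> l) (at_right 0)" by simp
  moreover have "eventually (\<lambda>t. free_quotient P X (zero_ext f) x t - ?R t = killed_quotient P X f x t) (at_right 0)"
    using eventually_at_right_less[of "0::real"]
  proof eventually_elim
    case (elim t)
    have [measurable]: "X t \<in> borel_measurable (P x)" using elim by (intro measurable_X) simp
    have low: "low t (- x) \<in> events" using elim by (intro low_events) simp
    have int: "integrable (P x) (\<lambda>\<omega>. zero_ext f (X t \<omega>))"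
      using B by (intro integrable_const_bound[of _ B]) auto
    have int2: "integrable (P x) (\<lambda>\<omega>. zero_ext f (X t \<omega>) * indicator (low t (- x)) \<omega>)"
      using integrable_mult_indicator[OF low int] by (simp add: mult.commute)
    have "(LINT \<omega>|completion (P x). f (killed X t \<omega>)) = (LINT \<omega>|P x. zero_ext f (X t \<omega>) * indicator (space (P x) - low t (- x)) \<omega>)"
      using elim assms(7,8) by (intro integral_killed start) auto
    also have "\<dots> = (LINT \<omega>|P x. zero_ext f (X t \<omega>) - zero_ext f (X t \<omega>) * indicator (low t (- x)) \<omega>)"
      by (intro Bochner_Integration.integral_cong) (auto simp: indicator_def)
    also have "\<dots> = (LINT \<omega>|P x. zero_ext f (X t \<omega>)) - (LINT \<omega>|P x. zero_ext f (X t \<omega>) * indicator (low t (- x)) \<omega>)"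
      by (rule Bochner_Integration.integral_diff[OF int int2])
    finally show ?case using assms(8)
      by (simp add: free_quotient_def killed_quotient_def zero_ext_def[of f x] diff_divide_distrib)
  qed
  ultimately show ?thesis by (rule Lim_transform_eventually)
qed

text \<open>Almost every path started at 0 has exit time 0, so the quotient is 0 for every t > 0 and
  not only in the limit.\<close>

lemma killed_generator_0:
  assumes "stable_family \<alpha> cp cm P X" "f 0 = 0"
  shows "killed_generator P X f 0 = 0"
proof -
  have start: "AE \<omega> in P 0. X 0 \<omega> = 0" using assms(1) by (simp add: stable_family_def)
  have "eventually (\<lambda>t. 0 = killed_quotient P X f 0 t) (at_right 0)"
    using eventually_at_right_less[of "0::real"]
  proof eventually_elim
    case (elim t)
    have "AE \<omega> in P 0. f (killed X t \<omega>) = 0"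
      using start by eventually_elim (use elim assms(2) killed_eq_0[of 0 t X] in auto)
    then have "(LINT \<omega>|completion (P 0). f (killed X t \<omega>)) = 0"
      by (intro integral_eq_zero_AE AE_completion)
    then show ?case using assms(2) by (simp add: killed_quotient_def)
  qed
  then have "(killed_quotient P X f 0 \<longlongrightarrow> 0) (at_right 0)"
    by (rule Lim_transform_eventually[OF tendsto_const])
  then show ?thesis unfolding killed_generator_def by (intro tendsto_Lim) auto
qed

section \<open>Change of variables in the integral operator\<close>

lemma stable_density_scale:
  assumes "x > 0"
  shows "stable_density \<alpha> cp cm (x * v) = x powr (- \<alpha> - 1) * stable_density \<alpha> cp cm v"
proof (cases "v < 0")
  case True
  have "\<bar>x * v\<bar> powr q = x powr q * \<bar>v\<bar> powr q" for q
    using assms by (simp add: abs_mult powr_mult)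
  moreover have "x * v < 0" using True assms by (simp add: mult_pos_neg)
  ultimately show ?thesis using True by (simp add: stable_density_def)
qed (use assms in \<open>auto simp: stable_density_def zero_less_mult_iff mult_less_0_iff powr_mult\<close>)

text \<open>After y = x v the cutoff |y| < 1 reads |x v| < 1, while the target formula has |v| < 1;
  T is the cost of the change. For \<alpha> < 1 the two cutoffs are integrated separately, for
  \<alpha> > 1 their complements. At \<alpha> = 1 convergence is enough, as T will be multiplied by
  c_+ - c_- = 0.\<close>

lemma has_bochner_integral_truncation_difference:
  assumes "0 < \<alpha>" "x > 0"
  obtains T where "has_bochner_integral lpos (\<lambda>v. (v * (indicator {v. \<bar>x * v\<bar> < 1} v - indicator {v. \<bar>v\<bar> < 1} v)) * v powr (- \<alpha> - 1)) T"
    and "\<alpha> \<noteq> 1 \<Longrightarrow> T = (x powr (\<alpha> - 1) - 1) / (1 - \<alpha>)"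
proof -
  let ?h = "\<lambda>v. (v * (indicator {v. \<bar>x * v\<bar> < 1} v - indicator {v. \<bar>v\<bar> < 1} v)) * v powr (- \<alpha> - 1)"
  have powr: "v * v powr (- \<alpha> - 1) = v powr (- \<alpha>)" if "v > 0" for v :: real
  proof -
    have "v * v powr (- \<alpha> - 1) = v powr 1 * v powr (- \<alpha> - 1)" using that by simp
    also have "\<dots> = v powr (- \<alpha>)" by (subst powr_add[symmetric]) simp
    finally show ?thesis .
  qed
  have inv: "(x * v) powr (- \<alpha>) * x powr \<alpha> = v powr (- \<alpha>)" if "v > 0" for v :: real
    using that assms(2) by (simp add: powr_mult powr_minus)
  have xa: "x powr \<alpha> / x = x powr (\<alpha> - 1)" using assms(2) by (simp add: powr_diff)
  consider "\<alpha> < 1" | "\<alpha> > 1" | "\<alpha> = 1" by linarith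
  then show ?thesis
  proof cases
    case 1
    have *: "has_bochner_integral lpos (\<lambda>v. indicator {..<1} v * v powr (- \<alpha>)) (1 / (- \<alpha> + 1))"
      using 1 by (intro has_bochner_integral_lpos_powr_lt1) auto
    have "has_bochner_integral lpos (\<lambda>v. (indicator {..<1} (x * v) * (x * v) powr (- \<alpha>)) * x powr \<alpha> - indicator {..<1} v * v powr (- \<alpha>))
        ((1 / (- \<alpha> + 1) /\<^sub>R x) * x powr \<alpha> - 1 / (- \<alpha> + 1))"
      by (intro has_bochner_integral_diff has_bochner_integral_mult_left * has_bochner_integral_lpos_scale[OF assms(2), THEN iffD1, OF *])
    also have "?this \<longleftrightarrow> has_bochner_integral lpos ?h ((x powr (\<alpha> - 1) - 1) / (1 - \<alpha>))"
    proof (rule has_bochner_integral_lpos_cong)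
      show "(indicator {..<1} (x * v) * (x * v) powr (- \<alpha>)) * x powr \<alpha> - indicator {..<1} v * v powr (- \<alpha>) = ?h v" if "v > 0" for v
        using that assms(2) inv[OF that] powr[OF that] by (auto simp: indicator_def abs_mult)
      show "(1 / (- \<alpha> + 1) /\<^sub>R x) * x powr \<alpha> - 1 / (- \<alpha> + 1) = (x powr (\<alpha> - 1) - 1) / (1 - \<alpha>)"
        unfolding xa[symmetric] by (simp add: divide_inverse algebra_simps)
    qed
    finally show ?thesis using that by blast
  next
    case 2
    have *: "has_bochner_integral lpos (\<lambda>v. indicator {1..} v * v powr (- \<alpha>)) (- 1 / (- \<alpha> + 1))"
      using 2 by (intro has_bochner_integral_lpos_powr_ge1) auto
    have "has_bochner_integral lpos (\<lambda>v. indicator {1..} v * v powr (- \<alpha>) - (indicator {1..} (x * v) * (x * v) powr (- \<alpha>)) * x powr \<alpha>)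
        (- 1 / (- \<alpha> + 1) - (- 1 / (- \<alpha> + 1) /\<^sub>R x) * x powr \<alpha>)"
      by (intro has_bochner_integral_diff has_bochner_integral_mult_left * has_bochner_integral_lpos_scale[OF assms(2), THEN iffD1, OF *])
    also have "?this \<longleftrightarrow> has_bochner_integral lpos ?h ((x powr (\<alpha> - 1) - 1) / (1 - \<alpha>))"
    proof (rule has_bochner_integral_lpos_cong)
      show "indicator {1..} v * v powr (- \<alpha>) - (indicator {1..} (x * v) * (x * v) powr (- \<alpha>)) * x powr \<alpha> = ?h v" if "v > 0" for v
        using that assms(2) inv[OF that] powr[OF that] by (auto simp: indicator_def abs_mult)
      show "- 1 / (- \<alpha> + 1) - (- 1 / (- \<alpha> + 1) /\<^sub>R x) * x powr \<alpha> = (x powr (\<alpha> - 1) - 1) / (1 - \<alpha>)"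
        unfolding xa[symmetric] by (simp add: divide_inverse algebra_simps)
    qed
    finally show ?thesis using that by blast
  next
    case 3
    have h: "?h v = (indicator {v. \<bar>x * v\<bar> < 1} v - indicator {v. \<bar>v\<bar> < 1} v) * v powr (- 1)" if "v > 0" for v
    proof -
      have "?h v = (indicator {v. \<bar>x * v\<bar> < 1} v - indicator {v. \<bar>v\<bar> < 1} v) * (v * v powr (- \<alpha> - 1))"
        by (simp only: mult_ac)
      also have "v * v powr (- \<alpha> - 1) = v powr (- 1)"
        unfolding powr[OF that] by (simp only: 3)
      finally show ?thesis .
    qed
    have "integrable lpos ?h"
    \<comment> \<open>For v < 1 the indicators differ only if x v \<ge> 1, where 1 / v \<le> x; for
      v \<ge> 1 only if x v < 1, where 1 / v \<le> 1 / (x v^2).\<close>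
    proof (rule integrable_lpos_powr_split(1)[where p = 0 and K = x and q = "- 2" and K' = "1 / x"])
      show "\<bar>?h v\<bar> \<le> x * v powr 0" if "0 < v" "v < 1" for v
        using that assms(2) unfolding h[OF that(1)] by (auto simp: indicator_def abs_mult powr_minus field_simps)
      show "\<bar>?h v\<bar> \<le> 1 / x * v powr (- 2)" if "1 \<le> v" for v
      proof -
        have v: "v > 0" using that by simp
        have p: "v powr (- 2) = 1 / (v * v)" "v powr (- 1) = 1 / v"
          using v by (simp_all add: powr_minus power2_eq_square divide_inverse)
        have "1 / v \<le> 1 / x * (1 / (v * v))" if "x * v < 1"
          using that v assms(2) by (simp add: field_simps)
        then show ?thesis
          unfolding h[OF v] p using that assms(2) by (auto simp: indicator_def abs_mult)
      qed
    qed auto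
    then show ?thesis using that 3 by (auto simp: has_bochner_integral_iff)
  qed
qed

text \<open>The range u \<le> 0 corresponds to jumps y = u - 1 \<le> -1, those that carry 1 out of
  the positive half-line; only c_- contributes to their total rate.\<close>

lemma has_bochner_integral_stable_density_left:
  assumes "\<alpha> > 0"
  shows "has_bochner_integral lborel (\<lambda>u. indicator {..0} u * stable_density \<alpha> cp cm (u - 1)) (cm / \<alpha>)"
proof -
  have "has_bochner_integral lborel (\<lambda>y. indicator {..-1} y * stable_density \<alpha> cp cm y) (cp * 0 + cm * (- 1 / ((- \<alpha> - 1) + 1)))"
  proof (rule has_bochner_integral_stable_density)
    show "has_bochner_integral lpos (\<lambda>y. indicator {..- 1} y * y powr (- \<alpha> - 1)) 0"
      by (subst has_bochner_integral_lpos_cong[where g = "\<lambda>_. 0" and b = 0]) (auto simp: indicator_def)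
    show "has_bochner_integral lpos (\<lambda>y. indicator {..- 1} (- y) * y powr (- \<alpha> - 1)) (- 1 / ((- \<alpha> - 1) + 1))"
      using has_bochner_integral_lpos_powr_ge1[of "- \<alpha> - 1"] assms
      by (subst has_bochner_integral_lpos_cong[where g = "\<lambda>y. indicator {1..} y * y powr (- \<alpha> - 1)" and b = "- 1 / ((- \<alpha> - 1) + 1)"]) (auto simp: indicator_def)
  qed
  then have "has_bochner_integral lborel (\<lambda>u. indicator {..-1} (- 1 + 1 * u) * stable_density \<alpha> cp cm (- 1 + 1 * u)) ((cp * 0 + cm * (- 1 / ((- \<alpha> - 1) + 1))) /\<^sub>R \<bar>1\<bar>)"
    by (subst (asm) lborel_has_bochner_integral_real_affine_iff[of 1 _ _ "- 1"]) auto
  also have "?this \<longleftrightarrow> ?thesis"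
    using assms by (intro has_bochner_integral_cong) (auto simp: indicator_def)
  finally show ?thesis .
qed

text \<open>Homogeneity of the density produces the factor x^(-\<alpha>). The cutoff has to be
  changed as well, and this correction replaces the drift a by a x^(1 - \<alpha>).\<close>

lemma levy_integral_conv_killed:
  assumes "0 < \<alpha>" "\<alpha> < 2" "x > 0" "\<alpha> = 1 \<Longrightarrow> cp = cm"
    and int: "integrable lborel (levy_integrand \<alpha> cp cm (zero_ext f) x)"
  shows "set_integrable lborel {0<..} (killed_integrand \<alpha> cp cm f x)"
    and "stable_drift \<alpha> cp cm * deriv (zero_ext f) x + (LINT y|lborel. levy_integrand \<alpha> cp cm (zero_ext f) x y)
      = (LBINT u:{0<..}. killed_integrand \<alpha> cp cm f x u) + stable_drift \<alpha> cp cm * x powr (1 - \<alpha>) * deriv f x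
        - cm / \<alpha> * x powr (- \<alpha>) * f x"
proof -
  define D where "D = deriv f x"
  define I where "I = (LINT y|lborel. levy_integrand \<alpha> cp cm (zero_ext f) x y)"
  define s where "s = stable_density \<alpha> cp cm"
  have "eventually (\<lambda>y. y > 0) (nhds x)" using assms(3) by (rule eventually_nhds_in_open[of "{0<..}", simplified, rotated]) simp
  then have D: "deriv (zero_ext f) x = D"
    unfolding D_def by (intro deriv_cong_ev) (auto simp: zero_ext_def elim!: eventually_mono)
  have "has_bochner_integral lborel (levy_integrand \<alpha> cp cm (zero_ext f) x) I"
    using int by (simp add: has_bochner_integral_iff I_def)
  then have "has_bochner_integral lborel (\<lambda>u. levy_integrand \<alpha> cp cm (zero_ext f) x (- x + x * u)) (I /\<^sub>R \<bar>x\<bar>)"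
    using assms(3) by (subst (asm) lborel_has_bochner_integral_real_affine_iff[of x _ _ "- x"]) auto
  then have "has_bochner_integral lborel (\<lambda>u. x * levy_integrand \<alpha> cp cm (zero_ext f) x (- x + x * u)) (x * (I /\<^sub>R \<bar>x\<bar>))"
    by (rule has_bochner_integral_mult_right)
  also have "x * (I /\<^sub>R \<bar>x\<bar>) = I" using assms(3) by simp
  also have "(\<lambda>u. x * levy_integrand \<alpha> cp cm (zero_ext f) x (- x + x * u)) =
     (\<lambda>u. x powr (- \<alpha>) * (zero_ext f (x * u) - f x - x * (u - 1) * D * indicator {v. \<bar>x * v\<bar> < 1} (u - 1)) * s (u - 1))"
  proof
    fix u
    have e: "- x + x * u = x * (u - 1)" by (simp add: algebra_simps)
    have e1: "x + x * (u - 1) = x * u" by (simp add: algebra_simps)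
    have e2: "indicator {y. \<bar>y\<bar> < 1} (x * (u - 1)) = (indicator {v. \<bar>x * v\<bar> < 1} (u - 1) :: real)"
      by (simp add: indicator_def)
    have e3: "x powr (- \<alpha>) = x * x powr (- \<alpha> - 1)" using assms(3) by (simp add: powr_diff)
    have e4: "zero_ext f x = f x" using assms(3) by (simp add: zero_ext_def)
    show "x * levy_integrand \<alpha> cp cm (zero_ext f) x (- x + x * u) =
      x powr (- \<alpha>) * (zero_ext f (x * u) - f x - x * (u - 1) * D * indicator {v. \<bar>x * v\<bar> < 1} (u - 1)) * s (u - 1)"
      unfolding levy_integrand_def e e1 e2 e3 e4 stable_density_scale[OF assms(3)] D s_def by (simp only: mult_ac)
  qed
  finally have G: "has_bochner_integral lborel
     (\<lambda>u. x powr (- \<alpha>) * (zero_ext f (x * u) - f x - x * (u - 1) * D * indicator {v. \<bar>x * v\<bar> < 1} (u - 1)) * s (u - 1)) I" .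
  obtain T where T: "has_bochner_integral lpos (\<lambda>v. (v * (indicator {v. \<bar>x * v\<bar> < 1} v - indicator {v. \<bar>v\<bar> < 1} v)) * v powr (- \<alpha> - 1)) T"
    and Teq: "\<alpha> \<noteq> 1 \<Longrightarrow> T = (x powr (\<alpha> - 1) - 1) / (1 - \<alpha>)"
    by (rule has_bochner_integral_truncation_difference[OF assms(1,3)]) auto
  let ?r = "\<lambda>v. v * (indicator {v. \<bar>x * v\<bar> < 1} v - indicator {v. \<bar>v\<bar> < 1} v) :: real"
  have "has_bochner_integral lborel (\<lambda>v. ?r v * s v) (cp * T + cm * - T)"
    unfolding s_def
  proof (rule has_bochner_integral_stable_density)
    show "has_bochner_integral lpos (\<lambda>v. ?r (- v) * v powr (- \<alpha> - 1)) (- T)"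
      using has_bochner_integral_minus[OF T] by (simp add: indicator_def)
  qed (rule T)
  then have R: "has_bochner_integral lborel (\<lambda>u. ?r (u - 1) * s (u - 1)) (cp * T + cm * - T)"
    by (subst (asm) lborel_has_bochner_integral_real_affine_iff[of 1 _ _ "- 1"]) auto
  have L: "has_bochner_integral lborel (\<lambda>u. indicator {..0} u * s (u - 1)) (cm / \<alpha>)"
    unfolding s_def by (rule has_bochner_integral_stable_density_left) fact
  \<comment> \<open>The first added term exchanges |x v| < 1 for |v| < 1; the second cancels - f x
    on u \<le> 0, where the extension vanishes and the new cutoff is 0.\<close>
  have "has_bochner_integral lborel
     (\<lambda>u. x powr (- \<alpha>) * (zero_ext f (x * u) - f x - x * (u - 1) * D * indicator {v. \<bar>x * v\<bar> < 1} (u - 1)) * s (u - 1)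
        + (x powr (- \<alpha>) * x * D) * (?r (u - 1) * s (u - 1)) + (x powr (- \<alpha>) * f x) * (indicator {..0} u * s (u - 1)))
     (I + (x powr (- \<alpha>) * x * D) * (cp * T + cm * - T) + (x powr (- \<alpha>) * f x) * (cm / \<alpha>))"
    by (intro has_bochner_integral_add has_bochner_integral_mult_right G R L)
  also have "(\<lambda>u. x powr (- \<alpha>) * (zero_ext f (x * u) - f x - x * (u - 1) * D * indicator {v. \<bar>x * v\<bar> < 1} (u - 1)) * s (u - 1)
        + (x powr (- \<alpha>) * x * D) * (?r (u - 1) * s (u - 1)) + (x powr (- \<alpha>) * f x) * (indicator {..0} u * s (u - 1)))
     = (\<lambda>u. indicator {0<..} u *\<^sub>R killed_integrand \<alpha> cp cm f x u)"
  proof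
    fix u :: real
    have i: "indicator {u. \<bar>u - 1\<bar> < 1} u = (indicator {v. \<bar>v\<bar> < 1} (u - 1) :: real)" by (simp add: indicator_def)
    have k: "killed_integrand \<alpha> cp cm f x u = x powr (- \<alpha>) * (f (u * x) - f x - x * D * (u - 1) * indicator {v. \<bar>v\<bar> < 1} (u - 1)) * s (u - 1)"
      unfolding killed_integrand_def i D_def s_def by (simp add: powr_minus_divide)
    show "x powr (- \<alpha>) * (zero_ext f (x * u) - f x - x * (u - 1) * D * indicator {v. \<bar>x * v\<bar> < 1} (u - 1)) * s (u - 1)
        + (x powr (- \<alpha>) * x * D) * (?r (u - 1) * s (u - 1)) + (x powr (- \<alpha>) * f x) * (indicator {..0} u * s (u - 1))
     = indicator {0<..} u *\<^sub>R killed_integrand \<alpha> cp cm f x u"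
    proof (cases "u > 0")
      case True
      then have "zero_ext f (x * u) = f (u * x)" using assms(3) by (simp add: zero_ext_def mult.commute)
      then show ?thesis using True unfolding k by (simp add: algebra_simps)
    next
      case False
      then have "zero_ext f (x * u) = 0" using assms(3) by (simp add: zero_ext_def zero_less_mult_iff)
      moreover have "indicator {v. \<bar>v\<bar> < 1} (u - 1) = (0::real)" using False by (simp add: indicator_def)
      ultimately show ?thesis using False by (simp add: algebra_simps)
    qed
  qed
  finally have K: "has_bochner_integral lborel (\<lambda>u. indicator {0<..} u *\<^sub>R killed_integrand \<alpha> cp cm f x u)
     (I + (x powr (- \<alpha>) * x * D) * (cp * T + cm * - T) + (x powr (- \<alpha>) * f x) * (cm / \<alpha>))" .
  then show "set_integrable lborel {0<..} (killed_integrand \<alpha> cp cm f x)"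
    by (simp add: set_integrable_def has_bochner_integral_iff)
  have "x powr (- \<alpha>) * x = x powr (1 - \<alpha>)" using assms(3) by (simp add: powr_diff powr_minus divide_inverse)
  then have K': "(LBINT u:{0<..}. killed_integrand \<alpha> cp cm f x u) = I + (x powr (1 - \<alpha>) * D) * ((cp - cm) * T) + (x powr (- \<alpha>) * f x) * (cm / \<alpha>)"
    using K by (simp add: set_lebesgue_integral_def has_bochner_integral_iff algebra_simps)
  \<comment> \<open>The cutoff correction is exactly the difference between the drifts a and a x^(1
    - \<alpha>); at \<alpha> = 1 both sides are 0 by symmetry.\<close>
  have "x powr (1 - \<alpha>) * ((cp - cm) * T) = stable_drift \<alpha> cp cm - stable_drift \<alpha> cp cm * x powr (1 - \<alpha>)"
  proof (cases "\<alpha> = 1")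
    case True
    then show ?thesis using assms(4) by (simp add: stable_drift_def)
  next
    case False
    have "x powr (1 - \<alpha>) * x powr (\<alpha> - 1) = 1" using assms(3) by (simp flip: powr_add)
    then have "x powr (1 - \<alpha>) * (x powr (\<alpha> - 1) - 1) = 1 - x powr (1 - \<alpha>)" by (simp add: right_diff_distrib)
    moreover have "x powr (1 - \<alpha>) * ((cp - cm) * T) = (cp - cm) / (1 - \<alpha>) * (x powr (1 - \<alpha>) * (x powr (\<alpha> - 1) - 1))"
      unfolding Teq[OF False] by simp
    ultimately show ?thesis using False by (simp add: stable_drift_def right_diff_distrib)
  qed
  then have "x powr (1 - \<alpha>) * D * ((cp - cm) * T) = D * (stable_drift \<alpha> cp cm - stable_drift \<alpha> cp cm * x powr (1 - \<alpha>))"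
    by (metis mult.assoc mult.commute)
  then show "stable_drift \<alpha> cp cm * deriv (zero_ext f) x + (LINT y|lborel. levy_integrand \<alpha> cp cm (zero_ext f) x y)
      = (LBINT u:{0<..}. killed_integrand \<alpha> cp cm f x u) + stable_drift \<alpha> cp cm * x powr (1 - \<alpha>) * deriv f x
        - cm / \<alpha> * x powr (- \<alpha>) * f x"
    unfolding K' D I_def[symmetric] D_def[symmetric] by (simp add: algebra_simps)
qed

theorem theorem3:
  fixes \<alpha> cp cm :: real
    and P :: "real \<Rightarrow> 'a measure"
    and X :: "real \<Rightarrow> 'a \<Rightarrow> real"
    and f :: "real \<Rightarrow> real"
  assumes "0 < \<alpha>" and "\<alpha> < 2"
    and "0 \<le> cp" and "0 \<le> cm" and "0 < cp + cm"
    and "\<alpha> = 1 \<Longrightarrow> cp = cm"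
    and "stable_family \<alpha> cp cm P X"
    and "\<not> subordinator (P 0) X"
    and "\<not> subordinator (P 0) (\<lambda>t \<omega>. - X t \<omega>)"
    and "f \<in> killed_generator_domain P X"
    and "zero_ext f \<in> generator_domain \<alpha> cp cm P X"
  shows "(\<forall>x>0. killed_generator P X f x =
            generator P X (zero_ext f) x
            - f x / x powr \<alpha> * (kill_const \<alpha> cp cm (neg_prob P X) - cm / \<alpha>))
       \<and> killed_generator P X f 0 = 0
       \<and> (\<forall>x>0. set_integrable lborel {0<..} (killed_integrand \<alpha> cp cm f x)
            \<and> killed_generator P X f x =
                (LBINT u:{0<..}. killed_integrand \<alpha> cp cm f x u)
                + stable_drift \<alpha> cp cm * x powr (1 - \<alpha>) * deriv f x
                - kill_const \<alpha> cp cm (neg_prob P X) * x powr (-\<alpha>) * f x)"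
proof -
  have k: "kill_const \<alpha> cp cm (neg_prob P X) = cm / \<alpha>"
    by (rule kill_const_neg_prob) (use assms in auto)
  have f0: "f 0 = 0" using assms(10) by (simp add: killed_generator_domain_def)
  have g: "continuous_on UNIV (zero_ext f)" "bounded (range (zero_ext f))"
    and int: "\<And>x. integrable lborel (levy_integrand \<alpha> cp cm (zero_ext f) x)"
    and lim: "\<And>x. (free_quotient P X (zero_ext f) x \<longlongrightarrow> stable_drift \<alpha> cp cm * deriv (zero_ext f) x
        + (LINT y|lborel. levy_integrand \<alpha> cp cm (zero_ext f) x y)) (at_right 0)"
    using assms(11) unfolding generator_domain_def by auto
  have free: "generator P X (zero_ext f) x = stable_drift \<alpha> cp cm * deriv (zero_ext f) x
        + (LINT y|lborel. levy_integrand \<alpha> cp cm (zero_ext f) x y)" for x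
    unfolding generator_def by (intro tendsto_Lim lim) simp
  have killed: "killed_generator P X f x = stable_drift \<alpha> cp cm * deriv (zero_ext f) x
        + (LINT y|lborel. levy_integrand \<alpha> cp cm (zero_ext f) x y)" if "x > 0" for x
    unfolding killed_generator_def
    by (intro tendsto_Lim killed_quotient_tendsto[OF assms(1,2,5,7) g f0 that lim]) simp
  show ?thesis
    unfolding k using killed free killed_generator_0[of \<alpha> cp cm P X f, OF assms(7) f0]
      levy_integral_conv_killed[OF assms(1,2) _ assms(6) int]
    by simp
qed

end
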